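(* Let $\ell\ge1$, $m\geq 2$, and let $B$, $\overline{R}$, $\overline{\mathfrak{m}}$, $\overline{V}$, $\overline{h}$, $U_m(B)$ be as in the context. Let $u\in\overline{V}$ be a primitive vector, let $t=\overline{h}(u,u)$, and let $S_u$ be the stabilizer of $u$ in $U_m(B)$. Suppose $t\in\overline{\mathfrak{m}}$. (i) If $\ell=2f-1$ is odd and $m$ is odd, then $$[U_m(B):S_u]=q^{m\ell-m-\ell+f}(q^{m-1}-1).$$ (ii) If $\ell=2f-1$ is odd and $m=2r$ is even, then $$[U_m(B):S_u]=\begin{cases} q^{m\ell-m-\ell+f}(q^r-1)(q^{r-1}+1) & \text{if } \overline{h}\text{ is of kind I},\\ q^{m\ell-m-\ell+f}(q^r+1)(q^{r-1}-1) & \text{if } \overline{h}\text{ is of kind II}.\end{cases}$$ (iii) If $\ell=2f$ is even and $m$ is odd, then $$[U_m(B):S_u]=q^{\ell m-m-\ell+f+1}(q^{m-1}-1).$$ (iv) If $\ell=2f$ is even and $m=2r$ is even, then $$[U_m(B):S_u]=\begin{cases} q^{\ell m-m-\ell+f+1}(q^r-1)(q^{r-1}+1) & \text{if } \overline{h}\text{ is of kind I},\\ q^{\ell m-m-\ell+f+1}(q^r+1)(q^{r-1}-1) & \text{if } \overline{h}\text{ is of kind II}.\end{cases}$$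
   Context: $K$ is a non-archimedean local field with ring of integers $\mathcal{O}$, maximal ideal $\mathfrak{p}$ and residue field $F_q$ of odd characteristic; $F$ is a ramified quadratic extension of $K$ with ring of integers $\mathcal{R}=\mathcal{O}[\rho]$, where $\rho^2=\pi$ is a prime element of $\mathcal{O}$, and maximal ideal $\mathcal{P}=(\rho)$; $\mathcal{R}$ has the involution fixing $\mathcal{O}$ elementwise with $\rho\mapsto-\rho$. Put $A=\mathcal{R}/\mathcal{P}^{2\ell}$ with inherited involution $*$ and maximal ideal $\mathfrak{r}$, and $B=A/\mathfrak{r}^\ell\cong\mathcal{R}/\mathcal{P}^\ell$ with inherited involution $\circ$. Let $\overline{R}$ be the fixed ring of $\circ$ in $B$; it is local, with maximal ideal denoted $\overline{\mathfrak{m}}$. $V$ is a free $A$-module of rank $m$ with a non-degenerate $*$-hermitian form $h$ (biadditive, $A$-linear in the second variable, $h(v,u)=h(u,v)^*$, with $u\mapsto h(u,-)$ a bijection from $V$ onto $\mathrm{Hom}_A(V,A)$). $\overline{V}=V/V\mathfrak{r}^\ell$ is the free $B$-module of rank $m$ with the non-degenerate hermitian form $\overline{h}(v+V\mathfrak{r}^\ell,w+V\mathfrak{r}^\ell)=h(v,w)+\mathfrak{r}^\ell$. $U_m(B)$ is the unitary group of $(\overline{V},\overline{h})$, i.e. the group of $B$-linear automorphisms of $\overline{V}$ preserving $\overline{h}$. A vector of $\overline{V}$ is primitive if it belongs to a basis of $\overline{V}$. Kinds. Fix a unit $\epsilon$ of $\overline{R}$ that is not a square in $\overline{R}^*$.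 A non-degenerate hermitian form on a free $B$-module of rank $n$ is of kind I (resp. kind II) if relative to some basis its matrix is diagonal with diagonal entries: for $n$ even, $1,-1,\dots,1,-1$ (resp. $1,-1,\dots,1,-\epsilon$); for $n$ odd, $1,-1,\dots,1,-1,-1$ (resp. $1,-1,\dots,1,-1,-\epsilon$). Every such form is of exactly one kind. (When $m=2$, a primitive $u$ with $t\in\overline{\mathfrak{m}}$ exists only if $\overline{h}$ is of kind I.) (The indices $[U_m(B):S_u]$, divided by $2q^{\ell-f}$, are the degrees of the irreducible constituents of the top layer of the Weil representation of $U_m(A)$.) *)

theory Defs
  imports "HOL-Algebra.Algebra" "HOL-Analysis.Abstract_Metric_Spaces"
begin

section \<open>Non-archimedean local fields\<close>

text \<open>
  A normalised discrete valuation on a field \<open>K\<close> is given by its restriction \<open>v\<close> to the non-zero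
  elements; \<open>v \<zero>\<close> is junk, and zero is always treated separately.
\<close>

definition val_ring :: "('a, 'c) ring_scheme \<Rightarrow> ('a \<Rightarrow> int) \<Rightarrow> ('a, 'c) ring_scheme" where
  "val_ring K v = K\<lparr>carrier := {x \<in> carrier K. x = \<zero>\<^bsub>K\<^esub> \<or> v x \<ge> 0}\<rparr>"

definition val_ideal :: "('a, 'c) ring_scheme \<Rightarrow> ('a \<Rightarrow> int) \<Rightarrow> 'a set" where
  "val_ideal K v = {x \<in> carrier K. x = \<zero>\<^bsub>K\<^esub> \<or> v x > 0}"

definition residue_field :: "('a, 'c) ring_scheme \<Rightarrow> ('a \<Rightarrow> int) \<Rightarrow> 'a set ring" where
  "residue_field K v = val_ring K v Quot val_ideal K v"

definition val_dist :: "('a, 'c) ring_scheme \<Rightarrow> ('a \<Rightarrow> int) \<Rightarrow> 'a \<Rightarrow> 'a \<Rightarrow> real" where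
  "val_dist K v x y = (if x = y then 0 else 2 powr (- real_of_int (v (x \<ominus>\<^bsub>K\<^esub> y))))"

locale nonarch_local_field = field K for K (structure) +
  fixes v :: "'a \<Rightarrow> int"
  assumes v_mult: "\<lbrakk>x \<in> carrier K - {\<zero>}; y \<in> carrier K - {\<zero>}\<rbrakk> \<Longrightarrow> v (x \<otimes> y) = v x + v y"
    and v_add: "\<lbrakk>x \<in> carrier K - {\<zero>}; y \<in> carrier K - {\<zero>}; x \<oplus> y \<noteq> \<zero>\<rbrakk>
                  \<Longrightarrow> v (x \<oplus> y) \<ge> min (v x) (v y)"
    and v_surj: "v ` (carrier K - {\<zero>}) = UNIV"
    and complete: "Metric_space.mcomplete (carrier K) (val_dist K v)"
    and finite_residue_field: "finite (carrier (residue_field K v))"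


section \<open>Ramified quadratic extensions\<close>

definition ext_integers ::
  "('a, 'c) ring_scheme \<Rightarrow> 'a set \<Rightarrow> ('a \<Rightarrow> int) \<Rightarrow> 'a \<Rightarrow> ('a, 'c) ring_scheme" where
  "ext_integers F K v \<rho> =
     F\<lparr>carrier := ring.simple_extension F (carrier (val_ring (F\<lparr>carrier := K\<rparr>) v)) \<rho>\<rparr>"

text \<open>
  The ring of integers of \<open>F\<close> is \<open>ext_integers F K v \<rho>\<close>, i.e. the subring generated by \<open>\<rho>\<close> over the
  valuation ring of \<open>K\<close>.  Ramification is expressed by \<open>\<rho>\<close> being a square root of a prime element.
  The characteristic of the residue field is the additive order of its unit element.  The involution
  \<open>\<sigma>\<close> is determined on the ring of integers by the three conditions on it.
\<close>

locale ramified_quadratic_extension = field F for F (structure) +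
  fixes K :: "'a set" and v :: "'a \<Rightarrow> int" and \<pi> \<rho> :: 'a and \<sigma> :: "'a \<Rightarrow> 'a"
  assumes subfield: "subfield K F"
    and local_field: "nonarch_local_field (F\<lparr>carrier := K\<rparr>) v"
    and odd_residue_char:
      "odd (group.ord (add_monoid (residue_field (F\<lparr>carrier := K\<rparr>) v))
                      \<one>\<^bsub>residue_field (F\<lparr>carrier := K\<rparr>) v\<^esub>)"
    and quadratic: "dimension 2 K (carrier F)"
    and \<pi>_closed: "\<pi> \<in> carrier (val_ring (F\<lparr>carrier := K\<rparr>) v)"
    and \<pi>_prime: "ring_prime\<^bsub>val_ring (F\<lparr>carrier := K\<rparr>) v\<^esub> \<pi>"
    and \<rho>_closed: "\<rho> \<in> carrier F"
    and \<rho>_square: "\<rho> [^] (2::nat) = \<pi>"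
    and \<sigma>_hom: "\<sigma> \<in> ring_hom (ext_integers F K v \<rho>) (ext_integers F K v \<rho>)"
    and \<sigma>_fix: "\<And>x. x \<in> carrier (val_ring (F\<lparr>carrier := K\<rparr>) v) \<Longrightarrow> \<sigma> x = x"
    and \<sigma>_\<rho>: "\<sigma> \<rho> = \<ominus> \<rho>"


section \<open>Rings with involution\<close>

definition ideal_power :: "('a, 'c) ring_scheme \<Rightarrow> 'a set \<Rightarrow> nat \<Rightarrow> 'a set" where
  "ideal_power R I n = I [^]\<^bsub>ideals_set R\<^esub> n"

definition fixed_ring :: "('a, 'c) ring_scheme \<Rightarrow> ('a \<Rightarrow> 'a) \<Rightarrow> ('a, 'c) ring_scheme" where
  "fixed_ring R \<tau> = R\<lparr>carrier := {x \<in> carrier R. \<tau> x = x}\<rparr>"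


section \<open>Modules: bases, homomorphisms, reduction modulo an ideal\<close>

definition module_basis ::
  "('a, 'c) ring_scheme \<Rightarrow> ('a, 'b, 'd) module_scheme \<Rightarrow> nat \<Rightarrow> (nat \<Rightarrow> 'b) \<Rightarrow> bool" where
  "module_basis R M n b \<longleftrightarrow>
     (\<forall>i<n. b i \<in> carrier M) \<and>
     (\<forall>x \<in> carrier M. \<exists>!c. c \<in> {..<n} \<rightarrow>\<^sub>E carrier R \<and> x = (\<Oplus>\<^bsub>M\<^esub> i\<in>{..<n}. c i \<odot>\<^bsub>M\<^esub> b i))"

definition free_of_rank ::
  "('a, 'c) ring_scheme \<Rightarrow> ('a, 'b, 'd) module_scheme \<Rightarrow> nat \<Rightarrow> bool" where
  "free_of_rank R M n \<longleftrightarrow> module R M \<and> (\<exists>b. module_basis R M n b)"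

definition primitive_vector ::
  "('a, 'c) ring_scheme \<Rightarrow> ('a, 'b, 'd) module_scheme \<Rightarrow> 'b \<Rightarrow> bool" where
  "primitive_vector R M u \<longleftrightarrow> (\<exists>n b. module_basis R M n b \<and> u \<in> b ` {..<n})"

definition module_hom ::
  "('a, 'c) ring_scheme \<Rightarrow> ('a, 'b, 'd) module_scheme \<Rightarrow> ('a, 'e, 'f) module_scheme \<Rightarrow>
   ('b \<Rightarrow> 'e) set" where
  "module_hom R M N = {g \<in> carrier M \<rightarrow>\<^sub>E carrier N.
     (\<forall>x \<in> carrier M. \<forall>y \<in> carrier M. g (x \<oplus>\<^bsub>M\<^esub> y) = g x \<oplus>\<^bsub>N\<^esub> g y) \<and>
     (\<forall>a \<in> carrier R. \<forall>x \<in> carrier M. g (a \<odot>\<^bsub>M\<^esub> x) = a \<odot>\<^bsub>N\<^esub> g x)}"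

definition regular_module :: "('a, 'c) ring_scheme \<Rightarrow> ('a, 'a) module" where
  "regular_module R = \<lparr>carrier = carrier R, monoid.mult = monoid.mult R, one = one R,
                       ring.zero = ring.zero R, add = add R, smult = monoid.mult R\<rparr>"

definition ideal_smult ::
  "('a, 'b, 'd) module_scheme \<Rightarrow> 'a set \<Rightarrow> 'b set" where
  "ideal_smult M I = generate (add_monoid M) {a \<odot>\<^bsub>M\<^esub> x | a x. a \<in> I \<and> x \<in> carrier M}"

text \<open>
  \<open>M/MI\<close> as a module over \<open>R Quot I\<close>; its elements are the cosets of \<open>MI\<close>, and the scalar action of
  a coset is given by a union over representatives, in the style of \<^const>\<open>rcoset_mult\<close>.  The fields
  \<open>mult\<close> and \<open>one\<close> are only present because module records extend ring records.
\<close>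

definition quot_module ::
  "('a, 'b, 'd) module_scheme \<Rightarrow> 'a set \<Rightarrow> ('a set, 'b set) module" where
  "quot_module M I =
     \<lparr>carrier = a_rcosets\<^bsub>M\<^esub> (ideal_smult M I),
      monoid.mult = undefined, one = undefined,
      ring.zero = ideal_smult M I,
      add = set_add M,
      smult = (\<lambda>C D. \<Union>a\<in>C. \<Union>x\<in>D. ideal_smult M I +>\<^bsub>M\<^esub> (a \<odot>\<^bsub>M\<^esub> x))\<rparr>"


section \<open>Hermitian forms\<close>

definition hermitian_form ::
  "('a, 'c) ring_scheme \<Rightarrow> ('a \<Rightarrow> 'a) \<Rightarrow> ('a, 'b, 'd) module_scheme \<Rightarrow> ('b \<Rightarrow> 'b \<Rightarrow> 'a) \<Rightarrow> bool" where
  "hermitian_form R \<tau> M h \<longleftrightarrow>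
     (\<forall>x \<in> carrier M. \<forall>y \<in> carrier M. h x y \<in> carrier R) \<and>
     (\<forall>x \<in> carrier M. \<forall>y \<in> carrier M. \<forall>z \<in> carrier M.
        h (x \<oplus>\<^bsub>M\<^esub> y) z = h x z \<oplus>\<^bsub>R\<^esub> h y z \<and> h x (y \<oplus>\<^bsub>M\<^esub> z) = h x y \<oplus>\<^bsub>R\<^esub> h x z) \<and>
     (\<forall>a \<in> carrier R. \<forall>x \<in> carrier M. \<forall>y \<in> carrier M. h x (a \<odot>\<^bsub>M\<^esub> y) = a \<otimes>\<^bsub>R\<^esub> h x y) \<and>
     (\<forall>x \<in> carrier M. \<forall>y \<in> carrier M. h y x = \<tau> (h x y))"

definition nondegenerate ::
  "('a, 'c) ring_scheme \<Rightarrow> ('a, 'b, 'd) module_scheme \<Rightarrow> ('b \<Rightarrow> 'b \<Rightarrow> 'a) \<Rightarrow> bool" where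
  "nondegenerate R M h \<longleftrightarrow>
     bij_betw (\<lambda>x. restrict (h x) (carrier M)) (carrier M) (module_hom R M (regular_module R))"

text \<open>
  The reduction of a form modulo \<open>I\<close>: on cosets \<open>C\<close> of \<open>x\<close> and \<open>D\<close> of \<open>y\<close> its value is the coset of
  \<open>h x y\<close>.
\<close>

definition quot_form ::
  "('a, 'c) ring_scheme \<Rightarrow> 'a set \<Rightarrow> ('b \<Rightarrow> 'b \<Rightarrow> 'a) \<Rightarrow> 'b set \<Rightarrow> 'b set \<Rightarrow> 'a set" where
  "quot_form R I h C D = (\<Union>x\<in>C. \<Union>y\<in>D. I +>\<^bsub>R\<^esub> h x y)"

definition unitary_group ::
  "('a, 'c) ring_scheme \<Rightarrow> ('a, 'b, 'd) module_scheme \<Rightarrow> ('b \<Rightarrow> 'b \<Rightarrow> 'a) \<Rightarrow> ('b \<Rightarrow> 'b) monoid" where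
  "unitary_group R M h = (BijGroup (carrier M))
     \<lparr>carrier := {g \<in> Bij (carrier M). g \<in> module_hom R M M \<and>
                  (\<forall>x \<in> carrier M. \<forall>y \<in> carrier M. h (g x) (g y) = h x y)}\<rparr>"

text \<open>
  Relative to some basis of length \<open>n\<close> the matrix of \<open>h\<close> is diagonal, with entries \<open>1, -1, 1, -1, \<dots>\<close>
  in all positions but the last, and with last entry \<open>-\<delta>\<close>; for odd \<open>n\<close> the last entry is thus
  preceded by complete pairs \<open>1, -1\<close>.
\<close>

definition alternating_diagonal ::
  "('a, 'c) ring_scheme \<Rightarrow> ('a, 'b, 'd) module_scheme \<Rightarrow> nat \<Rightarrow> ('b \<Rightarrow> 'b \<Rightarrow> 'a) \<Rightarrow> 'a \<Rightarrow> bool" where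
  "alternating_diagonal R M n h \<delta> \<longleftrightarrow>
     (\<exists>b. module_basis R M n b \<and>
        (\<forall>i<n. \<forall>j<n. h (b i) (b j) =
           (if i \<noteq> j then \<zero>\<^bsub>R\<^esub>
            else if i = n - 1 then \<ominus>\<^bsub>R\<^esub> \<delta>
            else if even i then \<one>\<^bsub>R\<^esub> else \<ominus>\<^bsub>R\<^esub> \<one>\<^bsub>R\<^esub>)))"

definition kind_I ::
  "('a, 'c) ring_scheme \<Rightarrow> ('a, 'b, 'd) module_scheme \<Rightarrow> nat \<Rightarrow> ('b \<Rightarrow> 'b \<Rightarrow> 'a) \<Rightarrow> bool" where
  "kind_I R M n h \<longleftrightarrow> alternating_diagonal R M n h \<one>\<^bsub>R\<^esub>"

definition kind_II ::
  "('a, 'c) ring_scheme \<Rightarrow> 'a \<Rightarrow> ('a, 'b, 'd) module_scheme \<Rightarrow> nat \<Rightarrow> ('b \<Rightarrow> 'b \<Rightarrow> 'a) \<Rightarrow> bool" where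
  "kind_II R \<epsilon> M n h \<longleftrightarrow> alternating_diagonal R M n h \<epsilon>"

end

theory Submission
  imports Defs
begin

text \<open>
  The index of the stabilizer of \<open>u\<close> is the size of its orbit. So one has to describe the orbit and to count
  it. Let \<open>k\<close> be the residue field, with \<open>q\<close> elements; the involution of \<open>B\<close> induces the identity on \<open>k\<close>.

  The orbit. Two vectors \<open>u\<close>, \<open>w\<close> of equal length are exchanged by a quasi-reflection along \<open>u - w\<close> as
  soon as \<open>h (u - w) u\<close> is a unit; if it is not, one passes through a third vector of that length. Since \<open>2\<close>
  is a unit, such a vector exists (\<open>unitary_transitive\<close>), and the orbit of \<open>u\<close> is the set of all vectors of
  length \<open>t = h u u\<close> that do not vanish modulo the maximal ideal. A member \<open>u\<close> of a basis is such a vector by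
  \<open>primitive_unimodular\<close>.

  The count. Moving a vector by fixed nonunit multiples of a suitable dual basis vector changes its length
  bijectively within its class modulo the maximal ideal of the fixed ring. Hence all lengths in this ideal
  occur equally often (\<open>card_isotropic_lift\<close>), and the index is the number of vectors over \<open>B\<close> that become
  nonzero and isotropic over \<open>k\<close>, divided by the size of the ideal. Over \<open>k\<close> the form is a nondegenerate quadratic form
  in \<open>m\<close> variables. If \<open>m\<close> is odd, it takes the value \<open>0\<close> exactly \<open>q ^ (m - 1)\<close> times: splitting off
  vectors of nonzero length one by one shows that multiplying the value by a nonsquare multiplies the
  deviation of its frequency from the mean by \<open>(-1) ^ m\<close> (\<open>form_count_twist\<close>). If \<open>m\<close> is even, the normal
  forms of the two kinds are sums of hyperbolic planes, in kind II with one anisotropic plane, and the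
  count is recursive over the planes (\<open>lin_count_hyperbolic\<close>, \<open>card_isotropic_kind_II\<close>).

  The sizes. In a ring whose nonunits are the multiples of an element \<open>\<beta>\<close> that the involution negates, the
  powers of \<open>\<beta>\<close> define a filtration with quotients \<open>k\<close>, and the involution acts on the \<open>j\<close>-th quotient by
  \<open>(-1) ^ j\<close>. If \<open>l\<close> is the nilpotency index of \<open>\<beta>\<close>, there are \<open>q ^ (l - 1)\<close> nonunits, and the fixed ones come
  from the even positive degrees below \<open>l\<close> (\<open>card_fixed_nonunits\<close>). The ring of integers has this structure
  with \<open>\<beta> = \<rho>\<close>, as \<open>\<pi>\<close> has valuation \<open>1\<close> (\<open>\<pi>_props\<close>), and it is inherited by quotients
  (\<open>quot_uniformized\<close>), so by \<open>A\<close> and \<open>B\<close>.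
\<close>

section \<open>Counting in finite fields of odd characteristic\<close>

lemma sum_card_fibres:
  assumes "finite Z" "finite Y" "f \<in> Z \<rightarrow> Y"
  shows "(\<Sum>c\<in>Y. card {x \<in> Z. f x = c}) = card Z"
  using sum_fun_comp[OF assms(1,2), of f "\<lambda>_. 1::nat"] assms(3)
  by (simp add: image_subset_iff_funcset)

text \<open>
  The values of a sum of two independent summands are distributed according to the convolution of the
  two distributions. All counts of solutions of quadratic equations below rest on this.
\<close>

lemma (in abelian_group) card_sum_fibre:
  assumes "finite (carrier G)" "finite Z" "finite Y" and f: "f \<in> Z \<rightarrow> carrier G" and g: "g \<in> Y \<rightarrow> carrier G"
    and c: "c \<in> carrier G"
  shows "card {p \<in> Z \<times> Y. f (fst p) \<oplus> g (snd p) = c} =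
    (\<Sum>d\<in>carrier G. card {x \<in> Z. f x = d} * card {y \<in> Y. g y = c \<ominus> d})"
proof -
  let ?P = "{p \<in> Z \<times> Y. f (fst p) \<oplus> g (snd p) = c}"
  have "{p \<in> ?P. f (fst p) = d} = {x \<in> Z. f x = d} \<times> {y \<in> Y. g y = c \<ominus> d}" if d: "d \<in> carrier G" for d
  proof -
    have "d \<oplus> g y = c \<longleftrightarrow> g y = c \<ominus> d" if "y \<in> Y" for y
    proof -
      have gy: "g y \<in> carrier G" using g that by auto
      have "g y = (d \<oplus> g y) \<ominus> d" using d gy by (simp add: a_comm a_assoc r_neg minus_eq r_neg1)
      moreover have "d \<oplus> (c \<ominus> d) = c" using d c by (simp add: a_lcomm r_neg minus_eq)
      ultimately show ?thesis by metis
    qed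
    note iff = this
    have "{p \<in> ?P. f (fst p) = d} = {p \<in> Z \<times> Y. f (fst p) = d \<and> d \<oplus> g (snd p) = c}" by auto
    also have "\<dots> = {p \<in> Z \<times> Y. f (fst p) = d \<and> g (snd p) = c \<ominus> d}"
      by (intro Collect_cong conj_cong refl iff) auto
    also have "\<dots> = {x \<in> Z. f x = d} \<times> {y \<in> Y. g y = c \<ominus> d}" by auto
    finally show ?thesis .
  qed
  then have "card {p \<in> ?P. f (fst p) = d} = card {x \<in> Z. f x = d} * card {y \<in> Y. g y = c \<ominus> d}"
    if "d \<in> carrier G" for d using that by (simp add: card_cartesian_product)
  moreover have "(\<Sum>d\<in>carrier G. card {p \<in> ?P. f (fst p) = d}) = card ?P"
    by (rule sum_card_fibres) (use assms in auto)
  ultimately show ?thesis by simp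
qed

locale finite_odd_field = field k for k (structure) +
  assumes finite_carrier: "finite (carrier k)"
    and two_nonzero: "\<one> \<oplus> \<one> \<noteq> \<zero>"
begin

abbreviation q :: nat where "q \<equiv> card (carrier k)"

text \<open>
  The quadratic character of the field, extended by \<open>0\<close> at zero. In this form it measures by how much the
  number of square roots of an element exceeds its mean value \<open>1\<close>.
\<close>

definition qchar :: "'a \<Rightarrow> real" where
  "qchar c = real (card {x \<in> carrier k. x \<otimes> x = c}) - 1"

lemma card_ge2: "q \<ge> 2"
proof -
  have "card {\<zero>, \<one>} \<le> q" by (rule card_mono) (auto simp: finite_carrier)
  then show ?thesis by simp
qed

lemma sum_qchar: "(\<Sum>c\<in>carrier k. qchar c) = 0"
  using sum_card_fibres[OF finite_carrier finite_carrier, of "\<lambda>x. x \<otimes> x"]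
  by (simp add: qchar_def sum_subtractf flip: of_nat_sum)

lemma square_eq_iff:
  assumes "x \<in> carrier k" "y \<in> carrier k"
  shows "x \<otimes> x = y \<otimes> y \<longleftrightarrow> x = y \<or> x = \<ominus> y"
proof -
  have "(x \<ominus> y) \<otimes> (x \<oplus> y) = x \<otimes> x \<ominus> y \<otimes> y"
    using assms by algebra
  then have "x \<otimes> x = y \<otimes> y \<longleftrightarrow> (x \<ominus> y) \<otimes> (x \<oplus> y) = \<zero>"
    using assms by (simp add: r_right_minus_eq)
  also have "\<dots> \<longleftrightarrow> x \<ominus> y = \<zero> \<or> x \<oplus> y = \<zero>"
    using assms by (intro integral_iff) auto
  also have "\<dots> \<longleftrightarrow> x = y \<or> x = \<ominus> y"
    using assms by (metis r_right_minus_eq add.inv_solve_right' l_neg minus_equality r_neg)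
  finally show ?thesis .
qed

lemma minus_neq: "x \<in> carrier k \<Longrightarrow> x \<noteq> \<zero> \<Longrightarrow> x \<noteq> \<ominus> x"
proof
  assume x: "x \<in> carrier k" "x \<noteq> \<zero>" "x = \<ominus> x"
  have "(\<one> \<oplus> \<one>) \<otimes> x = x \<ominus> (\<ominus> x)" using x(1) by algebra
  also have "\<dots> = \<zero>" using x(1,3) by (metis r_right_minus_eq)
  finally show False using x two_nonzero integral_iff by auto
qed

lemma square_zero_iff: "x \<in> carrier k \<Longrightarrow> x \<otimes> x = \<zero> \<longleftrightarrow> x = \<zero>"
  by (simp add: integral_iff)

lemma qchar_zero: "qchar \<zero> = 0"
proof -
  have "{x \<in> carrier k. x \<otimes> x = \<zero>} = {\<zero>}" by (auto simp: square_zero_iff)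
  then show ?thesis by (simp add: qchar_def)
qed

lemma qchar_square: "y \<in> carrier k \<Longrightarrow> y \<noteq> \<zero> \<Longrightarrow> qchar (y \<otimes> y) = 1"
proof -
  assume y: "y \<in> carrier k" "y \<noteq> \<zero>"
  have "{x \<in> carrier k. x \<otimes> x = y \<otimes> y} = {y, \<ominus> y}" using y by (auto simp: square_eq_iff)
  then show ?thesis using minus_neq[OF y] by (simp add: qchar_def)
qed

lemma qchar_nonsquare: "\<not> (\<exists>x\<in>carrier k. c = x \<otimes> x) \<Longrightarrow> qchar c = -1"
proof -
  assume "\<not> (\<exists>x\<in>carrier k. c = x \<otimes> x)"
  then have "{x \<in> carrier k. x \<otimes> x = c} = {}" by blast
  then show ?thesis unfolding qchar_def by (simp only: card.empty)
qed

lemma inv_mult: "a \<in> carrier k - {\<zero>} \<Longrightarrow> inv a \<in> carrier k \<and> inv a \<otimes> a = \<one> \<and> a \<otimes> inv a = \<one>"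
  using field_Units Units_l_inv Units_r_inv Units_inv_closed by auto

text \<open>
  Since \<open>qchar\<close> sums to zero, the nonzero elements are one half squares and one half nonsquares.
  Multiplication by a nonsquare maps the squares into the nonsquares, hence onto them, and so exchanges
  the two halves.
\<close>

lemma exists_nonsquare_twist:
  "\<exists>s \<in> carrier k - {\<zero>}. \<forall>c \<in> carrier k. qchar (s \<otimes> c) = - qchar c"
proof -
  let ?S = "carrier k - {\<zero>}"
  let ?Q = "(\<lambda>x. x \<otimes> x) ` ?S"
  have QS: "?Q \<subseteq> ?S" by (auto simp: square_zero_iff)
  have finS: "finite ?S" using finite_carrier by auto
  have "(\<Sum>c\<in>?S. qchar c) = 0"
    using sum_qchar finite_carrier by (simp add: sum_diff1 qchar_zero)
  moreover have "(\<Sum>c\<in>?S. qchar c) = (\<Sum>c\<in>?Q. qchar c) + (\<Sum>c\<in>?S-?Q. qchar c)"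
    using sum.subset_diff[OF QS finS] by (simp add: add.commute)
  moreover have "(\<Sum>c\<in>?Q. qchar c) = (\<Sum>c\<in>?Q. 1)"
    by (rule sum.cong) (use qchar_square in blast)+
  moreover have ns: "qchar c = -1" if "c \<in> ?S - ?Q" for c
  proof (rule qchar_nonsquare)
    show "\<not> (\<exists>x\<in>carrier k. c = x \<otimes> x)"
    proof
      assume "\<exists>x\<in>carrier k. c = x \<otimes> x"
      then obtain x where x: "x \<in> carrier k" "c = x \<otimes> x" by blast
      then have "x \<noteq> \<zero>" using that by auto
      then have "c \<in> ?Q" using x by blast
      then show False using that by blast
    qed
  qed
  moreover have "(\<Sum>c\<in>?S-?Q. qchar c) = (\<Sum>c\<in>?S-?Q. -1)"
    by (rule sum.cong) (auto simp: ns)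
  ultimately have eq: "card ?Q = card (?S - ?Q)" by simp
  have "\<one> \<in> ?Q" by (auto simp: image_iff intro!: bexI[of _ \<one>])
  then have "card ?Q > 0" using finS by (auto simp: card_gt_0_iff)
  then obtain s where s: "s \<in> ?S - ?Q" using eq by (metis card_gt_0_iff ex_in_conv)
  then have sc: "s \<in> carrier k" "s \<noteq> \<zero>" by auto
  have sQ: "s \<otimes> c \<in> ?S - ?Q" if c: "c \<in> ?Q" for c
  proof -
    obtain x where x: "x \<in> carrier k" "x \<noteq> \<zero>" "c = x \<otimes> x" using c by auto
    have "s \<otimes> c \<notin> ?Q"
    proof
      assume "s \<otimes> c \<in> ?Q"
      then obtain y where y: "y \<in> carrier k" "y \<noteq> \<zero>" "s \<otimes> c = y \<otimes> y" by auto
      have ix: "inv x \<in> carrier k" "inv x \<otimes> x = \<one>"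
        using inv_mult[of x] x by auto
      have ix0: "inv x \<noteq> \<zero>" using ix x by auto
      have "s = s \<otimes> (inv x \<otimes> x) \<otimes> (inv x \<otimes> x)" using ix sc by simp
      also have "\<dots> = (s \<otimes> c) \<otimes> (inv x \<otimes> inv x)" unfolding x(3) using ix(1) x(1) sc by algebra
      also have "\<dots> = (y \<otimes> inv x) \<otimes> (y \<otimes> inv x)" unfolding y(3) using ix(1) x(1) sc y(1) by algebra
      finally have "s = (y \<otimes> inv x) \<otimes> (y \<otimes> inv x)" .
      moreover have "y \<otimes> inv x \<in> ?S" using y(1,2) ix ix0 by (simp add: integral_iff)
      ultimately have "s \<in> ?Q" by blast
      then show False using s by auto
    qed
    then show ?thesis using c QS sc by (auto simp: integral_iff)
  qed
  have inj: "inj_on (\<lambda>c. s \<otimes> c) ?Q"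
    by (rule inj_onI) (use sc m_lcancel QS in auto)
  have "(\<lambda>c. s \<otimes> c) ` ?Q = ?S - ?Q"
    by (rule card_subset_eq) (use sQ finS eq card_image[OF inj] in auto)
  then have nsQ: "\<exists>d\<in>?Q. c = s \<otimes> d" if "c \<in> ?S - ?Q" for c using that by blast
  show ?thesis
  proof (intro bexI ballI)
    fix c assume c: "c \<in> carrier k"
    consider "c = \<zero>" | "c \<in> ?Q" | "c \<in> ?S - ?Q" using c by blast
    then show "qchar (s \<otimes> c) = - qchar c"
    proof cases
      case 1 then show ?thesis using sc by (simp add: qchar_zero)
    next
      case 2
      then have "qchar (s \<otimes> c) = -1" by (intro ns sQ)
      moreover have "qchar c = 1" using 2 qchar_square by blast
      ultimately show ?thesis by simp
    next
      case 3
      then obtain x where x: "x \<in> carrier k" "x \<noteq> \<zero>" "c = s \<otimes> (x \<otimes> x)" using nsQ by auto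
      have "s \<otimes> c = (s \<otimes> x) \<otimes> (s \<otimes> x)" unfolding x(3) using x(1) sc by algebra
      then have "qchar (s \<otimes> c) = 1" using x sc by (simp add: qchar_square integral_iff)
      then show ?thesis using ns[OF 3] by simp
    qed
  qed (use sc in auto)
qed

lemma card_scaled_square:
  assumes "a \<in> carrier k - {\<zero>}" "d \<in> carrier k"
  shows "real (card {x \<in> carrier k. a \<otimes> (x \<otimes> x) = d}) = 1 + qchar (inv a \<otimes> d)"
proof -
  have "a \<otimes> y = d \<longleftrightarrow> y = inv a \<otimes> d" if "y \<in> carrier k" for y
    using assms inv_mult[OF assms(1)] that
    by (metis DiffD1 m_assoc l_one)
  then have "{x \<in> carrier k. a \<otimes> (x \<otimes> x) = d} = {x \<in> carrier k. x \<otimes> x = inv a \<otimes> d}" by auto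
  then show ?thesis by (simp add: qchar_def)
qed

lemma sum_qchar_scaled:
  assumes a: "a \<in> carrier k - {\<zero>}"
  shows "(\<Sum>d\<in>carrier k. qchar (a \<otimes> d)) = 0"
proof -
  have "bij_betw (\<lambda>d. a \<otimes> d) (carrier k) (carrier k)"
    using inv_mult[OF a] a
    by (intro bij_betw_byWitness[where f' = "\<lambda>d. inv a \<otimes> d"]) (auto simp flip: m_assoc)
  from sum.reindex_bij_betw[OF this, of qchar] show ?thesis using sum_qchar by simp
qed

lemma two_Unit: "\<one> \<oplus> \<one> \<in> carrier k - {\<zero>}" using two_nonzero by auto

lemma card_mult_eq:
  assumes d: "d \<in> carrier k"
  shows "card {p \<in> carrier k \<times> carrier k. fst p \<otimes> snd p = d} = q - 1 + (if d = \<zero> then q else 0)"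
proof (cases "d = \<zero>")
  case True
  have "{p \<in> carrier k \<times> carrier k. fst p \<otimes> snd p = d} = {\<zero>} \<times> carrier k \<union> (carrier k - {\<zero>}) \<times> {\<zero>}"
    using True by (auto simp: integral_iff)
  moreover have "card \<dots> = q + (q - 1)"
    by (subst card_Un_disjoint) (auto simp: card_cartesian_product finite_carrier)
  ultimately show ?thesis using True by simp
next
  case False
  have "{p \<in> carrier k \<times> carrier k. fst p \<otimes> snd p = d} = (\<lambda>x. (x, inv x \<otimes> d)) ` (carrier k - {\<zero>})"
  proof (intro equalityI subsetI)
    fix p assume "p \<in> {p \<in> carrier k \<times> carrier k. fst p \<otimes> snd p = d}"
    then obtain x y where p: "p = (x,y)" "x \<in> carrier k" "y \<in> carrier k" "x \<otimes> y = d" by (cases p) auto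
    have x: "x \<in> carrier k - {\<zero>}" using p False by auto
    have "inv x \<otimes> (x \<otimes> y) = y" using inv_mult[OF x] p by (metis m_assoc l_one)
    then show "p \<in> (\<lambda>x. (x, inv x \<otimes> d)) ` (carrier k - {\<zero>})" using p x by auto
  next
    fix p assume "p \<in> (\<lambda>x. (x, inv x \<otimes> d)) ` (carrier k - {\<zero>})"
    then obtain x where x: "x \<in> carrier k - {\<zero>}" "p = (x, inv x \<otimes> d)" by auto
    have "x \<otimes> (inv x \<otimes> d) = d" using inv_mult[OF x(1)] d x(1) by (metis DiffD1 m_assoc l_one)
    then show "p \<in> {p \<in> carrier k \<times> carrier k. fst p \<otimes> snd p = d}" using x d inv_mult[OF x(1)] by auto
  qed
  moreover have "card ((\<lambda>x. (x, inv x \<otimes> d)) ` (carrier k - {\<zero>})) = card (carrier k - {\<zero>})"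
    by (rule card_image) (auto intro: inj_onI)
  ultimately show ?thesis using False by (simp add: finite_carrier)
qed

text \<open>
  The invertible substitution \<open>(x - y, x + y)\<close> turns \<open>x\<^sup>2 - y\<^sup>2\<close> into a product.
\<close>

lemma card_hyperbolic:
  assumes d: "d \<in> carrier k"
  shows "card {p \<in> carrier k \<times> carrier k. fst p \<otimes> fst p \<oplus> \<ominus> \<one> \<otimes> (snd p \<otimes> snd p) = d}
    = q - 1 + (if d = \<zero> then q else 0)"
proof -
  define h where "h = inv (\<one> \<oplus> \<one>)"
  have h: "h \<in> carrier k" "h \<oplus> h = \<one>"
  proof -
    show hc: "h \<in> carrier k" using inv_mult[OF two_Unit] h_def by auto
    have "h \<otimes> (\<one> \<oplus> \<one>) = \<one>" using inv_mult[OF two_Unit] h_def by auto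
    then show "h \<oplus> h = \<one>" using hc by (simp add: r_distr)
  qed
  have half: "h \<otimes> z \<oplus> h \<otimes> z = z" if "z \<in> carrier k" for z
    using h that by (metis l_distr l_one)
  let ?A = "{p \<in> carrier k \<times> carrier k. fst p \<otimes> fst p \<oplus> \<ominus> \<one> \<otimes> (snd p \<otimes> snd p) = d}"
  let ?B = "{p \<in> carrier k \<times> carrier k. fst p \<otimes> snd p = d}"
  have "bij_betw (\<lambda>p. (fst p \<ominus> snd p, fst p \<oplus> snd p)) ?A ?B"
  proof (rule bij_betw_byWitness[where f' = "\<lambda>p. (h \<otimes> (snd p \<oplus> fst p), h \<otimes> (snd p \<ominus> fst p))"])
    show "(\<lambda>p. (fst p \<ominus> snd p, fst p \<oplus> snd p)) ` ?A \<subseteq> ?B"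
    proof clarsimp
      fix a b assume ab: "a \<in> carrier k" "b \<in> carrier k"
      then have "(a \<ominus> b) \<otimes> (a \<oplus> b) = a \<otimes> a \<oplus> \<ominus> (b \<otimes> b)" by algebra
      then show "(a \<ominus> b) \<otimes> (a \<oplus> b) = a \<otimes> a \<oplus> \<ominus> \<one> \<otimes> (b \<otimes> b)"
        using ab by (simp add: l_minus)
    qed
    show "\<forall>a\<in>?A. (h \<otimes> (snd (fst a \<ominus> snd a, fst a \<oplus> snd a) \<oplus> fst (fst a \<ominus> snd a, fst a \<oplus> snd a)),
                h \<otimes> (snd (fst a \<ominus> snd a, fst a \<oplus> snd a) \<ominus> fst (fst a \<ominus> snd a, fst a \<oplus> snd a))) = a"
    proof clarsimp
      fix a b assume ab: "a \<in> carrier k" "b \<in> carrier k"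
      have "h \<otimes> (a \<oplus> b \<oplus> (a \<ominus> b)) = h \<otimes> a \<oplus> h \<otimes> a" using ab h(1) by algebra
      moreover have "h \<otimes> (a \<oplus> b \<ominus> (a \<ominus> b)) = h \<otimes> b \<oplus> h \<otimes> b" using ab h(1) by algebra
      ultimately show "h \<otimes> (a \<oplus> b \<oplus> (a \<ominus> b)) = a \<and> h \<otimes> (a \<oplus> b \<ominus> (a \<ominus> b)) = b"
        using half ab by simp
    qed
    show "\<forall>a'\<in>?B. (fst (h \<otimes> (snd a' \<oplus> fst a'), h \<otimes> (snd a' \<ominus> fst a')) \<ominus> snd (h \<otimes> (snd a' \<oplus> fst a'), h \<otimes> (snd a' \<ominus> fst a')),
             fst (h \<otimes> (snd a' \<oplus> fst a'), h \<otimes> (snd a' \<ominus> fst a')) \<oplus> snd (h \<otimes> (snd a' \<oplus> fst a'), h \<otimes> (snd a' \<ominus> fst a'))) = a'"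
    proof clarsimp
      fix a b assume ab: "a \<in> carrier k" "b \<in> carrier k"
      have "h \<otimes> (b \<oplus> a) \<ominus> h \<otimes> (b \<ominus> a) = h \<otimes> a \<oplus> h \<otimes> a" using ab h(1) by algebra
      moreover have "h \<otimes> (b \<oplus> a) \<oplus> h \<otimes> (b \<ominus> a) = h \<otimes> b \<oplus> h \<otimes> b" using ab h(1) by algebra
      ultimately show "h \<otimes> (b \<oplus> a) \<ominus> h \<otimes> (b \<ominus> a) = a \<and> h \<otimes> (b \<oplus> a) \<oplus> h \<otimes> (b \<ominus> a) = b"
        using half ab by simp
    qed
    show "(\<lambda>p. (h \<otimes> (snd p \<oplus> fst p), h \<otimes> (snd p \<ominus> fst p))) ` ?B \<subseteq> ?A"
    proof (rule image_subsetI)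
      fix p assume "p \<in> ?B"
      then obtain a b where p: "p = (a, b)" and ab: "a \<in> carrier k" "b \<in> carrier k" "a \<otimes> b = d" by (cases p) auto
      have "h \<otimes> (b \<oplus> a) \<otimes> (h \<otimes> (b \<oplus> a)) \<oplus> \<ominus> (h \<otimes> (b \<ominus> a) \<otimes> (h \<otimes> (b \<ominus> a)))
         = (h \<oplus> h) \<otimes> (h \<oplus> h) \<otimes> (a \<otimes> b)" using ab(1,2) h(1) by algebra
      then show "(h \<otimes> (snd p \<oplus> fst p), h \<otimes> (snd p \<ominus> fst p)) \<in> ?A"
        using h ab d by (simp add: p l_minus)
    qed
  qed
  from bij_betw_same_card[OF this] show ?thesis using card_mult_eq[OF d] by (simp only:)
qed

text \<open>
  A nontrivial zero \<open>(x, y)\<close> would exhibit \<open>e\<close> as the square of \<open>x / y\<close>.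
\<close>

lemma card_anisotropic:
  assumes e: "e \<in> carrier k" and ns: "\<not> (\<exists>x\<in>carrier k. e = x \<otimes> x)"
  shows "{p \<in> carrier k \<times> carrier k. fst p \<otimes> fst p \<oplus> \<ominus> e \<otimes> (snd p \<otimes> snd p) = \<zero>} = {(\<zero>,\<zero>)}"
proof -
  have "x = \<zero> \<and> y = \<zero>" if xy: "x \<in> carrier k" "y \<in> carrier k" "x \<otimes> x \<oplus> \<ominus> e \<otimes> (y \<otimes> y) = \<zero>" for x y
  proof -
    have "x \<otimes> x \<ominus> e \<otimes> (y \<otimes> y) = x \<otimes> x \<oplus> \<ominus> e \<otimes> (y \<otimes> y)" using e xy(1,2) by algebra
    then have 1: "x \<otimes> x = e \<otimes> (y \<otimes> y)" using xy e by (simp add: r_right_minus_eq)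
    have "y = \<zero>"
    proof (rule ccontr)
      assume "y \<noteq> \<zero>"
      then have i: "inv y \<in> carrier k" "inv y \<otimes> y = \<one>" using inv_mult[of y] xy by auto
      have "e = e \<otimes> (inv y \<otimes> y) \<otimes> (inv y \<otimes> y)" using i e by simp
      also have "\<dots> = (e \<otimes> (y \<otimes> y)) \<otimes> (inv y \<otimes> inv y)" using i(1) e xy(2) by algebra
      also have "\<dots> = (x \<otimes> inv y) \<otimes> (x \<otimes> inv y)" unfolding 1[symmetric] using i(1) xy(1) by algebra
      finally show False using ns i xy by blast
    qed
    then show ?thesis using 1 xy e by (simp add: square_zero_iff)
  qed
  moreover have "\<zero> \<otimes> \<zero> \<oplus> \<ominus> e \<otimes> (\<zero> \<otimes> \<zero>) = \<zero>" using e by simp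
  ultimately show ?thesis by (intro equalityI subsetI) (auto simp only: mem_Collect_eq mem_Sigma_iff prod.sel split_paired_all prod.inject insert_iff empty_iff zero_closed)
qed

lemma sum_shift:
  assumes c: "c \<in> carrier k" shows "(\<Sum>d\<in>carrier k. f (c \<ominus> d)) = (\<Sum>d\<in>carrier k. f d)"
proof -
  have "bij_betw (\<lambda>d. c \<ominus> d) (carrier k) (carrier k)"
  proof (rule bij_betw_byWitness[where f' = "\<lambda>d. c \<ominus> d"])
    show "\<forall>d\<in>carrier k. c \<ominus> (c \<ominus> d) = d" "\<forall>d\<in>carrier k. c \<ominus> (c \<ominus> d) = d"
      using c by (auto simp: minus_eq minus_add r_neg2)
  qed (use c in auto)
  from sum.reindex_bij_betw[OF this, of f] show ?thesis by simp
qed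

text \<open>
  This is the step from a quadratic form to its orthogonal sum with a form in one variable, read off on the
  numbers \<open>N c\<close> and \<open>N' c\<close> of vectors of value \<open>c\<close>; the means of these numbers are \<open>t\<close> and \<open>r t q\<close>. In the
  convolution the mean of one factor meets the deviation of the other, which sums to zero, so that the
  deviation of \<open>N'\<close> from its mean is a convolution of the two deviations. When \<open>c\<close> is multiplied by the
  nonsquare \<open>s\<close>, one of these changes its sign and the other is multiplied by \<open>g\<close>.
\<close>

lemma twisted_convolution:
  assumes a: "a \<in> carrier k - {\<zero>}" and s: "s \<in> carrier k - {\<zero>}"
    and qchar_s: "\<And>c. c \<in> carrier k \<Longrightarrow> qchar (s \<otimes> c) = - qchar c"
    and N: "\<And>c. c \<in> carrier k \<Longrightarrow> N (s \<otimes> c) - t = g * (N c - t)"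
    and t: "(\<Sum>c\<in>carrier k. N c) = t * real q"
    and N': "\<And>c. c \<in> carrier k \<Longrightarrow> N' c = (\<Sum>d\<in>carrier k. r * (1 + qchar (a \<otimes> d)) * N (c \<ominus> d))"
    and c: "c \<in> carrier k"
  shows "N' (s \<otimes> c) - r * t * real q = (- g) * (N' c - r * t * real q)"
proof -
  \<comment> \<open>The deviation of \<open>N'\<close> from its mean, up to the factor \<open>r\<close>.\<close>
  define E where "E = (\<lambda>c. \<Sum>d\<in>carrier k. qchar (a \<otimes> d) * (N (c \<ominus> d) - t))"
  have E: "N' c - r * t * real q = r * E c" if c: "c \<in> carrier k" for c
  proof -
    have 1: "(\<Sum>d\<in>carrier k. N (c \<ominus> d)) = t * real q" unfolding sum_shift[OF c] by (rule t)
    have "N' c = r * (\<Sum>d\<in>carrier k. N (c \<ominus> d)) + r * (\<Sum>d\<in>carrier k. qchar (a \<otimes> d) * N (c \<ominus> d))"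
      unfolding N'[OF c] by (simp add: sum_distrib_left algebra_simps flip: sum.distrib)
    moreover have "E c = (\<Sum>d\<in>carrier k. qchar (a \<otimes> d) * N (c \<ominus> d)) - t * (\<Sum>d\<in>carrier k. qchar (a \<otimes> d))"
      unfolding E_def by (simp add: sum_distrib_left algebra_simps flip: sum_subtractf)
    ultimately show ?thesis using 1 sum_qchar_scaled[OF a] by simp
  qed
  have "bij_betw (\<lambda>d. s \<otimes> d) (carrier k) (carrier k)"
    using inv_mult[OF s] s
    by (intro bij_betw_byWitness[where f' = "\<lambda>d. inv s \<otimes> d"]) (auto simp flip: m_assoc)
  from sum.reindex_bij_betw[OF this, of "\<lambda>d. qchar (a \<otimes> d) * (N (s \<otimes> c \<ominus> d) - t)"]
  have "E (s \<otimes> c) = (\<Sum>d\<in>carrier k. qchar (a \<otimes> (s \<otimes> d)) * (N (s \<otimes> c \<ominus> s \<otimes> d) - t))"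
    unfolding E_def by simp
  also have "\<dots> = (\<Sum>d\<in>carrier k. - g * (qchar (a \<otimes> d) * (N (c \<ominus> d) - t)))"
  proof (rule sum.cong[OF refl])
    fix d assume d: "d \<in> carrier k"
    have "a \<otimes> (s \<otimes> d) = s \<otimes> (a \<otimes> d)" using a s d by (simp add: m_lcomm)
    moreover have "s \<otimes> c \<ominus> s \<otimes> d = s \<otimes> (c \<ominus> d)" using s c d by (simp add: minus_eq r_distr r_minus)
    ultimately show "qchar (a \<otimes> (s \<otimes> d)) * (N (s \<otimes> c \<ominus> s \<otimes> d) - t) =
        - g * (qchar (a \<otimes> d) * (N (c \<ominus> d) - t))"
      using qchar_s[of "a \<otimes> d"] N[of "c \<ominus> d"] a c d by simp
  qed
  also have "\<dots> = - g * E c" unfolding E_def by (simp add: sum_distrib_left)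
  finally show ?thesis using E[OF c] E[of "s \<otimes> c"] s c by simp
qed

end

lemma card_pull_back:
  assumes "finite Z" "finite Y" "F \<in> Z \<rightarrow> Y" and "\<And>y. y \<in> Y \<Longrightarrow> card {x \<in> Z. F x = y} = n"
  shows "card {x \<in> Z. P (F x)} = n * card {y \<in> Y. P y}"
proof -
  have "card {x \<in> Z. P (F x)} = (\<Sum>y\<in>{y \<in> Y. P y}. card {x \<in> {x \<in> Z. P (F x)}. F x = y})"
    by (rule sum_card_fibres[symmetric]) (use assms in auto)
  also have "\<dots> = (\<Sum>y\<in>{y \<in> Y. P y}. n)"
  proof (rule sum.cong[OF refl])
    fix y assume y: "y \<in> {y \<in> Y. P y}"
    have "{x \<in> {x \<in> Z. P (F x)}. F x = y} = {x \<in> Z. F x = y}" using y by auto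
    then show "card {x \<in> {x \<in> Z. P (F x)}. F x = y} = n" using assms(4) y by auto
  qed
  finally show ?thesis by simp
qed

section \<open>Local rings with involution\<close>

text \<open>
  A local ring is given by its residue map: an element is a unit as soon as its residue is nonzero. The
  involution induces the identity on the residue field, which is the ramified situation; a hermitian form
  then becomes a symmetric bilinear form over the residue field, and odd characteristic makes this a
  matter of quadratic forms.
\<close>

locale local_involution = R?: cring B + k: finite_odd_field k
  for B :: "('a, 'c) ring_scheme" (structure) and k :: "('k, 'e) ring_scheme" +
  fixes \<phi> :: "'a \<Rightarrow> 'k" and \<tau> :: "'a \<Rightarrow> 'a"
  assumes \<phi>_hom: "\<phi> \<in> ring_hom B k"
    and \<phi>_surj: "\<phi> ` carrier B = carrier k"
    and \<phi>_unit: "\<And>x. x \<in> carrier B \<Longrightarrow> \<phi> x \<noteq> \<zero>\<^bsub>k\<^esub> \<Longrightarrow> x \<in> Units B"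
    and \<tau>_hom: "\<tau> \<in> ring_hom B B"
    and \<tau>_invol: "\<And>x. x \<in> carrier B \<Longrightarrow> \<tau> (\<tau> x) = x"
    and \<phi>_\<tau>: "\<And>x. x \<in> carrier B \<Longrightarrow> \<phi> (\<tau> x) = \<phi> x"
begin

sublocale \<phi>: ring_hom_cring B k \<phi>
  by unfold_locales (rule \<phi>_hom)

sublocale \<tau>: ring_hom_cring B B \<tau>
  by unfold_locales (rule \<tau>_hom)

definition nonunits :: "'a set" where "nonunits = {x \<in> carrier B. \<phi> x = \<zero>\<^bsub>k\<^esub>}"

definition fixed :: "'a set" where "fixed = {x \<in> carrier B. \<tau> x = x}"

definition fixed_nonunits :: "'a set" where "fixed_nonunits = fixed \<inter> nonunits"

lemma \<phi>_preimage: "y \<in> carrier k \<Longrightarrow> \<exists>x\<in>carrier B. \<phi> x = y"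
  unfolding \<phi>_surj[symmetric] by blast

lemma fixed_closed:
  "x \<in> fixed \<Longrightarrow> x \<in> carrier B" "\<zero> \<in> fixed" "\<one> \<in> fixed"
  "x \<in> fixed \<Longrightarrow> y \<in> fixed \<Longrightarrow> x \<oplus> y \<in> fixed"
  "x \<in> fixed \<Longrightarrow> y \<in> fixed \<Longrightarrow> x \<otimes> y \<in> fixed"
  "x \<in> fixed \<Longrightarrow> \<ominus> x \<in> fixed"
  "x \<in> fixed \<Longrightarrow> y \<in> fixed \<Longrightarrow> x \<ominus> y \<in> fixed"
  by (auto simp: fixed_def R.minus_eq)

lemma trace_fixed: "x \<in> carrier B \<Longrightarrow> x \<oplus> \<tau> x \<in> fixed"
  by (simp add: fixed_def \<tau>_invol R.a_comm)

text \<open>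
  If \<open>x\<close> lifts \<open>y / 2\<close>, then its trace \<open>x + \<tau> x\<close> is a fixed lift of \<open>y\<close>.
\<close>

lemma \<phi>_fixed_surj:
  assumes y: "y \<in> carrier k" shows "\<exists>x\<in>fixed. \<phi> x = y"
proof -
  define c where "c = inv\<^bsub>k\<^esub> (\<one>\<^bsub>k\<^esub> \<oplus>\<^bsub>k\<^esub> \<one>\<^bsub>k\<^esub>) \<otimes>\<^bsub>k\<^esub> y"
  have c: "c \<in> carrier k" "c \<oplus>\<^bsub>k\<^esub> c = y"
  proof -
    have i: "inv\<^bsub>k\<^esub> (\<one>\<^bsub>k\<^esub> \<oplus>\<^bsub>k\<^esub> \<one>\<^bsub>k\<^esub>) \<in> carrier k"
      "(\<one>\<^bsub>k\<^esub> \<oplus>\<^bsub>k\<^esub> \<one>\<^bsub>k\<^esub>) \<otimes>\<^bsub>k\<^esub> inv\<^bsub>k\<^esub> (\<one>\<^bsub>k\<^esub> \<oplus>\<^bsub>k\<^esub> \<one>\<^bsub>k\<^esub>) = \<one>\<^bsub>k\<^esub>"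
      using k.inv_mult[OF k.two_Unit] by auto
    show c: "c \<in> carrier k" using i y by (simp add: c_def)
    have "c \<oplus>\<^bsub>k\<^esub> c = (\<one>\<^bsub>k\<^esub> \<oplus>\<^bsub>k\<^esub> \<one>\<^bsub>k\<^esub>) \<otimes>\<^bsub>k\<^esub> c" using c by (simp add: k.l_distr)
    also have "\<dots> = y" unfolding c_def using i y by (simp flip: k.m_assoc)
    finally show "c \<oplus>\<^bsub>k\<^esub> c = y" .
  qed
  then obtain x where x: "x \<in> carrier B" "\<phi> x = c" using \<phi>_preimage by blast
  then show ?thesis using c by (intro bexI[of _ "x \<oplus> \<tau> x"] trace_fixed) (auto simp: \<phi>_\<tau>)
qed

end

locale finite_local_involution = local_involution +
  assumes finite_B: "finite (carrier B)"
begin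

lemma card_fibre: "y \<in> carrier k \<Longrightarrow> card {x \<in> carrier B. \<phi> x = y} = card nonunits"
proof -
  assume y: "y \<in> carrier k"
  then obtain x0 where x0: "x0 \<in> carrier B" "\<phi> x0 = y" using \<phi>_preimage by blast
  have "bij_betw (\<lambda>x. x \<oplus> x0) nonunits {x \<in> carrier B. \<phi> x = y}"
  proof (rule bij_betw_byWitness[where f' = "\<lambda>x. x \<ominus> x0"])
    show "\<forall>a\<in>nonunits. a \<oplus> x0 \<ominus> x0 = a"
      using x0 by (auto simp: nonunits_def R.minus_eq R.a_assoc R.r_neg)
    show "\<forall>a'\<in>{x \<in> carrier B. \<phi> x = y}. a' \<ominus> x0 \<oplus> x0 = a'"
      using x0 by (auto simp: R.minus_eq R.a_assoc R.l_neg)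
    show "(\<lambda>x. x \<oplus> x0) ` nonunits \<subseteq> {x \<in> carrier B. \<phi> x = y}"
      using x0 by (auto simp: nonunits_def)
    show "(\<lambda>x. x \<ominus> x0) ` {x \<in> carrier B. \<phi> x = y} \<subseteq> nonunits"
      using x0 by (auto simp: nonunits_def R.minus_eq k.r_neg)
  qed
  then show ?thesis by (simp add: bij_betw_same_card)
qed

lemma card_\<phi>_preimage: "card {x \<in> carrier B. P (\<phi> x)} = card nonunits * card {y \<in> carrier k. P y}"
  by (rule card_pull_back[OF finite_B k.finite_carrier]) (auto simp: card_fibre)

lemma card_\<phi>_preimage2:
  "card {p \<in> carrier B \<times> carrier B. P (\<phi> (fst p)) (\<phi> (snd p))} =
   card nonunits ^ 2 * card {p \<in> carrier k \<times> carrier k. P (fst p) (snd p)}"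
proof -
  have "card {p \<in> carrier B \<times> carrier B. case_prod P (map_prod \<phi> \<phi> p)} =
    (card nonunits * card nonunits) * card {p \<in> carrier k \<times> carrier k. case_prod P p}"
  proof (rule card_pull_back)
    fix y assume y: "y \<in> carrier k \<times> carrier k"
    have "{x \<in> carrier B \<times> carrier B. map_prod \<phi> \<phi> x = y} =
      {x \<in> carrier B. \<phi> x = fst y} \<times> {x \<in> carrier B. \<phi> x = snd y}"
      by (cases y) auto
    then show "card {x \<in> carrier B \<times> carrier B. map_prod \<phi> \<phi> x = y} = card nonunits * card nonunits"
      using y by (auto simp: card_cartesian_product card_fibre)
  qed (auto simp: finite_B k.finite_carrier)
  then show ?thesis by (simp add: case_prod_unfold power2_eq_square)
qed

lemma card_B: "card (carrier B) = k.q * card nonunits"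
  using card_\<phi>_preimage[of "\<lambda>_. True"] by simp

text \<open>
  The values at \<open>s\<close> and \<open>s'\<close> differ by \<open>(s - s') (T + (s + s') N)\<close>. If the second factor is always a unit, the
  polynomial is injective on \<open>J\<close>, hence bijective because \<open>J\<close> is finite. This takes the place of Hensel's
  lemma: quadratic equations over \<open>B\<close> are solved by surjectivity, without approximation.
\<close>

lemma quadratic_bij:
  assumes J: "J \<subseteq> carrier B" and T: "T \<in> carrier B" and N: "N \<in> carrier B"
    and closed: "\<And>s. s \<in> J \<Longrightarrow> s \<otimes> T \<oplus> s \<otimes> s \<otimes> N \<in> J"
    and unit: "\<And>s s'. s \<in> J \<Longrightarrow> s' \<in> J \<Longrightarrow> \<phi> (T \<oplus> (s \<oplus> s') \<otimes> N) \<noteq> \<zero>\<^bsub>k\<^esub>"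
  shows "bij_betw (\<lambda>s. s \<otimes> T \<oplus> s \<otimes> s \<otimes> N) J J"
proof -
  have inj: "inj_on (\<lambda>s. s \<otimes> T \<oplus> s \<otimes> s \<otimes> N) J"
  proof (rule inj_onI)
    fix s s' assume s: "s \<in> J" "s' \<in> J" and eq: "s \<otimes> T \<oplus> s \<otimes> s \<otimes> N = s' \<otimes> T \<oplus> s' \<otimes> s' \<otimes> N"
    then have sc: "s \<in> carrier B" "s' \<in> carrier B" using J by auto
    have U: "T \<oplus> (s \<oplus> s') \<otimes> N \<in> Units B" by (rule \<phi>_unit) (use sc T N unit[OF s] in auto)
    have "(T \<oplus> (s \<oplus> s') \<otimes> N) \<otimes> (s \<ominus> s') = (s \<otimes> T \<oplus> s \<otimes> s \<otimes> N) \<ominus> (s' \<otimes> T \<oplus> s' \<otimes> s' \<otimes> N)"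
      using sc T N by algebra
    also have "\<dots> = \<zero>" using eq sc T N by (simp add: R.r_right_minus_eq)
    finally have "s \<ominus> s' = \<zero>" using R.Units_l_cancel[OF U, of "s \<ominus> s'" \<zero>] sc T N by simp
    then show "s = s'" using sc by (simp add: R.r_right_minus_eq)
  qed
  moreover have "finite J" using J finite_B finite_subset by auto
  ultimately show ?thesis using closed by (intro bij_betw_imageI endo_inj_surj) auto
qed

text \<open>
  With a fixed lift \<open>x0\<close> of \<open>y\<close>, the root is sought in the form \<open>x0 + s\<close> with a fixed nonunit \<open>s\<close>. The condition
  on \<open>s\<close> is \<open>2 x0 s + s\<^sup>2 = \<epsilon> - x0\<^sup>2\<close>, where \<open>2 x0\<close> is a unit.
\<close>

lemma fixed_square_lift:
  assumes \<epsilon>: "\<epsilon> \<in> fixed" and y: "y \<in> carrier k" "y \<noteq> \<zero>\<^bsub>k\<^esub>" "\<phi> \<epsilon> = y \<otimes>\<^bsub>k\<^esub> y"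
  shows "\<exists>x\<in>fixed. \<phi> x = y \<and> \<epsilon> = x \<otimes> x"
proof -
  obtain x0 where x0: "x0 \<in> fixed" "\<phi> x0 = y" using \<phi>_fixed_surj y by blast
  note cl = fixed_closed(1)[OF x0(1)] fixed_closed(1)[OF \<epsilon>]
  have "bij_betw (\<lambda>s. s \<otimes> (x0 \<oplus> x0) \<oplus> s \<otimes> s \<otimes> \<one>) fixed_nonunits fixed_nonunits"
  proof (rule quadratic_bij)
    fix s s' assume s: "s \<in> fixed_nonunits" "s' \<in> fixed_nonunits"
    have "y \<oplus>\<^bsub>k\<^esub> y = (\<one>\<^bsub>k\<^esub> \<oplus>\<^bsub>k\<^esub> \<one>\<^bsub>k\<^esub>) \<otimes>\<^bsub>k\<^esub> y" using y by (simp add: k.l_distr)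
    then have "y \<oplus>\<^bsub>k\<^esub> y \<noteq> \<zero>\<^bsub>k\<^esub>" using y k.two_nonzero by (simp add: k.integral_iff)
    then show "\<phi> (x0 \<oplus> x0 \<oplus> (s \<oplus> s') \<otimes> \<one>) \<noteq> \<zero>\<^bsub>k\<^esub>"
      using s x0 cl y by (auto simp: fixed_nonunits_def nonunits_def)
  next
    fix s assume s: "s \<in> fixed_nonunits"
    then show "s \<otimes> (x0 \<oplus> x0) \<oplus> s \<otimes> s \<otimes> \<one> \<in> fixed_nonunits"
      using x0 cl y by (auto simp: fixed_nonunits_def nonunits_def intro!: fixed_closed)
  qed (use cl in \<open>auto simp: fixed_nonunits_def nonunits_def\<close>)
  then have surj: "(\<lambda>s. s \<otimes> (x0 \<oplus> x0) \<oplus> s \<otimes> s \<otimes> \<one>) ` fixed_nonunits = fixed_nonunits"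
    by (rule bij_betw_imp_surj_on)
  have "\<epsilon> \<ominus> x0 \<otimes> x0 \<in> fixed_nonunits"
    using x0 cl y \<epsilon> fixed_closed(7)[OF \<epsilon> fixed_closed(5)[OF x0(1) x0(1)]]
    by (simp add: fixed_nonunits_def nonunits_def R.minus_eq k.r_neg)
  then have "\<epsilon> \<ominus> x0 \<otimes> x0 \<in> (\<lambda>s. s \<otimes> (x0 \<oplus> x0) \<oplus> s \<otimes> s \<otimes> \<one>) ` fixed_nonunits"
    by (simp only: surj)
  then obtain s where s: "s \<in> fixed_nonunits" "s \<otimes> (x0 \<oplus> x0) \<oplus> s \<otimes> s \<otimes> \<one> = \<epsilon> \<ominus> x0 \<otimes> x0"
    by (elim imageE) (simp only:)
  have sc: "s \<in> carrier B" "s \<in> fixed" "\<phi> s = \<zero>\<^bsub>k\<^esub>" using s by (auto simp: fixed_nonunits_def nonunits_def)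
  have "(x0 \<oplus> s) \<otimes> (x0 \<oplus> s) = x0 \<otimes> x0 \<oplus> (s \<otimes> (x0 \<oplus> x0) \<oplus> s \<otimes> s)" using sc(1) cl by algebra
  also have "\<dots> = x0 \<otimes> x0 \<oplus> (\<epsilon> \<ominus> x0 \<otimes> x0)" using s(2) sc by simp
  also have "\<dots> = \<epsilon>" using cl by algebra
  finally show ?thesis using x0 sc cl y
    by (intro bexI[of _ "x0 \<oplus> s"] fixed_closed(4) conjI) simp_all
qed

end

section \<open>Hermitian spaces over a finite local ring\<close>

lemma (in module) lin_comb_closed:
  "(\<And>i. i < (n::nat) \<Longrightarrow> b i \<in> carrier M) \<Longrightarrow> (\<And>i. i < n \<Longrightarrow> c i \<in> carrier R) \<Longrightarrow>
    (\<Oplus>\<^bsub>M\<^esub> i\<in>{..<n}. c i \<odot>\<^bsub>M\<^esub> b i) \<in> carrier M"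
  by (intro M.finsum_closed) auto

lemma (in module) lin_comb_Suc:
  assumes "\<And>i. i < Suc n \<Longrightarrow> b i \<in> carrier M" "\<And>i. i < Suc n \<Longrightarrow> c i \<in> carrier R"
  shows "(\<Oplus>\<^bsub>M\<^esub> i\<in>{..<Suc n}. c i \<odot>\<^bsub>M\<^esub> b i) = c n \<odot>\<^bsub>M\<^esub> b n \<oplus>\<^bsub>M\<^esub> (\<Oplus>\<^bsub>M\<^esub> i\<in>{..<n}. c i \<odot>\<^bsub>M\<^esub> b i)"
  unfolding lessThan_Suc by (rule M.finsum_insert) (use assms in auto)

lemma (in module) lin_comb_cong:
  "(\<And>i. i < (n::nat) \<Longrightarrow> b i \<in> carrier M) \<Longrightarrow> (\<And>i. i < n \<Longrightarrow> c i \<in> carrier R) \<Longrightarrow> (\<And>i. i < n \<Longrightarrow> c' i = c i) \<Longrightarrow>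
    (\<Oplus>\<^bsub>M\<^esub> i\<in>{..<n}. c' i \<odot>\<^bsub>M\<^esub> b i) = (\<Oplus>\<^bsub>M\<^esub> i\<in>{..<n}. c i \<odot>\<^bsub>M\<^esub> b i)"
  by (rule M.finsum_cong') auto

lemma (in module) lin_comb_unit:
  assumes b: "\<And>i. i < (n::nat) \<Longrightarrow> b i \<in> carrier M" and j: "j < n" and a: "a \<in> carrier R"
  shows "(\<Oplus>\<^bsub>M\<^esub> i\<in>{..<n}. (if i = j then a else \<zero>) \<odot>\<^bsub>M\<^esub> b i) = a \<odot>\<^bsub>M\<^esub> b j"
proof -
  have "(\<Oplus>\<^bsub>M\<^esub> i\<in>{..<n}. (if i = j then a else \<zero>) \<odot>\<^bsub>M\<^esub> b i) = (\<Oplus>\<^bsub>M\<^esub> i\<in>{..<n}. if j = i then a \<odot>\<^bsub>M\<^esub> b i else \<zero>\<^bsub>M\<^esub>)"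
    by (rule M.finsum_cong') (use b a in auto)
  also have "\<dots> = a \<odot>\<^bsub>M\<^esub> b j" by (rule M.finsum_singleton) (use b j a in auto)
  finally show ?thesis .
qed

text \<open>
  Nondegeneracy is expressed by a dual basis \<open>d\<close> of the basis \<open>e\<close>; the coordinates of a vector are then values
  of the form.
\<close>

locale hermitian_space = finite_local_involution B k \<phi> \<tau> + module B M
  for B :: "('a, 'c) ring_scheme" (structure) and k :: "('k, 'e) ring_scheme"
    and \<phi> :: "'a \<Rightarrow> 'k" and \<tau> :: "'a \<Rightarrow> 'a" and M :: "('a, 'b, 'g) module_scheme" +
  fixes h :: "'b \<Rightarrow> 'b \<Rightarrow> 'a" and m :: nat and e d :: "nat \<Rightarrow> 'b"
  assumes herm: "hermitian_form B \<tau> M h"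
    and basis: "module_basis B M m e"
    and dual_closed: "\<And>i. i < m \<Longrightarrow> d i \<in> carrier M"
    and dual: "\<And>i j. i < m \<Longrightarrow> j < m \<Longrightarrow> h (d i) (e j) = (if i = j then \<one> else \<zero>)"
begin

lemma h_closed [simp]: "x \<in> carrier M \<Longrightarrow> y \<in> carrier M \<Longrightarrow> h x y \<in> carrier B"
  and h_add_l: "x \<in> carrier M \<Longrightarrow> y \<in> carrier M \<Longrightarrow> z \<in> carrier M \<Longrightarrow> h (x \<oplus>\<^bsub>M\<^esub> y) z = h x z \<oplus> h y z"
  and h_add_r: "x \<in> carrier M \<Longrightarrow> y \<in> carrier M \<Longrightarrow> z \<in> carrier M \<Longrightarrow> h x (y \<oplus>\<^bsub>M\<^esub> z) = h x y \<oplus> h x z"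
  and h_smult_r: "a \<in> carrier B \<Longrightarrow> x \<in> carrier M \<Longrightarrow> y \<in> carrier M \<Longrightarrow> h x (a \<odot>\<^bsub>M\<^esub> y) = a \<otimes> h x y"
  and h_sym: "x \<in> carrier M \<Longrightarrow> y \<in> carrier M \<Longrightarrow> h y x = \<tau> (h x y)"
  using herm unfolding hermitian_form_def by blast+

lemma h_smult_l: "a \<in> carrier B \<Longrightarrow> x \<in> carrier M \<Longrightarrow> y \<in> carrier M \<Longrightarrow> h (a \<odot>\<^bsub>M\<^esub> x) y = \<tau> a \<otimes> h x y"
  using h_sym[of y "a \<odot>\<^bsub>M\<^esub> x"] h_sym[of y x] by (simp add: h_smult_r)

lemma h_minus_r: "x \<in> carrier M \<Longrightarrow> y \<in> carrier M \<Longrightarrow> h x (\<ominus>\<^bsub>M\<^esub> y) = \<ominus> h x y"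
  using h_smult_r[of "\<ominus> \<one>" x y] by (simp add: smult_l_minus R.l_minus)

lemma h_minus_l: "x \<in> carrier M \<Longrightarrow> y \<in> carrier M \<Longrightarrow> h (\<ominus>\<^bsub>M\<^esub> x) y = \<ominus> h x y"
  using h_smult_l[of "\<ominus> \<one>" x y] by (simp add: smult_l_minus R.l_minus)

lemma h_zero_r: "x \<in> carrier M \<Longrightarrow> h x \<zero>\<^bsub>M\<^esub> = \<zero>"
  using h_smult_r[of "\<zero>" x "\<zero>\<^bsub>M\<^esub>"] by simp

lemma h_self_fixed: "x \<in> carrier M \<Longrightarrow> h x x \<in> fixed"
  using h_sym[of x x, symmetric] by (simp add: fixed_def)

lemma \<phi>_h_sym: "x \<in> carrier M \<Longrightarrow> y \<in> carrier M \<Longrightarrow> \<phi> (h y x) = \<phi> (h x y)"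
  by (simp add: h_sym[of x y] \<phi>_\<tau>)

text \<open>
  The vectors that are nonzero over the residue field. The definition avoids a choice of coordinates, so
  that invariance under isometries is immediate.
\<close>

definition unimodular :: "'b \<Rightarrow> bool" where
  "unimodular w \<longleftrightarrow> (\<exists>y\<in>carrier M. \<phi> (h w y) \<noteq> \<zero>\<^bsub>k\<^esub>)"

abbreviation lin :: "(nat \<Rightarrow> 'b) \<Rightarrow> nat \<Rightarrow> (nat \<Rightarrow> 'a) \<Rightarrow> 'b" where
  "lin b n c \<equiv> \<Oplus>\<^bsub>M\<^esub> i\<in>{..<n}. c i \<odot>\<^bsub>M\<^esub> b i"

lemma bij_lin:
  assumes "module_basis B M n b"
  shows "bij_betw (lin b n) ({..<n} \<rightarrow>\<^sub>E carrier B) (carrier M)"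
proof (rule bij_betwI')
  have bc: "\<And>i. i < n \<Longrightarrow> b i \<in> carrier M" using assms by (auto simp: module_basis_def)
  have ex: "\<exists>!c. c \<in> {..<n} \<rightarrow>\<^sub>E carrier B \<and> x = lin b n c" if "x \<in> carrier M" for x
    using assms that unfolding module_basis_def by blast
  have cl: "lin b n c \<in> carrier M" if "c \<in> {..<n} \<rightarrow>\<^sub>E carrier B" for c
    using that by (intro lin_comb_closed bc) auto
  then show "lin b n c \<in> carrier M" if "c \<in> {..<n} \<rightarrow>\<^sub>E carrier B" for c using that .
  show "lin b n c = lin b n c' \<longleftrightarrow> c = c'"
    if "c \<in> {..<n} \<rightarrow>\<^sub>E carrier B" "c' \<in> {..<n} \<rightarrow>\<^sub>E carrier B" for c c'
    using ex[OF cl[OF that(1)]] that by blast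
  show "\<exists>c\<in>{..<n} \<rightarrow>\<^sub>E carrier B. x = lin b n c" if "x \<in> carrier M" for x
    using ex[OF that] by blast
qed

lemma h_lin_r:
  assumes x: "x \<in> carrier M" and "\<And>i. i < n \<Longrightarrow> b i \<in> carrier M" "\<And>i. i < n \<Longrightarrow> c i \<in> carrier B"
  shows "h x (lin b n c) = (\<Oplus>i\<in>{..<n}. c i \<otimes> h x (b i))"
  using assms(2-)
proof (induction n)
  case 0 then show ?case using x by (simp add: h_zero_r)
next
  case (Suc n)
  have "h x (lin b (Suc n) c) = h x (c n \<odot>\<^bsub>M\<^esub> b n \<oplus>\<^bsub>M\<^esub> lin b n c)"
    by (subst lin_comb_Suc) (use Suc.prems in auto)
  also have "\<dots> = c n \<otimes> h x (b n) \<oplus> h x (lin b n c)"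
    using Suc.prems x by (subst h_add_r) (auto simp: h_smult_r intro!: lin_comb_closed)
  also have "\<dots> = c n \<otimes> h x (b n) \<oplus> (\<Oplus>i\<in>{..<n}. c i \<otimes> h x (b i))" using Suc by simp
  also have "\<dots> = (\<Oplus>i\<in>{..<Suc n}. c i \<otimes> h x (b i))"
    unfolding lessThan_Suc by (rule R.finsum_insert[symmetric]) (use Suc.prems x in auto)
  finally show ?case .
qed

lemma basis_closed: "i < m \<Longrightarrow> e i \<in> carrier M"
  using basis by (auto simp: module_basis_def)

lemma h_dual_lin:
  assumes i: "i < m" and c: "\<And>i. i < m \<Longrightarrow> c i \<in> carrier B"
  shows "h (d i) (lin e m c) = c i"
proof -
  have "h (d i) (lin e m c) = (\<Oplus>j\<in>{..<m}. c j \<otimes> h (d i) (e j))"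
    by (rule h_lin_r) (use i c basis_closed dual_closed in auto)
  also have "\<dots> = (\<Oplus>j\<in>{..<m}. if i = j then c j else \<zero>)"
    by (rule R.finsum_cong') (use i c dual in auto)
  also have "\<dots> = c i" using R.finsum_singleton[of i "{..<m}" c] i c by auto
  finally show ?thesis .
qed

lemma ex_coord: "x \<in> carrier M \<Longrightarrow> \<exists>c. c \<in> {..<m} \<rightarrow>\<^sub>E carrier B \<and> x = lin e m c"
  using basis unfolding module_basis_def by blast

lemma eq_lin_dual:
  assumes x: "x \<in> carrier M" shows "x = lin e m (\<lambda>i. h (d i) x)"
proof -
  obtain c where c: "c \<in> {..<m} \<rightarrow>\<^sub>E carrier B" "x = lin e m c" using ex_coord[OF x] by blast
  have "lin e m (\<lambda>i. h (d i) x) = lin e m c"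
    by (rule M.finsum_cong') (use c h_dual_lin[of _ c] basis_closed in \<open>auto simp: PiE_iff\<close>)
  then show ?thesis using c by simp
qed

lemma nondeg:
  assumes x: "x \<in> carrier M" and "\<And>y. y \<in> carrier M \<Longrightarrow> h x y = \<zero>"
  shows "x = \<zero>\<^bsub>M\<^esub>"
proof -
  have "h (d i) x = \<zero>" if "i < m" for i
    using assms h_sym[OF x dual_closed[OF that]] dual_closed[OF that] by simp
  then have "lin e m (\<lambda>i. h (d i) x) = (\<Oplus>\<^bsub>M\<^esub> i\<in>{..<m}. \<zero>\<^bsub>M\<^esub>)"
    by (intro M.finsum_cong') (use basis_closed in auto)
  then show ?thesis using eq_lin_dual[OF x] by simp
qed

lemma \<phi>_finsum_zero:
  assumes "\<And>i. i < n \<Longrightarrow> f i \<in> carrier B" "\<And>i. i < (n::nat) \<Longrightarrow> \<phi> (f i) = \<zero>\<^bsub>k\<^esub>"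
  shows "\<phi> (\<Oplus>i\<in>{..<n}. f i) = \<zero>\<^bsub>k\<^esub>"
  using assms
proof (induction n)
  case (Suc n)
  have "(\<Oplus>i\<in>{..<Suc n}. f i) = f n \<oplus> (\<Oplus>i\<in>{..<n}. f i)"
    unfolding lessThan_Suc by (rule R.finsum_insert) (use Suc.prems in auto)
  moreover have "(\<Oplus>i\<in>{..<n}. f i) \<in> carrier B" by (rule R.finsum_closed) (use Suc.prems in auto)
  ultimately show ?case using Suc by simp
qed simp

lemma unimodular_iff:
  assumes w: "w \<in> carrier M"
  shows "unimodular w \<longleftrightarrow> (\<exists>i<m. \<phi> (h (d i) w) \<noteq> \<zero>\<^bsub>k\<^esub>)"
proof
  assume "\<exists>i<m. \<phi> (h (d i) w) \<noteq> \<zero>\<^bsub>k\<^esub>"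
  then obtain i where i: "i < m" "\<phi> (h (d i) w) \<noteq> \<zero>\<^bsub>k\<^esub>" by blast
  then have "\<phi> (h w (d i)) \<noteq> \<zero>\<^bsub>k\<^esub>" using \<phi>_h_sym[OF w dual_closed[OF i(1)]] by simp
  then show "unimodular w" unfolding unimodular_def using dual_closed[OF i(1)] by blast
next
  assume u: "unimodular w"
  show "\<exists>i<m. \<phi> (h (d i) w) \<noteq> \<zero>\<^bsub>k\<^esub>"
  proof (rule ccontr)
    assume n: "\<not> (\<exists>i<m. \<phi> (h (d i) w) \<noteq> \<zero>\<^bsub>k\<^esub>)"
    have "\<phi> (h w y) = \<zero>\<^bsub>k\<^esub>" if y: "y \<in> carrier M" for y
    proof -
      have "h y w = h y (lin e m (\<lambda>i. h (d i) w))" using eq_lin_dual[OF w] by simp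
      also have "\<dots> = (\<Oplus>i\<in>{..<m}. h (d i) w \<otimes> h y (e i))"
        by (rule h_lin_r) (use w y basis_closed dual_closed in auto)
      also have "\<phi> \<dots> = \<zero>\<^bsub>k\<^esub>"
        by (rule \<phi>_finsum_zero) (use n w y basis_closed dual_closed in auto)
      finally show ?thesis using \<phi>_h_sym[OF w y] by simp
    qed
    then show False using u by (auto simp: unimodular_def)
  qed
qed

lemma finite_M: "finite (carrier M)"
  using bij_betw_finite[OF bij_lin[OF basis]] finite_B by (auto intro: finite_PiE)

lemma card_M: "card (carrier M) = card (carrier B) ^ m"
  using bij_betw_same_card[OF bij_lin[OF basis]] by (simp add: card_PiE)

text \<open>
  These are the vectors all of whose coordinates are nonunits.
\<close>

lemma card_not_unimodular: "card {w \<in> carrier M. \<not> unimodular w} = card nonunits ^ m"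
proof -
  have "bij_betw (lin e m) ({..<m} \<rightarrow>\<^sub>E nonunits) {w \<in> carrier M. \<not> unimodular w}"
  proof -
    have N: "nonunits \<subseteq> carrier B" by (auto simp: nonunits_def)
    have "lin e m ` ({..<m} \<rightarrow>\<^sub>E nonunits) = {w \<in> carrier M. \<not> unimodular w}"
    proof (intro equalityI subsetI)
      fix w assume "w \<in> lin e m ` ({..<m} \<rightarrow>\<^sub>E nonunits)"
      then obtain c where c: "c \<in> {..<m} \<rightarrow>\<^sub>E nonunits" "w = lin e m c" by auto
      then have cc: "c i \<in> carrier B" "\<phi> (c i) = \<zero>\<^bsub>k\<^esub>" if "i < m" for i using that by (auto simp: nonunits_def PiE_iff)
      then have w: "w \<in> carrier M" unfolding c(2) by (intro lin_comb_closed basis_closed)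
      then show "w \<in> {w \<in> carrier M. \<not> unimodular w}"
        using unimodular_iff[OF w] cc h_dual_lin[of _ c] c(2) by auto
    next
      fix w assume w: "w \<in> {w \<in> carrier M. \<not> unimodular w}"
      then obtain c where c: "c \<in> {..<m} \<rightarrow>\<^sub>E carrier B" "w = lin e m c" using ex_coord[of w] by blast
      have "c i \<in> nonunits" if "i < m" for i
        using w unimodular_iff[of w] h_dual_lin[of i c] that c by (auto simp: nonunits_def PiE_iff)
      then have "c \<in> {..<m} \<rightarrow>\<^sub>E nonunits" using c by (auto simp: PiE_iff)
      then show "w \<in> lin e m ` ({..<m} \<rightarrow>\<^sub>E nonunits)" using c by blast
    qed
    moreover have "inj_on (lin e m) ({..<m} \<rightarrow>\<^sub>E nonunits)"
      using bij_lin[OF basis] N by (meson PiE_mono bij_betw_imp_inj_on inj_on_subset)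
    ultimately show ?thesis by (simp add: bij_betw_def)
  qed
  from bij_betw_same_card[OF this] show ?thesis by (simp add: card_PiE)
qed

end

section \<open>Transitivity of the unitary group\<close>

context hermitian_space
begin

abbreviation U :: "('b \<Rightarrow> 'b) monoid" where "U \<equiv> unitary_group B M h"

lemma unitary_memD:
  assumes "g \<in> carrier U"
  shows "g \<in> Bij (carrier M)" "x \<in> carrier M \<Longrightarrow> g x \<in> carrier M"
    "x \<in> carrier M \<Longrightarrow> y \<in> carrier M \<Longrightarrow> g (x \<oplus>\<^bsub>M\<^esub> y) = g x \<oplus>\<^bsub>M\<^esub> g y"
    "a \<in> carrier B \<Longrightarrow> x \<in> carrier M \<Longrightarrow> g (a \<odot>\<^bsub>M\<^esub> x) = a \<odot>\<^bsub>M\<^esub> g x"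
    "x \<in> carrier M \<Longrightarrow> y \<in> carrier M \<Longrightarrow> h (g x) (g y) = h x y"
proof -
  have g: "g \<in> Bij (carrier M)" "g \<in> module_hom B M M"
    "\<forall>x \<in> carrier M. \<forall>y \<in> carrier M. h (g x) (g y) = h x y"
    using assms unfolding unitary_group_def by auto
  show "g \<in> Bij (carrier M)" by (rule g(1))
  show "x \<in> carrier M \<Longrightarrow> g x \<in> carrier M" using g(2) by (auto simp: module_hom_def)
  show "x \<in> carrier M \<Longrightarrow> y \<in> carrier M \<Longrightarrow> g (x \<oplus>\<^bsub>M\<^esub> y) = g x \<oplus>\<^bsub>M\<^esub> g y"
    "a \<in> carrier B \<Longrightarrow> x \<in> carrier M \<Longrightarrow> g (a \<odot>\<^bsub>M\<^esub> x) = a \<odot>\<^bsub>M\<^esub> g x"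
    using g(2) unfolding module_hom_def by blast+
  show "x \<in> carrier M \<Longrightarrow> y \<in> carrier M \<Longrightarrow> h (g x) (g y) = h x y" using g(3) by blast
qed

lemma unitary_memI:
  assumes cl: "\<And>x. x \<in> carrier M \<Longrightarrow> g x \<in> carrier M"
    and add: "\<And>x y. x \<in> carrier M \<Longrightarrow> y \<in> carrier M \<Longrightarrow> g (x \<oplus>\<^bsub>M\<^esub> y) = g x \<oplus>\<^bsub>M\<^esub> g y"
    and smult: "\<And>a x. a \<in> carrier B \<Longrightarrow> x \<in> carrier M \<Longrightarrow> g (a \<odot>\<^bsub>M\<^esub> x) = a \<odot>\<^bsub>M\<^esub> g x"
    and iso: "\<And>x y. x \<in> carrier M \<Longrightarrow> y \<in> carrier M \<Longrightarrow> h (g x) (g y) = h x y"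
  shows "restrict g (carrier M) \<in> carrier U"
proof -
  have "inj_on g (carrier M)"
  proof (rule inj_onI)
    fix x y assume xy: "x \<in> carrier M" "y \<in> carrier M" "g x = g y"
    have "x \<ominus>\<^bsub>M\<^esub> y = \<zero>\<^bsub>M\<^esub>"
    proof (rule nondeg)
      fix z assume z: "z \<in> carrier M"
      have "h x z = h y z" using iso[OF xy(1) z] iso[OF xy(2) z] xy(3) by simp
      then show "h (x \<ominus>\<^bsub>M\<^esub> y) z = \<zero>"
        using xy z by (simp add: M.minus_eq h_add_l h_minus_l R.r_neg)
    qed (use xy in auto)
    moreover have "x = (x \<ominus>\<^bsub>M\<^esub> y) \<oplus>\<^bsub>M\<^esub> y" using xy by (simp add: M.minus_eq M.a_assoc M.l_neg)
    ultimately show "x = y" using xy by simp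
  qed
  then have "bij_betw g (carrier M) (carrier M)"
    by (intro bij_betw_imageI endo_inj_surj finite_M) (use cl in auto)
  then have "bij_betw (restrict g (carrier M)) (carrier M) (carrier M)"
    by (simp cong: bij_betw_cong)
  then show ?thesis
    using cl add smult iso unfolding unitary_group_def by (auto simp: Bij_def module_hom_def)
qed

lemma unitary_subgroup: "subgroup (carrier U) (BijGroup (carrier M))"
proof (rule group.subgroupI[OF group_BijGroup])
  show "carrier U \<subseteq> carrier (BijGroup (carrier M))"
    unfolding unitary_group_def by (auto simp: BijGroup_def)
  have "restrict (\<lambda>x. x) (carrier M) \<in> carrier U" by (rule unitary_memI) auto
  then show "carrier U \<noteq> {}" by auto
  fix f g assume f: "f \<in> carrier U" and g: "g \<in> carrier U"
  note fD = unitary_memD[OF f] and gD = unitary_memD[OF g]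
  have "restrict (\<lambda>x. f (g x)) (carrier M) \<in> carrier U"
    by (rule unitary_memI) (auto simp: fD gD)
  then show "f \<otimes>\<^bsub>BijGroup (carrier M)\<^esub> g \<in> carrier U"
    using fD(1) gD(1) by (simp add: BijGroup_def compose_def)
next
  fix f assume f: "f \<in> carrier U"
  note fD = unitary_memD[OF f]
  let ?g = "inv_into (carrier M) f"
  have bij: "bij_betw f (carrier M) (carrier M)" using fD(1) by (simp add: Bij_def)
  have gc: "?g x \<in> carrier M" and fg: "f (?g x) = x" if "x \<in> carrier M" for x
    using that bij by (auto simp: bij_betw_def inv_into_into f_inv_into_f)
  have gf: "?g (f x) = x" if "x \<in> carrier M" for x
    using that bij by (auto simp: bij_betw_def)
  have "restrict ?g (carrier M) \<in> carrier U"
  proof (rule unitary_memI)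
    fix x y assume x: "x \<in> carrier M" and y: "y \<in> carrier M"
    show "?g x \<in> carrier M" by (rule gc[OF x])
    have "f (?g x \<oplus>\<^bsub>M\<^esub> ?g y) = x \<oplus>\<^bsub>M\<^esub> y" using x y by (simp add: fD gc fg)
    then show "?g (x \<oplus>\<^bsub>M\<^esub> y) = ?g x \<oplus>\<^bsub>M\<^esub> ?g y" using gf[of "?g x \<oplus>\<^bsub>M\<^esub> ?g y"] gc x y by simp
    show "h (?g x) (?g y) = h x y" using fD(5)[of "?g x" "?g y"] gc fg x y by simp
    fix a assume a: "a \<in> carrier B"
    have "f (a \<odot>\<^bsub>M\<^esub> ?g x) = a \<odot>\<^bsub>M\<^esub> x" using x a by (simp add: fD gc fg)
    then show "?g (a \<odot>\<^bsub>M\<^esub> x) = a \<odot>\<^bsub>M\<^esub> ?g x" using gf[of "a \<odot>\<^bsub>M\<^esub> ?g x"] gc x a by simp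
  qed
  then show "inv\<^bsub>BijGroup (carrier M)\<^esub> f \<in> carrier U"
    using inv_BijGroup[OF fD(1)] by simp
qed

lemma U_eq: "U = (BijGroup (carrier M))\<lparr>carrier := carrier U\<rparr>"
  unfolding unitary_group_def by simp

lemma unitary_action: "group_action U (carrier M) (\<lambda>g. g)"
proof -
  have "group U" using group.subgroup_imp_group[OF group_BijGroup unitary_subgroup] U_eq by simp
  moreover have "(\<lambda>g. g) \<in> hom U (BijGroup (carrier M))"
    using unitary_memD(1) by (auto simp: hom_def BijGroup_def unitary_group_def)
  ultimately show ?thesis
    by (simp add: group_action_def group_hom_def group_hom_axioms_def group_BijGroup)
qed

lemma unitary_comp:
  assumes "f \<in> carrier U" "g \<in> carrier U" shows "restrict (\<lambda>x. f (g x)) (carrier M) \<in> carrier U"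
  by (rule unitary_memI) (auto simp: unitary_memD[OF assms(1)] unitary_memD[OF assms(2)])

lemma h_diff:
  assumes "x \<in> carrier M" "y \<in> carrier M" "x' \<in> carrier M" "y' \<in> carrier M"
  shows "h (x \<ominus>\<^bsub>M\<^esub> x') (y \<ominus>\<^bsub>M\<^esub> y') = (h x y \<ominus> h x y') \<ominus> (h x' y \<ominus> h x' y')"
  using assms by (simp add: M.minus_eq h_add_l h_add_r h_minus_l h_minus_r R.minus_eq R.minus_add R.a_ac)

text \<open>
  Let \<open>z = u - w\<close> and \<open>a = h z u\<close>. Equality of the lengths of \<open>u\<close> and \<open>w\<close> says that \<open>h z z = a + \<tau> a\<close>, and
  this is what makes the quasi-reflection sending \<open>x\<close> to \<open>x - a\<^sup>-\<^sup>1 h z x z\<close> an isometry. It maps \<open>u\<close> to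
  \<open>u - z = w\<close>. The only obstruction is that \<open>a = h u u - h w u\<close> has to be a unit.
\<close>

lemma reflection_exists:
  assumes u: "u \<in> carrier M" and w: "w \<in> carrier M" and eq: "h u u = h w w"
    and unit: "\<phi> (h w u) \<noteq> \<phi> (h u u)"
  shows "\<exists>g\<in>carrier U. g u = w"
proof -
  define z where "z = u \<ominus>\<^bsub>M\<^esub> w"
  define a where "a = h z u"
  have z: "z \<in> carrier M" using u w by (simp add: z_def)
  have a_eq: "a = h u u \<ominus> h w u" using u w by (simp add: a_def z_def M.minus_eq h_add_l h_minus_l R.minus_eq)
  have ac: "a \<in> carrier B" using z u by (simp add: a_def)
  have "\<phi> a \<noteq> \<zero>\<^bsub>k\<^esub>"
  proof
    assume "\<phi> a = \<zero>\<^bsub>k\<^esub>"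
    then have "\<phi> (h u u) \<ominus>\<^bsub>k\<^esub> \<phi> (h w u) = \<zero>\<^bsub>k\<^esub>" using u w by (simp add: a_eq R.minus_eq k.minus_eq)
    then show False using unit u w by (simp add: k.r_right_minus_eq)
  qed
  then have aU: "a \<in> Units B" using ac by (intro \<phi>_unit)
  define c where "c = inv a"
  have c: "c \<in> carrier B" "c \<otimes> a = \<one>" using aU by (auto simp: c_def)
  have \<tau>c: "\<tau> c \<in> carrier B" "\<tau> c \<otimes> \<tau> a = \<one>" using c ac by (auto simp flip: \<tau>.hom_mult)
  have \<tau>a: "\<tau> a = h u u \<ominus> h u w"
    using h_sym[OF z u] u w by (simp add: a_def z_def M.minus_eq h_add_r h_minus_r R.minus_eq)
  have hzz: "h z z = a \<oplus> \<tau> a"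
  proof -
    have "h z z = h u u \<ominus> h u w \<ominus> h w u \<oplus> h w w"
      using u w by (simp add: z_def M.minus_eq h_add_l h_add_r h_minus_l h_minus_r R.minus_eq R.minus_add R.a_ac)
    also have "\<dots> = (h u u \<ominus> h w u) \<oplus> (h u u \<ominus> h u w)"
      unfolding eq[symmetric] using u w by (simp add: R.minus_eq R.a_ac)
    also have "\<dots> = a \<oplus> \<tau> a" by (simp only: \<tau>a) (simp only: a_eq)
    finally show ?thesis .
  qed
  define r where "r = (\<lambda>x. x \<ominus>\<^bsub>M\<^esub> (c \<otimes> h z x) \<odot>\<^bsub>M\<^esub> z)"
  have "restrict r (carrier M) \<in> carrier U"
  proof (rule unitary_memI)
    fix x y assume x: "x \<in> carrier M" and y: "y \<in> carrier M"
    show "r x \<in> carrier M" using x z c by (simp add: r_def)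
    show "r (x \<oplus>\<^bsub>M\<^esub> y) = r x \<oplus>\<^bsub>M\<^esub> r y"
      using x y z c by (simp add: r_def h_add_r R.r_distr smult_l_distr M.minus_eq M.minus_add M.a_ac)
    { fix b assume b: "b \<in> carrier B"
      show "r (b \<odot>\<^bsub>M\<^esub> x) = b \<odot>\<^bsub>M\<^esub> r x"
        using x z c b by (simp add: r_def h_smult_r smult_r_distr M.minus_eq smult_r_minus R.m_lcomm flip: smult_assoc1) }
    define p where "p = h z x"
    define s where "s = h z y"
    have ps: "p \<in> carrier B" "s \<in> carrier B" using x y z by (auto simp: p_def s_def)
    have hxz: "h x z = \<tau> p" using h_sym[OF z x] by (simp add: p_def)
    have 1: "\<tau> c \<otimes> c \<otimes> (a \<oplus> \<tau> a) = c \<oplus> \<tau> c"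
    proof -
      have "\<tau> c \<otimes> c \<otimes> (a \<oplus> \<tau> a) = \<tau> c \<otimes> (c \<otimes> a) \<oplus> c \<otimes> (\<tau> c \<otimes> \<tau> a)"
        using c(1) \<tau>c(1) ac by (simp add: R.r_distr R.m_ac)
      then show ?thesis using c \<tau>c by (simp add: R.a_comm)
    qed
    have "h (r x) (r y) = (h x y \<ominus> (c \<otimes> s) \<otimes> \<tau> p) \<ominus> (\<tau> c \<otimes> \<tau> p \<otimes> s \<ominus> (c \<otimes> s) \<otimes> (\<tau> c \<otimes> \<tau> p \<otimes> (a \<oplus> \<tau> a)))"
      using x y z c(1) \<tau>c(1) ps ac
      by (simp add: r_def h_diff h_smult_l h_smult_r hxz hzz flip: p_def s_def)
    also have "\<dots> = h x y \<oplus> (s \<otimes> \<tau> p) \<otimes> (\<tau> c \<otimes> c \<otimes> (a \<oplus> \<tau> a) \<ominus> (c \<oplus> \<tau> c))"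
    proof -
      have "(A \<ominus> (c \<otimes> s) \<otimes> P) \<ominus> (C \<otimes> P \<otimes> s \<ominus> (c \<otimes> s) \<otimes> (C \<otimes> P \<otimes> N)) = A \<oplus> (s \<otimes> P) \<otimes> (C \<otimes> c \<otimes> N \<ominus> (c \<oplus> C))"
        if "A \<in> carrier B" "P \<in> carrier B" "C \<in> carrier B" "N \<in> carrier B" for A P C N
        using that c(1) ps(2) by algebra
      then show ?thesis using x y ps \<tau>c(1) ac by simp
    qed
    also have "\<dots> = h x y" unfolding 1 using x y c(1) \<tau>c(1) ps by (simp add: R.minus_eq R.r_neg)
    finally show "h (r x) (r y) = h x y" .
  qed
  moreover have "r u = w"
  proof -
    have "r u = u \<ominus>\<^bsub>M\<^esub> z" using z c by (simp add: r_def flip: a_def)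
    also have "\<dots> = w" using u w by (simp add: z_def M.minus_eq M.minus_add M.r_neg2)
    finally show ?thesis .
  qed
  ultimately show ?thesis using u by (intro bexI[of _ "restrict r (carrier M)"]) simp
qed

text \<open>
  If neither of the two vectors \<open>y1\<close>, \<open>y2\<close> that exist by unimodularity serves both \<open>u\<close> and \<open>w\<close>, then their
  sum does: a module is not the union of two proper submodules.
\<close>

lemma common_nonorthogonal:
  assumes u: "u \<in> carrier M" "unimodular u" and w: "w \<in> carrier M" "unimodular w"
  shows "\<exists>y\<in>carrier M. \<phi> (h u y) \<noteq> \<zero>\<^bsub>k\<^esub> \<and> \<phi> (h w y) \<noteq> \<zero>\<^bsub>k\<^esub>"
proof -
  obtain y1 where y1: "y1 \<in> carrier M" "\<phi> (h u y1) \<noteq> \<zero>\<^bsub>k\<^esub>" using u by (auto simp: unimodular_def)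
  obtain y2 where y2: "y2 \<in> carrier M" "\<phi> (h w y2) \<noteq> \<zero>\<^bsub>k\<^esub>" using w by (auto simp: unimodular_def)
  consider "\<phi> (h w y1) \<noteq> \<zero>\<^bsub>k\<^esub>" | "\<phi> (h u y2) \<noteq> \<zero>\<^bsub>k\<^esub>" | "\<phi> (h w y1) = \<zero>\<^bsub>k\<^esub>" "\<phi> (h u y2) = \<zero>\<^bsub>k\<^esub>"
    by blast
  then show ?thesis
  proof cases
    case 1 then show ?thesis using y1 by blast
  next
    case 2 then show ?thesis using y2 by blast
  next
    case 3
    then show ?thesis using y1 y2 u w by (intro bexI[of _ "y1 \<oplus>\<^bsub>M\<^esub> y2"]) (simp_all add: h_add_r)
  qed
qed

text \<open>
  If \<open>h w u\<close> is a nonunit, no quasi-reflection along \<open>u - w\<close> is available, and one passes through a third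
  vector \<open>y'\<close> of the same length that is orthogonal to neither \<open>u\<close> nor \<open>w\<close> over the residue field. Starting
  from \<open>y0\<close> with \<open>h u y0 = 1\<close> and \<open>h w y0\<close> a unit, it is found on the line \<open>y0 + s u\<close>: adding a multiple of \<open>u\<close>
  does not change the residue of the product with either vector, and the length of \<open>y0 + s u\<close> can be
  prescribed.
\<close>

lemma unitary_transitive:
  assumes u: "u \<in> carrier M" "unimodular u" and w: "w \<in> carrier M" "unimodular w"
    and eq: "h u u = h w w" and iso: "\<phi> (h u u) = \<zero>\<^bsub>k\<^esub>"
  shows "\<exists>g\<in>carrier U. g u = w"
proof (cases "\<phi> (h w u) = \<zero>\<^bsub>k\<^esub>")
  case False
  then show ?thesis using reflection_exists[OF u(1) w(1) eq] iso by simp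
next
  case True
  obtain y where y: "y \<in> carrier M" "\<phi> (h u y) \<noteq> \<zero>\<^bsub>k\<^esub>" "\<phi> (h w y) \<noteq> \<zero>\<^bsub>k\<^esub>"
    using common_nonorthogonal[OF u w] by blast
  define b where "b = inv (h u y)"
  have bU: "h u y \<in> Units B" using y u by (intro \<phi>_unit) auto
  have b: "b \<in> carrier B" "b \<otimes> h u y = \<one>" using bU by (auto simp: b_def)
  define y0 where "y0 = b \<odot>\<^bsub>M\<^esub> y"
  have y0: "y0 \<in> carrier M" using b y by (simp add: y0_def)
  have huy0: "h u y0 = \<one>" using b y u by (simp add: y0_def h_smult_r)
  have hy0u: "h y0 u = \<one>" using h_sym[OF u(1) y0] huy0 by simp
  have "\<phi> b \<otimes>\<^bsub>k\<^esub> \<phi> (h u y) = \<one>\<^bsub>k\<^esub>" using b y u by (simp flip: \<phi>.hom_mult)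
  then have "\<phi> b \<noteq> \<zero>\<^bsub>k\<^esub>" using y u by auto
  then have hwy0: "\<phi> (h w y0) \<noteq> \<zero>\<^bsub>k\<^esub>" using b y w by (simp add: y0_def h_smult_r k.integral_iff)
  define t where "t = h u u"
  have t: "t \<in> fixed" "\<phi> t = \<zero>\<^bsub>k\<^esub>" "t \<in> carrier B" using u iso h_self_fixed by (auto simp: t_def)
  \<comment> \<open>The increment of the length along the line \<open>y0 + s u\<close>. It takes every fixed value because \<open>t\<close> is a
    nonunit and \<open>2\<close> is a unit.\<close>
  have "bij_betw (\<lambda>s. s \<otimes> (\<one> \<oplus> \<one>) \<oplus> s \<otimes> s \<otimes> t) fixed fixed"
  proof (rule quadratic_bij)
    fix s s' assume "s \<in> fixed" "s' \<in> fixed"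
    then have "s \<in> carrier B" "s' \<in> carrier B" using fixed_closed(1) by auto
    then show "\<phi> (\<one> \<oplus> \<one> \<oplus> (s \<oplus> s') \<otimes> t) \<noteq> \<zero>\<^bsub>k\<^esub>" using t k.two_nonzero by simp
  next
    fix s assume "s \<in> fixed"
    then show "s \<otimes> (\<one> \<oplus> \<one>) \<oplus> s \<otimes> s \<otimes> t \<in> fixed" using t by (intro fixed_closed)
  qed (use t fixed_closed(1) in auto)
  then have surj: "(\<lambda>s. s \<otimes> (\<one> \<oplus> \<one>) \<oplus> s \<otimes> s \<otimes> t) ` fixed = fixed" by (rule bij_betw_imp_surj_on)
  have "t \<ominus> h y0 y0 \<in> (\<lambda>s. s \<otimes> (\<one> \<oplus> \<one>) \<oplus> s \<otimes> s \<otimes> t) ` fixed"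
    unfolding surj by (intro fixed_closed t h_self_fixed y0)
  then obtain s where s: "s \<in> fixed" "s \<otimes> (\<one> \<oplus> \<one>) \<oplus> s \<otimes> s \<otimes> t = t \<ominus> h y0 y0"
    by (elim imageE) (simp only:)
  have sc: "s \<in> carrier B" "\<tau> s = s" using s(1) by (simp_all add: fixed_def)
  define y' where "y' = y0 \<oplus>\<^bsub>M\<^esub> s \<odot>\<^bsub>M\<^esub> u"
  have y': "y' \<in> carrier M" using y0 sc u by (simp add: y'_def)
  have "h y' y' = h y0 y0 \<oplus> (s \<otimes> (\<one> \<oplus> \<one>) \<oplus> s \<otimes> s \<otimes> t)"
  proof -
    have "h y' y' = h y0 y0 \<oplus> s \<otimes> h u y0 \<oplus> (s \<otimes> h y0 u \<oplus> s \<otimes> (s \<otimes> h u u))"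
      using y0 sc u by (simp add: y'_def h_add_l h_add_r h_smult_l h_smult_r R.r_distr)
    also have "\<dots> = h y0 y0 \<oplus> s \<otimes> \<one> \<oplus> (s \<otimes> \<one> \<oplus> s \<otimes> (s \<otimes> t))" by (simp only: huy0 hy0u t_def)
    also have "\<dots> = h y0 y0 \<oplus> (s \<otimes> (\<one> \<oplus> \<one>) \<oplus> s \<otimes> s \<otimes> t)"
      using y0 sc(1) t(3) by (simp add: R.r_distr R.a_assoc R.m_assoc)
    finally show ?thesis .
  qed
  also have "\<dots> = t" unfolding s(2)
  proof -
    have "h y0 y0 \<in> carrier B" using y0 by simp
    then show "h y0 y0 \<oplus> (t \<ominus> h y0 y0) = t" using t(3) by algebra
  qed
  finally have hy': "h y' y' = t" .
  have "h u y' = \<one> \<oplus> s \<otimes> t" using y0 sc u by (simp add: y'_def h_add_r h_smult_r huy0 t_def)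
  then have "\<phi> (h u y') = \<one>\<^bsub>k\<^esub>" using sc t by simp
  then have 1: "\<phi> (h y' u) \<noteq> \<phi> (h u u)" using \<phi>_h_sym[OF u(1) y'] iso by simp
  have "\<phi> (h w y') = \<phi> (h w y0)" using y0 sc u w True by (simp add: y'_def h_add_r h_smult_r)
  then have 2: "\<phi> (h w y') \<noteq> \<phi> (h y' y')" using hwy0 hy' t by simp
  obtain g1 where g1: "g1 \<in> carrier U" "g1 u = y'"
    using reflection_exists[OF u(1) y' _ 1] hy' by (auto simp: t_def)
  obtain g2 where g2: "g2 \<in> carrier U" "g2 y' = w"
    using reflection_exists[OF y' w(1) _ 2] hy' eq by (auto simp: t_def)
  show ?thesis using unitary_comp[OF g2(1) g1(1)] g1 g2 u
    by (intro bexI[of _ "restrict (\<lambda>x. g2 (g1 x)) (carrier M)"]) simp_all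
qed

text \<open>
  By transitivity the orbit of \<open>u\<close> consists of all unimodular vectors of its length; the index of the stabilizer
  is the size of the orbit.
\<close>

lemma card_rcosets_stabilizer:
  assumes u: "u \<in> carrier M" "unimodular u" and iso: "\<phi> (h u u) = \<zero>\<^bsub>k\<^esub>"
  shows "card (rcosets\<^bsub>U\<^esub> (stabilizer U (\<lambda>g. g) u)) = card {w \<in> carrier M. unimodular w \<and> h w w = h u u}"
proof -
  have "orbit U (\<lambda>g. g) u = {w \<in> carrier M. unimodular w \<and> h w w = h u u}"
  proof (intro equalityI subsetI)
    fix w assume "w \<in> orbit U (\<lambda>g. g) u"
    then obtain g where g: "g \<in> carrier U" "w = g u" by (auto simp: orbit_def)
    note gD = unitary_memD[OF g(1)]
    obtain y where "y \<in> carrier M" "\<phi> (h u y) \<noteq> \<zero>\<^bsub>k\<^esub>" using u by (auto simp: unimodular_def)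
    then have "unimodular w" unfolding unimodular_def
      by (intro bexI[of _ "g y"]) (simp_all add: g(2) gD u)
    then show "w \<in> {w \<in> carrier M. unimodular w \<and> h w w = h u u}" using u by (simp add: g(2) gD)
  next
    fix w assume w: "w \<in> {w \<in> carrier M. unimodular w \<and> h w w = h u u}"
    then obtain g where "g \<in> carrier U" "g u = w" using unitary_transitive[OF u, of w] iso by auto
    then show "w \<in> orbit U (\<lambda>g. g) u" by (auto simp: orbit_def)
  qed
  then show ?thesis
    using bij_betw_same_card[OF group_action.orbit_stab_fun_is_bij[OF unitary_action u(1)]] by simp
qed

end

section \<open>Lifting isotropic vectors from the residue field\<close>

context hermitian_space
begin

text \<open>
  A choice of a dual basis vector that is not orthogonal to \<open>w\<close> over the residue field. It depends on \<open>w\<close> only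
  modulo the maximal ideal, which makes moves along this vector reversible.
\<close>

definition pivot :: "'b \<Rightarrow> nat" where
  "pivot w = (LEAST i. i < m \<and> \<phi> (h (d i) w) \<noteq> \<zero>\<^bsub>k\<^esub>)"

lemma pivot:
  assumes "w \<in> carrier M" "unimodular w"
  shows "pivot w < m" "\<phi> (h (d (pivot w)) w) \<noteq> \<zero>\<^bsub>k\<^esub>"
proof -
  have "\<exists>i. i < m \<and> \<phi> (h (d i) w) \<noteq> \<zero>\<^bsub>k\<^esub>" using assms unimodular_iff by blast
  from LeastI_ex[OF this] show "pivot w < m" "\<phi> (h (d (pivot w)) w) \<noteq> \<zero>\<^bsub>k\<^esub>"
    by (simp_all add: pivot_def)
qed

lemma \<phi>_h_shift:
  assumes "x \<in> carrier M" "w \<in> carrier M" "z \<in> carrier M" "s \<in> nonunits"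
  shows "\<phi> (h x (w \<oplus>\<^bsub>M\<^esub> s \<odot>\<^bsub>M\<^esub> z)) = \<phi> (h x w)"
  using assms by (simp add: nonunits_def h_add_r h_smult_r)

lemma shift:
  assumes w: "w \<in> carrier M" and z: "z \<in> carrier M" and s: "s \<in> nonunits"
  shows "pivot (w \<oplus>\<^bsub>M\<^esub> s \<odot>\<^bsub>M\<^esub> z) = pivot w"
    and "unimodular (w \<oplus>\<^bsub>M\<^esub> s \<odot>\<^bsub>M\<^esub> z) \<longleftrightarrow> unimodular w"
proof -
  have eq: "(i < m \<and> \<phi> (h (d i) (w \<oplus>\<^bsub>M\<^esub> s \<odot>\<^bsub>M\<^esub> z)) \<noteq> \<zero>\<^bsub>k\<^esub>) = (i < m \<and> \<phi> (h (d i) w) \<noteq> \<zero>\<^bsub>k\<^esub>)" for i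
    using \<phi>_h_shift[OF dual_closed w z s] by auto
  show "pivot (w \<oplus>\<^bsub>M\<^esub> s \<odot>\<^bsub>M\<^esub> z) = pivot w" unfolding pivot_def eq ..
  have "w \<oplus>\<^bsub>M\<^esub> s \<odot>\<^bsub>M\<^esub> z \<in> carrier M" using w z s by (simp add: nonunits_def)
  then show "unimodular (w \<oplus>\<^bsub>M\<^esub> s \<odot>\<^bsub>M\<^esub> z) \<longleftrightarrow> unimodular w"
    using unimodular_iff w eq by simp
qed

lemma fixed_nonunits_closed:
  "s \<in> fixed_nonunits \<Longrightarrow> s \<in> carrier B" "s \<in> fixed_nonunits \<Longrightarrow> s \<in> nonunits" "s \<in> fixed_nonunits \<Longrightarrow> s \<in> fixed"
  "s \<in> fixed_nonunits \<Longrightarrow> \<ominus> s \<in> fixed_nonunits"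
  "s \<in> fixed_nonunits \<Longrightarrow> s' \<in> fixed_nonunits \<Longrightarrow> s \<ominus> s' \<in> fixed_nonunits"
  by (auto simp: fixed_nonunits_def nonunits_def R.minus_eq intro: fixed_closed)

lemma h_line:
  assumes w: "w \<in> carrier M" and z: "z \<in> carrier M" and s: "s \<in> fixed"
  shows "h (w \<oplus>\<^bsub>M\<^esub> s \<odot>\<^bsub>M\<^esub> z) (w \<oplus>\<^bsub>M\<^esub> s \<odot>\<^bsub>M\<^esub> z) = h w w \<oplus> (s \<otimes> (h w z \<oplus> h z w) \<oplus> s \<otimes> s \<otimes> h z z)"
proof -
  have sc: "s \<in> carrier B" "\<tau> s = s" using s by (auto simp: fixed_def)
  have "h (w \<oplus>\<^bsub>M\<^esub> s \<odot>\<^bsub>M\<^esub> z) (w \<oplus>\<^bsub>M\<^esub> s \<odot>\<^bsub>M\<^esub> z) = h w w \<oplus> s \<otimes> h z w \<oplus> (s \<otimes> h w z \<oplus> s \<otimes> (s \<otimes> h z z))"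
    using w z sc by (simp add: h_add_l h_add_r h_smult_l h_smult_r R.r_distr)
  also have "\<dots> = h w w \<oplus> (s \<otimes> (h w z \<oplus> h z w) \<oplus> s \<otimes> s \<otimes> h z z)"
    using w z sc(1) by (simp add: R.r_distr R.m_assoc R.a_ac)
  finally show ?thesis .
qed

text \<open>
  This polynomial is the change of the length of \<open>w\<close> when \<open>s z\<close> is added, see \<open>h_line\<close>. Its linear coefficient
  is a trace with residue \<open>2 \<phi> (h z w)\<close>, a unit.
\<close>

lemma line_bij:
  assumes w: "w \<in> carrier M" and z: "z \<in> carrier M" and nz: "\<phi> (h z w) \<noteq> \<zero>\<^bsub>k\<^esub>"
  shows "bij_betw (\<lambda>s. s \<otimes> (h w z \<oplus> h z w) \<oplus> s \<otimes> s \<otimes> h z z) fixed_nonunits fixed_nonunits"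
proof (rule quadratic_bij)
  have T: "h w z \<oplus> h z w \<in> fixed" using trace_fixed[of "h w z"] h_sym[OF w z] w z by simp
  have "\<phi> (h w z \<oplus> h z w) = (\<one>\<^bsub>k\<^esub> \<oplus>\<^bsub>k\<^esub> \<one>\<^bsub>k\<^esub>) \<otimes>\<^bsub>k\<^esub> \<phi> (h z w)"
    using w z \<phi>_h_sym[OF z w] by (simp add: k.l_distr)
  then have nT: "\<phi> (h w z \<oplus> h z w) \<noteq> \<zero>\<^bsub>k\<^esub>" using nz k.two_nonzero w z by (simp add: k.integral_iff)
  fix s s' assume s: "s \<in> fixed_nonunits" "s' \<in> fixed_nonunits"
  then have "\<phi> (h w z \<oplus> h z w \<oplus> (s \<oplus> s') \<otimes> h z z) = \<phi> (h w z \<oplus> h z w)"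
    using w z by (simp add: fixed_nonunits_def nonunits_def)
  then show "\<phi> (h w z \<oplus> h z w \<oplus> (s \<oplus> s') \<otimes> h z z) \<noteq> \<zero>\<^bsub>k\<^esub>" using nT by simp
next
  have T: "h w z \<oplus> h z w \<in> fixed" using trace_fixed[of "h w z"] h_sym[OF w z] w z by simp
  fix s assume s: "s \<in> fixed_nonunits"
  then have "s \<otimes> (h w z \<oplus> h z w) \<oplus> s \<otimes> s \<otimes> h z z \<in> fixed"
    using fixed_nonunits_closed(3)[OF s] T h_self_fixed[OF z] by (simp add: fixed_closed)
  then show "s \<otimes> (h w z \<oplus> h z w) \<oplus> s \<otimes> s \<otimes> h z z \<in> fixed_nonunits"
    using s w z by (simp add: fixed_nonunits_def nonunits_def)
qed (use w z in \<open>auto simp: fixed_nonunits_def nonunits_def\<close>)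

text \<open>
  A unimodular vector that is isotropic over the residue field reaches the length \<open>t\<close> by exactly one move along
  its pivot vector with a fixed nonunit coefficient. The move preserves the pivot, so it can be undone, and
  the vectors on the left correspond to pairs of a vector of length \<open>t\<close> and a fixed nonunit. In particular
  all lengths in the maximal ideal of the fixed ring are equally frequent.
\<close>

lemma card_isotropic_lift:
  assumes t: "t \<in> fixed_nonunits"
  shows "card {w \<in> carrier M. unimodular w \<and> \<phi> (h w w) = \<zero>\<^bsub>k\<^esub>} =
    card {w \<in> carrier M. unimodular w \<and> h w w = t} * card fixed_nonunits"
proof -
  let ?Z = "{w \<in> carrier M. unimodular w \<and> \<phi> (h w w) = \<zero>\<^bsub>k\<^esub>}"
  let ?T = "{w \<in> carrier M. unimodular w \<and> h w w = t}"
  let ?f = "\<lambda>p. fst p \<oplus>\<^bsub>M\<^esub> snd p \<odot>\<^bsub>M\<^esub> d (pivot (fst p))"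
  have TZ: "?T \<subseteq> ?Z" using t by (auto simp: fixed_nonunits_def nonunits_def)
  have inj: "inj_on ?f (?T \<times> fixed_nonunits)"
  proof (rule inj_onI)
    fix p p' assume p: "p \<in> ?T \<times> fixed_nonunits" and p': "p' \<in> ?T \<times> fixed_nonunits" and eq: "?f p = ?f p'"
    obtain w s w' s' where ws: "p = (w, s)" "p' = (w', s')" by (cases p, cases p')
    have w: "w \<in> carrier M" "unimodular w" "h w w = t" "s \<in> fixed_nonunits"
      and w': "w' \<in> carrier M" "unimodular w'" "h w' w' = t" "s' \<in> fixed_nonunits"
      using p p' ws by auto
    note sc = fixed_nonunits_closed[OF w(4)] and sc' = fixed_nonunits_closed[OF w'(4)]
    define z where "z = d (pivot w)"
    have z: "z \<in> carrier M" using pivot(1)[OF w(1,2)] dual_closed by (simp add: z_def)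
    define y where "y = w \<oplus>\<^bsub>M\<^esub> s \<odot>\<^bsub>M\<^esub> z"
    have zc': "d (pivot w') \<in> carrier M" using pivot(1)[OF w'(1,2)] dual_closed by simp
    have y': "y = w' \<oplus>\<^bsub>M\<^esub> s' \<odot>\<^bsub>M\<^esub> d (pivot w')" using eq ws by (simp add: y_def z_def)
    have "pivot y = pivot w" unfolding y_def by (rule shift(1)[OF w(1) z sc(2)])
    moreover have "pivot y = pivot w'" unfolding y' by (rule shift(1)[OF w'(1) zc' sc'(2)])
    ultimately have y2: "y = w' \<oplus>\<^bsub>M\<^esub> s' \<odot>\<^bsub>M\<^esub> z" using y' by (simp add: z_def)
    have yc: "y \<in> carrier M" using w z sc by (simp add: y_def)
    have wy: "w = y \<oplus>\<^bsub>M\<^esub> (\<ominus> s) \<odot>\<^bsub>M\<^esub> z"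
      using w z sc by (simp add: y_def smult_l_minus M.a_assoc M.r_neg)
    have wy': "w' = y \<oplus>\<^bsub>M\<^esub> (\<ominus> s') \<odot>\<^bsub>M\<^esub> z"
      using w' z sc' by (simp add: y2 smult_l_minus M.a_assoc M.r_neg)
    have "\<phi> (h z w) \<noteq> \<zero>\<^bsub>k\<^esub>" using pivot(2)[OF w(1,2)] by (simp add: z_def)
    then have nz: "\<phi> (h z y) \<noteq> \<zero>\<^bsub>k\<^esub>" using \<phi>_h_shift[OF z w(1) z sc(2)] by (simp add: y_def)
    let ?p = "\<lambda>s. s \<otimes> (h y z \<oplus> h z y) \<oplus> s \<otimes> s \<otimes> h z z"
    have "h y y \<oplus> ?p (\<ominus> s) = t" using h_line[OF yc z, of "\<ominus> s"] sc(3) w(3) fixed_closed(6) by (simp flip: wy)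
    moreover have "h y y \<oplus> ?p (\<ominus> s') = t" using h_line[OF yc z, of "\<ominus> s'"] sc'(3) w'(3) fixed_closed(6) by (simp flip: wy')
    ultimately have "h y y \<oplus> ?p (\<ominus> s) = h y y \<oplus> ?p (\<ominus> s')" by (simp only:)
    moreover have "?p (\<ominus> s) \<in> carrier B" "?p (\<ominus> s') \<in> carrier B" "h y y \<in> carrier B"
      using yc z sc(1) sc'(1) by simp_all
    ultimately have "?p (\<ominus> s) = ?p (\<ominus> s')" by (simp only: R.add.l_cancel)
    then have "\<ominus> s = \<ominus> s'"
      using inj_onD[OF bij_betw_imp_inj_on[OF line_bij[OF yc z nz]]] sc(4) sc'(4) by blast
    then have "\<ominus> (\<ominus> s) = \<ominus> (\<ominus> s')" by (simp only:)
    then have ss: "s = s'" using sc(1) sc'(1) by simp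
    then show "p = p'" using ws wy wy' by simp
  qed
  have "?f ` (?T \<times> fixed_nonunits) = ?Z"
  proof (intro equalityI subsetI)
    fix y assume "y \<in> ?f ` (?T \<times> fixed_nonunits)"
    then obtain w s where w: "w \<in> carrier M" "unimodular w" "h w w = t" "s \<in> fixed_nonunits"
      and y: "y = w \<oplus>\<^bsub>M\<^esub> s \<odot>\<^bsub>M\<^esub> d (pivot w)" by auto
    have z: "d (pivot w) \<in> carrier M" using pivot(1)[OF w(1,2)] dual_closed by simp
    note sc = fixed_nonunits_closed[OF w(4)]
    have "\<phi> (h y y) = \<phi> (h w w)" unfolding y h_line[OF w(1) z sc(3)]
      using w z sc fixed_nonunits_closed(1)[OF t] by (simp add: nonunits_def)
    then show "y \<in> ?Z" using shift(2)[OF w(1) z sc(2)] w z sc t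
      by (simp add: y fixed_nonunits_def nonunits_def)
  next
    fix y assume "y \<in> ?Z"
    then have y: "y \<in> carrier M" "unimodular y" "\<phi> (h y y) = \<zero>\<^bsub>k\<^esub>" by auto
    define z where "z = d (pivot y)"
    have z: "z \<in> carrier M" using pivot(1)[OF y(1,2)] dual_closed by (simp add: z_def)
    have nz: "\<phi> (h z y) \<noteq> \<zero>\<^bsub>k\<^esub>" using pivot(2)[OF y(1,2)] by (simp add: z_def)
    have hyy: "h y y \<in> fixed_nonunits" using y h_self_fixed by (simp add: fixed_nonunits_def nonunits_def)
    have "t \<ominus> h y y \<in> (\<lambda>s. s \<otimes> (h y z \<oplus> h z y) \<oplus> s \<otimes> s \<otimes> h z z) ` fixed_nonunits"
      unfolding bij_betw_imp_surj_on[OF line_bij[OF y(1) z nz]] by (rule fixed_nonunits_closed(5)[OF t hyy])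
    then obtain s where s: "s \<in> fixed_nonunits" "s \<otimes> (h y z \<oplus> h z y) \<oplus> s \<otimes> s \<otimes> h z z = t \<ominus> h y y"
      by (elim imageE) (simp only:)
    note sc = fixed_nonunits_closed[OF s(1)]
    define w where "w = y \<oplus>\<^bsub>M\<^esub> s \<odot>\<^bsub>M\<^esub> z"
    have w: "w \<in> carrier M" using y z sc by (simp add: w_def)
    have "h w w = h y y \<oplus> (t \<ominus> h y y)" unfolding w_def h_line[OF y(1) z sc(3)] s(2) ..
    also have "\<dots> = t"
    proof -
      have "h y y \<in> carrier B" "t \<in> carrier B" using y t fixed_nonunits_closed(1) by auto
      then show ?thesis by algebra
    qed
    finally have "w \<in> ?T" using w shift(2)[OF y(1) z sc(2)] y by (simp add: w_def)
    moreover have "pivot w = pivot y" unfolding w_def by (rule shift(1)[OF y(1) z sc(2)])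
    then have "y = ?f (w, \<ominus> s)"
      using y z sc by (simp add: z_def[symmetric]) (simp add: w_def smult_l_minus M.a_assoc M.r_neg)
    ultimately show "y \<in> ?f ` (?T \<times> fixed_nonunits)" using sc(4) by blast
  qed
  with inj have "bij_betw ?f (?T \<times> fixed_nonunits) ?Z" by (simp add: bij_betw_def)
  from bij_betw_same_card[OF this] show ?thesis by (simp add: card_cartesian_product)
qed

lemma card_isotropic_split:
  "card {w \<in> carrier M. \<phi> (h w w) = \<zero>\<^bsub>k\<^esub>} =
    card {w \<in> carrier M. unimodular w \<and> \<phi> (h w w) = \<zero>\<^bsub>k\<^esub>} + card nonunits ^ m"
proof -
  have "{w \<in> carrier M. \<phi> (h w w) = \<zero>\<^bsub>k\<^esub>} =
    {w \<in> carrier M. unimodular w \<and> \<phi> (h w w) = \<zero>\<^bsub>k\<^esub>} \<union> {w \<in> carrier M. \<not> unimodular w}"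
    by (auto simp: unimodular_def)
  also have "card \<dots> = card {w \<in> carrier M. unimodular w \<and> \<phi> (h w w) = \<zero>\<^bsub>k\<^esub>} + card {w \<in> carrier M. \<not> unimodular w}"
    by (rule card_Un_disjoint) (use finite_M in auto)
  finally show ?thesis by (simp only: card_not_unimodular)
qed

lemma h_orth_add:
  assumes "x \<in> carrier M" "y \<in> carrier M" "h x y = \<zero>"
  shows "h (x \<oplus>\<^bsub>M\<^esub> y) (x \<oplus>\<^bsub>M\<^esub> y) = h x x \<oplus> h y y"
  using assms h_sym[of x y] by (simp add: h_add_l h_add_r)

end

section \<open>Splitting off anisotropic vectors\<close>

context hermitian_space
begin

text \<open>
  The radical of the form that \<open>h\<close> induces over the residue field, restricted to \<open>W\<close>.
\<close>

definition radical :: "'b set \<Rightarrow> 'b set" where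
  "radical W = {w \<in> W. \<forall>y\<in>W. \<phi> (h w y) = \<zero>\<^bsub>k\<^esub>}"

definition perp :: "'b \<Rightarrow> 'b set \<Rightarrow> 'b set" where
  "perp x W = {w \<in> W. h x w = \<zero>}"

lemma submodule_zero: "submodule W B M \<Longrightarrow> \<zero>\<^bsub>M\<^esub> \<in> W"
  using subgroup.one_closed[OF submodule.axioms(1)] by fastforce

lemma perp_submodule:
  assumes W: "submodule W B M" and x: "x \<in> carrier M"
  shows "submodule (perp x W) B M"
proof -
  note WE = submoduleE[OF W]
  show ?thesis
    by (rule submoduleI)
      (use WE submodule_zero[OF W] x in
        \<open>auto simp: perp_def h_zero_r h_minus_r h_add_r h_smult_r subset_iff\<close>)
qed

text \<open>
  A vector whose length is a unit splits off orthogonally: the coefficient of \<open>w\<close> at \<open>x\<close> is \<open>h x w / h x x\<close>.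
\<close>

lemma split_bij:
  assumes W: "submodule W B M" and x: "x \<in> W" and nz: "\<phi> (h x x) \<noteq> \<zero>\<^bsub>k\<^esub>"
  shows "bij_betw (\<lambda>p. fst p \<odot>\<^bsub>M\<^esub> x \<oplus>\<^bsub>M\<^esub> snd p) (carrier B \<times> perp x W) W"
proof (rule bij_betwI')
  note WE = submoduleE[OF W]
  have xc: "x \<in> carrier M" using x WE(1) by auto
  have U: "h x x \<in> Units B" using nz xc by (intro \<phi>_unit) auto
  have hp: "h x (fst p \<odot>\<^bsub>M\<^esub> x \<oplus>\<^bsub>M\<^esub> snd p) = fst p \<otimes> h x x" if p: "p \<in> carrier B \<times> perp x W" for p
  proof -
    have "snd p \<in> carrier M" "h x (snd p) = \<zero>" using p WE(1) by (auto simp: perp_def)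
    then show ?thesis using p xc by (auto simp: h_add_r h_smult_r)
  qed
  show "fst p \<odot>\<^bsub>M\<^esub> x \<oplus>\<^bsub>M\<^esub> snd p \<in> W" if p: "p \<in> carrier B \<times> perp x W" for p
  proof -
    have "snd p \<in> W" "fst p \<in> carrier B" using p by (auto simp: perp_def)
    then show ?thesis by (intro WE(4,5) x)
  qed
  show "fst p \<odot>\<^bsub>M\<^esub> x \<oplus>\<^bsub>M\<^esub> snd p = fst p' \<odot>\<^bsub>M\<^esub> x \<oplus>\<^bsub>M\<^esub> snd p' \<longleftrightarrow> p = p'"
    if p: "p \<in> carrier B \<times> perp x W" and p': "p' \<in> carrier B \<times> perp x W" for p p'
  proof
    assume eq: "fst p \<odot>\<^bsub>M\<^esub> x \<oplus>\<^bsub>M\<^esub> snd p = fst p' \<odot>\<^bsub>M\<^esub> x \<oplus>\<^bsub>M\<^esub> snd p'"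
    have fc: "fst p \<in> carrier B" "fst p' \<in> carrier B" using p p' by (simp_all add: mem_Times_iff)
    have "fst p \<otimes> h x x = fst p' \<otimes> h x x" by (simp only: hp[OF p, symmetric] hp[OF p', symmetric] eq)
    then have "h x x \<otimes> fst p = h x x \<otimes> fst p'" using R.m_comm[of "h x x"] fc xc by simp
    then have f: "fst p = fst p'" using R.Units_l_cancel[OF U] fc by simp
    have c: "fst p' \<odot>\<^bsub>M\<^esub> x \<in> carrier M" "snd p \<in> carrier M" "snd p' \<in> carrier M"
      using p p' fc xc subsetD[OF WE(1)] by (simp_all add: perp_def mem_Times_iff)
    from eq have "fst p' \<odot>\<^bsub>M\<^esub> x \<oplus>\<^bsub>M\<^esub> snd p = fst p' \<odot>\<^bsub>M\<^esub> x \<oplus>\<^bsub>M\<^esub> snd p'" unfolding f .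
    from M.add.l_cancel[OF this c(2,3,1)] have "snd p = snd p'" .
    then show "p = p'" using f by (simp add: prod_eq_iff)
  qed simp
  show "\<exists>p\<in>carrier B \<times> perp x W. w = fst p \<odot>\<^bsub>M\<^esub> x \<oplus>\<^bsub>M\<^esub> snd p" if w: "w \<in> W" for w
  proof -
    have wc: "w \<in> carrier M" using w WE(1) by auto
    define a where "a = h x w \<otimes> inv (h x x)"
    have ac: "a \<in> carrier B" using xc wc U by (simp add: a_def)
    have "a \<otimes> h x x = h x w" using xc wc U by (simp add: a_def R.m_assoc)
    then have "h x (w \<ominus>\<^bsub>M\<^esub> a \<odot>\<^bsub>M\<^esub> x) = \<zero>"
      using xc wc ac by (simp add: M.minus_eq h_add_r h_minus_r h_smult_r R.r_neg)
    moreover have "w \<ominus>\<^bsub>M\<^esub> a \<odot>\<^bsub>M\<^esub> x \<in> W" using w x ac WE by (simp add: M.minus_eq)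
    ultimately have "w \<ominus>\<^bsub>M\<^esub> a \<odot>\<^bsub>M\<^esub> x \<in> perp x W" by (simp add: perp_def)
    moreover have "w = a \<odot>\<^bsub>M\<^esub> x \<oplus>\<^bsub>M\<^esub> (w \<ominus>\<^bsub>M\<^esub> a \<odot>\<^bsub>M\<^esub> x)"
      using wc xc ac by (simp add: M.minus_eq M.a_lcomm M.r_neg)
    ultimately show ?thesis using ac by (intro bexI[of _ "(a, w \<ominus>\<^bsub>M\<^esub> a \<odot>\<^bsub>M\<^esub> x)"]) auto
  qed
qed

lemma h_split:
  assumes W: "submodule W B M" and x: "x \<in> W" and a: "a \<in> carrier B" and w: "w \<in> perp x W"
  shows "\<phi> (h (a \<odot>\<^bsub>M\<^esub> x \<oplus>\<^bsub>M\<^esub> w) (a \<odot>\<^bsub>M\<^esub> x \<oplus>\<^bsub>M\<^esub> w)) = \<phi> (h x x) \<otimes>\<^bsub>k\<^esub> (\<phi> a \<otimes>\<^bsub>k\<^esub> \<phi> a) \<oplus>\<^bsub>k\<^esub> \<phi> (h w w)"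
proof -
  have c: "x \<in> carrier M" "w \<in> carrier M" "h x w = \<zero>"
    using x w submoduleE(1)[OF W] by (auto simp: perp_def)
  have "h (a \<odot>\<^bsub>M\<^esub> x) w = \<zero>" using c a by (simp add: h_smult_l)
  then have "h (a \<odot>\<^bsub>M\<^esub> x \<oplus>\<^bsub>M\<^esub> w) (a \<odot>\<^bsub>M\<^esub> x \<oplus>\<^bsub>M\<^esub> w) = a \<otimes> (\<tau> a \<otimes> h x x) \<oplus> h w w"
    using c a by (simp add: h_orth_add h_smult_l h_smult_r)
  then show ?thesis using c a by (simp add: \<phi>_\<tau> k.m_ac)
qed

text \<open>
  The residue form on \<open>W\<close> is the orthogonal sum of \<open>h x x y\<^sup>2\<close> and the residue form on the complement, and
  \<open>1 + qchar\<close> counts the solutions of \<open>h x x y\<^sup>2 = d\<close>.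
\<close>

lemma card_split_fibre:
  assumes W: "submodule W B M" and x: "x \<in> W" and nz: "\<phi> (h x x) \<noteq> \<zero>\<^bsub>k\<^esub>" and c: "c \<in> carrier k"
  shows "real (card {w \<in> W. \<phi> (h w w) = c}) = (\<Sum>d\<in>carrier k. real (card nonunits) *
    (1 + k.qchar (inv\<^bsub>k\<^esub> \<phi> (h x x) \<otimes>\<^bsub>k\<^esub> d)) * real (card {w \<in> perp x W. \<phi> (h w w) = c \<ominus>\<^bsub>k\<^esub> d}))"
proof -
  note WE = submoduleE[OF W]
  have xc: "x \<in> carrier M" using x WE(1) by auto
  have pc: "perp x W \<subseteq> carrier M" using WE(1) by (auto simp: perp_def)
  let ?f = "\<lambda>a. \<phi> (h x x) \<otimes>\<^bsub>k\<^esub> (\<phi> a \<otimes>\<^bsub>k\<^esub> \<phi> a)"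
  let ?g = "\<lambda>w. \<phi> (h w w)"
  let ?F = "\<lambda>p. fst p \<odot>\<^bsub>M\<^esub> x \<oplus>\<^bsub>M\<^esub> snd p"
  have eq: "?g (?F p) = ?f (fst p) \<oplus>\<^bsub>k\<^esub> ?g (snd p)" if "p \<in> carrier B \<times> perp x W" for p
    using h_split[OF W x] that by auto
  have "bij_betw ?F {p \<in> carrier B \<times> perp x W. ?f (fst p) \<oplus>\<^bsub>k\<^esub> ?g (snd p) = c} {w \<in> W. ?g w = c}"
  proof (rule bij_betw_subset[OF split_bij[OF W x nz], THEN bij_betw_cong[THEN iffD1, rotated]])
    show "?F ` {p \<in> carrier B \<times> perp x W. ?f (fst p) \<oplus>\<^bsub>k\<^esub> ?g (snd p) = c} = {w \<in> W. ?g w = c}"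
    proof (intro equalityI subsetI)
      fix w assume "w \<in> {w \<in> W. ?g w = c}"
      then have w: "w \<in> W" "?g w = c" by auto
      then obtain p where "p \<in> carrier B \<times> perp x W" "w = ?F p"
        using bij_betw_imp_surj_on[OF split_bij[OF W x nz]] by blast
      then show "w \<in> ?F ` {p \<in> carrier B \<times> perp x W. ?f (fst p) \<oplus>\<^bsub>k\<^esub> ?g (snd p) = c}"
        using w eq by auto
    next
      fix w assume "w \<in> ?F ` {p \<in> carrier B \<times> perp x W. ?f (fst p) \<oplus>\<^bsub>k\<^esub> ?g (snd p) = c}"
      then obtain p where p: "p \<in> carrier B \<times> perp x W" "?f (fst p) \<oplus>\<^bsub>k\<^esub> ?g (snd p) = c" "w = ?F p" by blast
      then show "w \<in> {w \<in> W. ?g w = c}"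
        using eq[OF p(1)] bij_betw_imp_surj_on[OF split_bij[OF W x nz]] by blast
    qed
  qed auto
  from bij_betw_same_card[OF this]
  have "card {w \<in> W. ?g w = c} = card {p \<in> carrier B \<times> perp x W. ?f (fst p) \<oplus>\<^bsub>k\<^esub> ?g (snd p) = c}" by simp
  also have "\<dots> = (\<Sum>d\<in>carrier k. card {a \<in> carrier B. ?f a = d} * card {w \<in> perp x W. ?g w = c \<ominus>\<^bsub>k\<^esub> d})"
    by (rule k.card_sum_fibre) (use finite_subset[OF pc finite_M] k.finite_carrier finite_B xc pc c in auto)
  also have "real \<dots> = (\<Sum>d\<in>carrier k. real (card nonunits) *
    (1 + k.qchar (inv\<^bsub>k\<^esub> \<phi> (h x x) \<otimes>\<^bsub>k\<^esub> d)) * real (card {w \<in> perp x W. ?g w = c \<ominus>\<^bsub>k\<^esub> d}))"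
    unfolding of_nat_sum
  proof (rule sum.cong[OF refl])
    fix d assume d: "d \<in> carrier k"
    have "card {a \<in> carrier B. ?f a = d} = card nonunits * card {y \<in> carrier k. \<phi> (h x x) \<otimes>\<^bsub>k\<^esub> (y \<otimes>\<^bsub>k\<^esub> y) = d}"
      by (rule card_\<phi>_preimage)
    moreover have "real (card {y \<in> carrier k. \<phi> (h x x) \<otimes>\<^bsub>k\<^esub> (y \<otimes>\<^bsub>k\<^esub> y) = d}) = 1 + k.qchar (inv\<^bsub>k\<^esub> \<phi> (h x x) \<otimes>\<^bsub>k\<^esub> d)"
      by (rule k.card_scaled_square) (use nz d xc in auto)
    ultimately show "real (card {a \<in> carrier B. ?f a = d} * card {w \<in> perp x W. ?g w = c \<ominus>\<^bsub>k\<^esub> d}) =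
      real (card nonunits) * (1 + k.qchar (inv\<^bsub>k\<^esub> \<phi> (h x x) \<otimes>\<^bsub>k\<^esub> d)) * real (card {w \<in> perp x W. ?g w = c \<ominus>\<^bsub>k\<^esub> d})"
      by simp
  qed
  finally show ?thesis .
qed

text \<open>
  A vector in the radical has a nonunit coefficient at \<open>x\<close>. So the rank of the residue form, which is the
  exponent of \<open>q\<close> in the index of the radical, drops by exactly one with each splitting.
\<close>

lemma card_split_radical:
  assumes W: "submodule W B M" and x: "x \<in> W" and nz: "\<phi> (h x x) \<noteq> \<zero>\<^bsub>k\<^esub>"
  shows "card (radical W) = card nonunits * card (radical (perp x W))"
proof -
  note WE = submoduleE[OF W]
  have xc: "x \<in> carrier M" using x WE(1) by auto
  let ?F = "\<lambda>p. fst p \<odot>\<^bsub>M\<^esub> x \<oplus>\<^bsub>M\<^esub> snd p"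
  note surj = bij_betw_imp_surj_on[OF split_bij[OF W x nz]]
  have form: "\<phi> (h (?F p) (?F p')) = \<phi> (fst p) \<otimes>\<^bsub>k\<^esub> (\<phi> (fst p') \<otimes>\<^bsub>k\<^esub> \<phi> (h x x)) \<oplus>\<^bsub>k\<^esub> \<phi> (h (snd p) (snd p'))"
    if p: "p \<in> carrier B \<times> perp x W" and p': "p' \<in> carrier B \<times> perp x W" for p p'
  proof -
    have c: "fst p \<in> carrier B" "fst p' \<in> carrier B" "snd p \<in> carrier M" "snd p' \<in> carrier M"
      "h x (snd p') = \<zero>" "h x (snd p) = \<zero>" using p p' WE(1) by (auto simp: perp_def)
    have "h (snd p) x = \<zero>" using h_sym[OF xc c(3)] c(6) by simp
    then show ?thesis using c xc by (simp add: h_add_l h_add_r h_smult_l h_smult_r \<phi>_\<tau> k.m_ac)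
  qed
  have rad: "?F p \<in> radical W \<longleftrightarrow> p \<in> nonunits \<times> radical (perp x W)" if p: "p \<in> carrier B \<times> perp x W" for p
  proof
    assume r: "?F p \<in> radical W"
    have z: "\<phi> (h (?F p) (?F p')) = \<zero>\<^bsub>k\<^esub>" if "p' \<in> carrier B \<times> perp x W" for p'
      using r surj that unfolding radical_def by blast
    have z0: "\<zero>\<^bsub>M\<^esub> \<in> perp x W" using submodule_zero[OF perp_submodule[OF W xc]] .
    have c: "fst p \<in> carrier B" "snd p \<in> carrier M" using p WE(1) by (auto simp: perp_def)
    have "\<phi> (fst p) \<otimes>\<^bsub>k\<^esub> \<phi> (h x x) = \<zero>\<^bsub>k\<^esub>"
      using z[of "(\<one>, \<zero>\<^bsub>M\<^esub>)"] form[OF p, of "(\<one>, \<zero>\<^bsub>M\<^esub>)"] z0 c xc by (simp add: h_zero_r)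
    then have n: "\<phi> (fst p) = \<zero>\<^bsub>k\<^esub>" using nz c xc by (simp add: k.integral_iff)
    have "\<phi> (h (snd p) y) = \<zero>\<^bsub>k\<^esub>" if y: "y \<in> perp x W" for y
    proof -
      have "y \<in> carrier M" using y WE(1) by (auto simp: perp_def)
      then show ?thesis using z[of "(\<zero>, y)"] form[OF p, of "(\<zero>, y)"] y c xc n by simp
    qed
    then show "p \<in> nonunits \<times> radical (perp x W)" using n p c by (auto simp: nonunits_def radical_def mem_Times_iff)
  next
    assume r: "p \<in> nonunits \<times> radical (perp x W)"
    have "\<phi> (h (?F p) y) = \<zero>\<^bsub>k\<^esub>" if y: "y \<in> W" for y
    proof -
      obtain p' where p': "p' \<in> carrier B \<times> perp x W" "y = ?F p'" using y surj by blast
      have "fst p' \<in> carrier B" using p' by auto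
      then show ?thesis unfolding p'(2) form[OF p p'(1)] using r p' xc
        by (auto simp: nonunits_def radical_def mem_Times_iff)
    qed
    then show "?F p \<in> radical W" using surj p unfolding radical_def by blast
  qed
  have "bij_betw ?F (nonunits \<times> radical (perp x W)) (radical W)"
  proof (rule bij_betw_subset[OF split_bij[OF W x nz]])
    show sub: "nonunits \<times> radical (perp x W) \<subseteq> carrier B \<times> perp x W" by (auto simp: nonunits_def radical_def)
    show "?F ` (nonunits \<times> radical (perp x W)) = radical W"
    proof (intro equalityI subsetI)
      fix w assume "w \<in> ?F ` (nonunits \<times> radical (perp x W))"
      then obtain p where p: "p \<in> nonunits \<times> radical (perp x W)" "w = ?F p" by blast
      show "w \<in> radical W" unfolding p(2) using rad[OF subsetD[OF sub p(1)]] p(1) by blast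
    next
      fix w assume w: "w \<in> radical W"
      then have "w \<in> W" by (simp add: radical_def)
      then obtain p where p: "p \<in> carrier B \<times> perp x W" "w = ?F p" using surj by blast
      then have "p \<in> nonunits \<times> radical (perp x W)" using rad[OF p(1)] w by simp
      then show "w \<in> ?F ` (nonunits \<times> radical (perp x W))" using p(2) by blast
    qed
  qed
  from bij_betw_same_card[OF this] show ?thesis by (simp add: card_cartesian_product)
qed

end

section \<open>Counting isotropic vectors\<close>

lemma bij_PiE_Suc_Suc:
  "bij_betw (\<lambda>x. ((x n, x (Suc n)), restrict x {..<n})) ({..<Suc (Suc n)} \<rightarrow>\<^sub>E S) ((S \<times> S) \<times> ({..<n} \<rightarrow>\<^sub>E S))"
proof (rule bij_betwI')
  fix x y assume x: "x \<in> {..<Suc (Suc n)} \<rightarrow>\<^sub>E S" and y: "y \<in> {..<Suc (Suc n)} \<rightarrow>\<^sub>E S"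
  show "((x n, x (Suc n)), restrict x {..<n}) = ((y n, y (Suc n)), restrict y {..<n}) \<longleftrightarrow> x = y"
  proof
    assume eq: "((x n, x (Suc n)), restrict x {..<n}) = ((y n, y (Suc n)), restrict y {..<n})"
    show "x = y"
    proof (rule PiE_ext[OF x y])
      fix i assume "i \<in> {..<Suc (Suc n)}"
      then consider "i < n" | "i = n" | "i = Suc n" by fastforce
      then show "x i = y i"
      proof cases
        case 1
        have "restrict x {..<n} i = restrict y {..<n} i" using eq by simp
        then show ?thesis using 1 by simp
      qed (use eq in simp_all)
    qed
  qed simp
next
  fix x assume "x \<in> {..<Suc (Suc n)} \<rightarrow>\<^sub>E S"
  then show "((x n, x (Suc n)), restrict x {..<n}) \<in> (S \<times> S) \<times> ({..<n} \<rightarrow>\<^sub>E S)" by (simp add: PiE_iff)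
next
  fix p assume "p \<in> (S \<times> S) \<times> ({..<n} \<rightarrow>\<^sub>E S)"
  then obtain a b y where p: "p = ((a, b), y)" "a \<in> S" "b \<in> S" "y \<in> {..<n} \<rightarrow>\<^sub>E S" by blast
  define x where "x = y(n := a, Suc n := b)"
  have "x \<in> {..<Suc (Suc n)} \<rightarrow>\<^sub>E S"
    using p by (auto simp: x_def PiE_iff extensional_def less_Suc_eq)
  moreover have "restrict x {..<n} = y"
    by (rule ext) (use p(4) in \<open>simp add: x_def restrict_def PiE_iff extensional_def\<close>)
  ultimately show "\<exists>x\<in>{..<Suc (Suc n)} \<rightarrow>\<^sub>E S. p = ((x n, x (Suc n)), restrict x {..<n})"
    using p(1) by (intro bexI[of _ x]) (simp_all add: x_def)
qed

context hermitian_space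
begin

text \<open>
  Polarization: a symmetric form all of whose lengths vanish is zero, as \<open>2\<close> is invertible.
\<close>

lemma nonorthogonal_anisotropic:
  assumes W: "submodule W B M" and ne: "radical W \<noteq> W"
  shows "\<exists>x\<in>W. \<phi> (h x x) \<noteq> \<zero>\<^bsub>k\<^esub>"
proof (rule ccontr)
  note WE = submoduleE[OF W]
  assume "\<not> (\<exists>x\<in>W. \<phi> (h x x) \<noteq> \<zero>\<^bsub>k\<^esub>)"
  then have iso: "\<phi> (h x x) = \<zero>\<^bsub>k\<^esub>" if "x \<in> W" for x using that by blast
  obtain x y where xy: "x \<in> W" "y \<in> W" "\<phi> (h x y) \<noteq> \<zero>\<^bsub>k\<^esub>" using ne by (auto simp: radical_def)
  have c: "x \<in> carrier M" "y \<in> carrier M" using xy WE(1) by auto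
  have "\<zero>\<^bsub>k\<^esub> = \<phi> (h (x \<oplus>\<^bsub>M\<^esub> y) (x \<oplus>\<^bsub>M\<^esub> y))" using iso WE(5) xy by simp
  also have "\<dots> = \<phi> (h x x) \<oplus>\<^bsub>k\<^esub> \<phi> (h y x) \<oplus>\<^bsub>k\<^esub> (\<phi> (h x y) \<oplus>\<^bsub>k\<^esub> \<phi> (h y y))"
    using c by (simp add: h_add_l h_add_r)
  also have "\<dots> = (\<one>\<^bsub>k\<^esub> \<oplus>\<^bsub>k\<^esub> \<one>\<^bsub>k\<^esub>) \<otimes>\<^bsub>k\<^esub> \<phi> (h x y)"
    using c iso xy by (simp add: \<phi>_h_sym[OF c] k.l_distr)
  finally show False using xy c k.two_nonzero by (simp add: k.integral_iff eq_commute[of "\<zero>\<^bsub>k\<^esub>"])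
qed

lemma sum_card_form:
  assumes "W \<subseteq> carrier M"
  shows "(\<Sum>c\<in>carrier k. real (card {w \<in> W. \<phi> (h w w) = c})) = real (card W)"
proof -
  have "(\<Sum>c\<in>carrier k. card {w \<in> W. \<phi> (h w w) = c}) = card W"
    by (rule sum_card_fibres) (use assms finite_subset[OF assms finite_M] k.finite_carrier in auto)
  then show ?thesis by (simp flip: of_nat_sum)
qed

lemma q_pos: "real k.q > 0" using k.card_ge2 by simp

text \<open>
  Vectors whose length is a unit are split off until the residue form vanishes. Each splitting gives one sign
  by \<open>twisted_convolution\<close> and one factor \<open>q\<close> to the index of the radical, so the exponent of \<open>-1\<close> is the rank of
  the residue form.
\<close>

lemma form_count_twist:
  assumes s: "s \<in> carrier k - {\<zero>\<^bsub>k\<^esub>}"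
    and qchar_s: "\<And>c. c \<in> carrier k \<Longrightarrow> k.qchar (s \<otimes>\<^bsub>k\<^esub> c) = - k.qchar c"
    and W: "submodule W B M"
  shows "\<exists>n. card W = k.q ^ n * card (radical W) \<and> (\<forall>c\<in>carrier k.
    real (card {w \<in> W. \<phi> (h w w) = s \<otimes>\<^bsub>k\<^esub> c}) - real (card W) / real k.q =
    (-1) ^ n * (real (card {w \<in> W. \<phi> (h w w) = c}) - real (card W) / real k.q))"
  using W
proof (induction "card W" arbitrary: W rule: less_induct)
  case less
  note W = less.prems
  note WE = submoduleE[OF W]
  have fW: "finite W" using WE(1) finite_M finite_subset by auto
  show ?case
  proof (cases "radical W = W")
    case True
    have iso: "\<phi> (h w w) = \<zero>\<^bsub>k\<^esub>" if w: "w \<in> W" for w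
    proof -
      have "w \<in> radical W" using w True by simp
      then show ?thesis using w by (simp add: radical_def)
    qed
    have eq: "card {w \<in> W. \<phi> (h w w) = s \<otimes>\<^bsub>k\<^esub> c} = card {w \<in> W. \<phi> (h w w) = c}" if c: "c \<in> carrier k" for c
    proof -
      have 1: "s \<otimes>\<^bsub>k\<^esub> c = \<zero>\<^bsub>k\<^esub> \<longleftrightarrow> c = \<zero>\<^bsub>k\<^esub>" using s c k.integral_iff[of s c] by simp
      have "{w \<in> W. \<phi> (h w w) = s \<otimes>\<^bsub>k\<^esub> c} = {w \<in> W. \<phi> (h w w) = c}"
        by (rule Collect_cong) (use iso 1 in \<open>auto simp only:\<close>)
      then show ?thesis by (simp only:)
    qed
    show ?thesis by (intro exI[of _ 0]) (simp add: True eq)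
  next
    case False
    obtain x where x: "x \<in> W" "\<phi> (h x x) \<noteq> \<zero>\<^bsub>k\<^esub>" using nonorthogonal_anisotropic[OF W False] by blast
    have xc: "x \<in> carrier M" using x WE(1) by auto
    have P: "submodule (perp x W) B M" by (rule perp_submodule[OF W xc])
    have pc: "perp x W \<subseteq> carrier M" using WE(1) by (auto simp: perp_def)
    have "x \<notin> perp x W" using x by (auto simp: perp_def)
    then have "perp x W \<subset> W" using x by (auto simp: perp_def)
    then have "card (perp x W) < card W" by (rule psubset_card_mono[OF fW])
    from less.hyps[OF this P] obtain n where n: "card (perp x W) = k.q ^ n * card (radical (perp x W))"
      and tw: "\<And>c. c \<in> carrier k \<Longrightarrow>
        real (card {w \<in> perp x W. \<phi> (h w w) = s \<otimes>\<^bsub>k\<^esub> c}) - real (card (perp x W)) / real k.q =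
        (-1) ^ n * (real (card {w \<in> perp x W. \<phi> (h w w) = c}) - real (card (perp x W)) / real k.q)"
      by blast
    have cW: "card W = k.q * card nonunits * card (perp x W)"
      using bij_betw_same_card[OF split_bij[OF W x]] by (simp add: card_cartesian_product card_B)
    have ia: "inv\<^bsub>k\<^esub> \<phi> (h x x) \<in> carrier k - {\<zero>\<^bsub>k\<^esub>}"
    proof -
      have "\<phi> (h x x) \<in> carrier k - {\<zero>\<^bsub>k\<^esub>}" using x xc by simp
      from k.inv_mult[OF this] show ?thesis using xc by auto
    qed
    have "real (card {w \<in> W. \<phi> (h w w) = s \<otimes>\<^bsub>k\<^esub> c}) -
        real (card nonunits) * (real (card (perp x W)) / real k.q) * real k.q =
      (- ((-1) ^ n)) * (real (card {w \<in> W. \<phi> (h w w) = c}) -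
        real (card nonunits) * (real (card (perp x W)) / real k.q) * real k.q)"
      if c: "c \<in> carrier k" for c
    proof (rule k.twisted_convolution[where N = "\<lambda>c. real (card {w \<in> perp x W. \<phi> (h w w) = c})"
          and N' = "\<lambda>c. real (card {w \<in> W. \<phi> (h w w) = c})", OF ia s qchar_s tw _ _ c])
      show "(\<Sum>c\<in>carrier k. real (card {w \<in> perp x W. \<phi> (h w w) = c})) = real (card (perp x W)) / real k.q * real k.q"
        using sum_card_form[OF pc] q_pos by simp
    qed (assumption | (rule card_split_fibre[OF W x], assumption))+
    moreover have "real (card nonunits) * (real (card (perp x W)) / real k.q) * real k.q = real (card W) / real k.q"
      using q_pos by (simp add: cW)
    moreover have "card W = k.q ^ Suc n * card (radical W)"
      unfolding card_split_radical[OF W x] cW n by simp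
    ultimately show ?thesis by (intro exI[of _ "Suc n"]) simp
  qed
qed

lemma card_nonunits_pos: "card nonunits > 0"
proof -
  have "\<zero> \<in> nonunits" by (simp add: nonunits_def)
  moreover have "finite nonunits" using finite_B by (simp add: nonunits_def)
  ultimately show ?thesis by (auto simp: card_gt_0_iff)
qed

text \<open>
  The value \<open>0\<close> is not moved by multiplication with the nonsquare \<open>s\<close>. In odd rank its frequency therefore
  deviates from the mean by a number equal to its own negative.
\<close>

lemma card_isotropic_odd:
  assumes "odd m"
  shows "card {w \<in> carrier M. \<phi> (h w w) = \<zero>\<^bsub>k\<^esub>} = k.q ^ (m - 1) * card nonunits ^ m"
proof -
  obtain s where s: "s \<in> carrier k - {\<zero>\<^bsub>k\<^esub>}" "\<And>c. c \<in> carrier k \<Longrightarrow> k.qchar (s \<otimes>\<^bsub>k\<^esub> c) = - k.qchar c"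
    using k.exists_nonsquare_twist by blast
  obtain n where n: "card (carrier M) = k.q ^ n * card (radical (carrier M))"
    and tw: "\<And>c. c \<in> carrier k \<Longrightarrow>
    real (card {w \<in> carrier M. \<phi> (h w w) = s \<otimes>\<^bsub>k\<^esub> c}) - real (card (carrier M)) / real k.q =
    (-1) ^ n * (real (card {w \<in> carrier M. \<phi> (h w w) = c}) - real (card (carrier M)) / real k.q)"
    using form_count_twist[OF s carrier_is_submodule] by blast
  have "radical (carrier M) = {w \<in> carrier M. \<not> unimodular w}" by (auto simp: radical_def unimodular_def)
  then have "card (radical (carrier M)) = card nonunits ^ m" by (simp add: card_not_unimodular)
  then have "k.q ^ m * card nonunits ^ m = k.q ^ n * card nonunits ^ m"
    using n by (simp add: card_M card_B power_mult_distrib)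
  then have "k.q ^ m = k.q ^ n" using card_nonunits_pos by simp
  then have "m = n" using k.card_ge2 by (simp add: power_inject_exp)
  then have "real (card {w \<in> carrier M. \<phi> (h w w) = \<zero>\<^bsub>k\<^esub>}) = real (card (carrier M)) / real k.q"
    using tw[of "\<zero>\<^bsub>k\<^esub>"] s(1) assms by simp
  also have "\<dots> = real (k.q ^ (m - 1) * card nonunits ^ m)"
    using assms q_pos by (cases m) (simp_all add: card_M card_B power_mult_distrib)
  finally show ?thesis by (simp only: of_nat_eq_iff)
qed

text \<open>
  Coefficient vectors are counted, rather than vectors of \<open>M\<close>, in order that the first \<open>n\<close> members of a longer
  basis can be treated by recursion on \<open>n\<close>.
\<close>

definition lin_count :: "(nat \<Rightarrow> 'b) \<Rightarrow> nat \<Rightarrow> 'k \<Rightarrow> nat" where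
  "lin_count b n c = card {x \<in> {..<n} \<rightarrow>\<^sub>E carrier B. \<phi> (h (lin b n x) (lin b n x)) = c}"

lemma lin_count_basis:
  assumes "module_basis B M n b"
  shows "lin_count b n c = card {w \<in> carrier M. \<phi> (h w w) = c}"
proof -
  have "bij_betw (lin b n) {x \<in> {..<n} \<rightarrow>\<^sub>E carrier B. \<phi> (h (lin b n x) (lin b n x)) = c}
      {w \<in> carrier M. \<phi> (h w w) = c}"
    by (rule bij_betw_Collect[OF bij_lin[OF assms]]) (rule refl)
  then show ?thesis unfolding lin_count_def by (rule bij_betw_same_card)
qed

lemma finsum_zero_terms: "(\<And>i. i < (n::nat) \<Longrightarrow> f i = \<zero>) \<Longrightarrow> (\<Oplus>i\<in>{..<n}. f i) = \<zero>"
proof -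
  assume "\<And>i. i < n \<Longrightarrow> f i = \<zero>"
  then have "(\<Oplus>i\<in>{..<n}. f i) = (\<Oplus>i\<in>{..<n}. \<zero>)" by (intro R.finsum_cong') auto
  then show ?thesis by simp
qed

lemma lin_Suc_form:
  assumes b: "\<And>i. i \<le> n \<Longrightarrow> b i \<in> carrier M" and orth: "\<And>i. i < n \<Longrightarrow> h (b n) (b i) = \<zero>"
    and x: "\<And>i. i \<le> n \<Longrightarrow> x i \<in> carrier B"
  shows "\<phi> (h (lin b (Suc n) x) (lin b (Suc n) x)) =
    \<phi> (h (b n) (b n)) \<otimes>\<^bsub>k\<^esub> (\<phi> (x n) \<otimes>\<^bsub>k\<^esub> \<phi> (x n)) \<oplus>\<^bsub>k\<^esub> \<phi> (h (lin b n x) (lin b n x))"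
proof -
  have c: "x n \<in> carrier B" "b n \<in> carrier M" "lin b n x \<in> carrier M"
    using b x by (auto intro!: lin_comb_closed)
  have "h (b n) (lin b n x) = (\<Oplus>i\<in>{..<n}. x i \<otimes> h (b n) (b i))"
    by (rule h_lin_r) (use b x in auto)
  also have "\<dots> = \<zero>" by (rule finsum_zero_terms) (use orth x in auto)
  finally have "h (x n \<odot>\<^bsub>M\<^esub> b n) (lin b n x) = \<zero>" using c by (simp add: h_smult_l)
  moreover have "lin b (Suc n) x = x n \<odot>\<^bsub>M\<^esub> b n \<oplus>\<^bsub>M\<^esub> lin b n x" by (rule lin_comb_Suc) (use b x in auto)
  ultimately have "h (lin b (Suc n) x) (lin b (Suc n) x) = x n \<otimes> (\<tau> (x n) \<otimes> h (b n) (b n)) \<oplus> h (lin b n x) (lin b n x)"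
    using c by (simp add: h_orth_add h_smult_l h_smult_r)
  then show ?thesis using c by (simp add: \<phi>_\<tau> k.m_ac)
qed

lemma lin_count_two_more:
  assumes b: "\<And>i. i < Suc (Suc n) \<Longrightarrow> b i \<in> carrier M"
    and orth: "\<And>i j. i < Suc (Suc n) \<Longrightarrow> j < Suc (Suc n) \<Longrightarrow> i \<noteq> j \<Longrightarrow> h (b i) (b j) = \<zero>"
    and a: "a = \<phi> (h (b n) (b n))" and a': "a' = \<phi> (h (b (Suc n)) (b (Suc n)))"
    and c: "c \<in> carrier k"
  shows "lin_count b (Suc (Suc n)) c = (\<Sum>d\<in>carrier k. card nonunits ^ 2 *
    card {p \<in> carrier k \<times> carrier k. a \<otimes>\<^bsub>k\<^esub> (fst p \<otimes>\<^bsub>k\<^esub> fst p) \<oplus>\<^bsub>k\<^esub> a' \<otimes>\<^bsub>k\<^esub> (snd p \<otimes>\<^bsub>k\<^esub> snd p) = d} *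
    lin_count b n (c \<ominus>\<^bsub>k\<^esub> d))"
proof -
  let ?E = "\<lambda>n. {..<n} \<rightarrow>\<^sub>E carrier B"
  let ?q = "\<lambda>n x. \<phi> (h (lin b n x) (lin b n x))"
  let ?f = "\<lambda>p. a \<otimes>\<^bsub>k\<^esub> (\<phi> (fst p) \<otimes>\<^bsub>k\<^esub> \<phi> (fst p)) \<oplus>\<^bsub>k\<^esub> a' \<otimes>\<^bsub>k\<^esub> (\<phi> (snd p) \<otimes>\<^bsub>k\<^esub> \<phi> (snd p))"
  have ac: "a \<in> carrier k" "a' \<in> carrier k" using b by (auto simp: a a')
  have lc: "lin b n x \<in> carrier M" if "x \<in> ?E n" for x
    using that b by (intro lin_comb_closed) auto
  let ?g = "\<lambda>x. ((x n, x (Suc n)), restrict x {..<n})"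
  have bij: "bij_betw ?g (?E (Suc (Suc n))) ((carrier B \<times> carrier B) \<times> ?E n)"
    by (rule bij_PiE_Suc_Suc)
  have q: "?q (Suc (Suc n)) x = ?f (fst (?g x)) \<oplus>\<^bsub>k\<^esub> ?q n (snd (?g x))" if x: "x \<in> ?E (Suc (Suc n))" for x
  proof -
    have xc: "x i \<in> carrier B" if "i < Suc (Suc n)" for i using x that by (auto simp: PiE_iff)
    have "lin b n (restrict x {..<n}) = lin b n x" by (rule lin_comb_cong) (use b xc in auto)
    moreover have l: "lin b n x \<in> carrier M" using b xc by (intro lin_comb_closed) auto
    moreover have "?q (Suc (Suc n)) x = a' \<otimes>\<^bsub>k\<^esub> (\<phi> (x (Suc n)) \<otimes>\<^bsub>k\<^esub> \<phi> (x (Suc n))) \<oplus>\<^bsub>k\<^esub> ?q (Suc n) x"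
      unfolding a' by (rule lin_Suc_form) (use b xc orth in auto)
    moreover have "?q (Suc n) x = a \<otimes>\<^bsub>k\<^esub> (\<phi> (x n) \<otimes>\<^bsub>k\<^esub> \<phi> (x n)) \<oplus>\<^bsub>k\<^esub> ?q n x"
      unfolding a by (rule lin_Suc_form) (use b xc orth in auto)
    ultimately show ?thesis using ac xc[of n] xc[of "Suc n"] by (simp add: k.a_ac)
  qed
  have "bij_betw ?g {x \<in> ?E (Suc (Suc n)). ?q (Suc (Suc n)) x = c}
     {p \<in> (carrier B \<times> carrier B) \<times> ?E n. ?f (fst p) \<oplus>\<^bsub>k\<^esub> ?q n (snd p) = c}"
    by (rule bij_betw_Collect[OF bij]) (simp only: q)
  from bij_betw_same_card[OF this]
  have "lin_count b (Suc (Suc n)) c = card {p \<in> (carrier B \<times> carrier B) \<times> ?E n. ?f (fst p) \<oplus>\<^bsub>k\<^esub> ?q n (snd p) = c}"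
    by (simp only: lin_count_def)
  also have "\<dots> = (\<Sum>d\<in>carrier k. card {p \<in> carrier B \<times> carrier B. ?f p = d} * card {x \<in> ?E n. ?q n x = c \<ominus>\<^bsub>k\<^esub> d})"
    by (rule k.card_sum_fibre) (use k.finite_carrier finite_B ac c lc in \<open>auto intro: finite_PiE\<close>)
  finally show ?thesis
    unfolding lin_count_def[of b n] card_\<phi>_preimage2[of "\<lambda>x y. a \<otimes>\<^bsub>k\<^esub> (x \<otimes>\<^bsub>k\<^esub> x) \<oplus>\<^bsub>k\<^esub> a' \<otimes>\<^bsub>k\<^esub> (y \<otimes>\<^bsub>k\<^esub> y) = _"] .
qed

lemma sum_lin_count:
  assumes "\<And>i. i < n \<Longrightarrow> b i \<in> carrier M"
  shows "(\<Sum>c\<in>carrier k. lin_count b n c) = (k.q * card nonunits) ^ n"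
proof -
  have "(\<Sum>c\<in>carrier k. lin_count b n c) = card ({..<n} \<rightarrow>\<^sub>E carrier B)"
    unfolding lin_count_def
    by (rule sum_card_fibres) (use k.finite_carrier finite_B assms in \<open>auto intro!: finite_PiE lin_comb_closed \<phi>.hom_closed h_closed\<close>)
  then show ?thesis by (simp add: card_PiE card_B)
qed

text \<open>
  On a hyperbolic plane over the residue field every value is taken \<open>q - 1\<close> times, and \<open>0\<close> is taken \<open>q\<close> times
  more. Convolution with the constant part sees only the total number of vectors; hence each further
  plane multiplies the excess at \<open>0\<close> by \<open>q\<close>, apart from the sizes of the fibres of the residue map.
\<close>

lemma lin_count_hyperbolic:
  assumes b: "\<And>i. i < 2 * r \<Longrightarrow> b i \<in> carrier M"
    and orth: "\<And>i j. i < 2 * r \<Longrightarrow> j < 2 * r \<Longrightarrow> i \<noteq> j \<Longrightarrow> h (b i) (b j) = \<zero>"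
    and diag: "\<And>i. i < 2 * r \<Longrightarrow> h (b i) (b i) = (if even i then \<one> else \<ominus> \<one>)"
    and c: "c \<in> carrier k"
  shows "real (lin_count b (2 * r) c) = real (card nonunits) ^ (2 * r) *
    (real k.q ^ (2 * r) / real k.q - real k.q ^ r / real k.q + (if c = \<zero>\<^bsub>k\<^esub> then real k.q ^ r else 0))"
  using assms
proof (induction r arbitrary: c)
  case 0
  have "{x. x = (\<lambda>x. undefined) \<and> \<zero>\<^bsub>k\<^esub> = c} = (if c = \<zero>\<^bsub>k\<^esub> then {\<lambda>x. undefined} else {})" by auto
  then have "lin_count b 0 c = (if c = \<zero>\<^bsub>k\<^esub> then 1 else 0)" by (simp add: lin_count_def h_zero_r)
  then show ?case by simp
next
  case (Suc r)
  let ?q = "real k.q" and ?R = "real (card nonunits)"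
  have IH: "real (lin_count b (2 * r) c) = ?R ^ (2 * r) *
    (?q ^ (2 * r) / ?q - ?q ^ r / ?q + (if c = \<zero>\<^bsub>k\<^esub> then ?q ^ r else 0))" if "c \<in> carrier k" for c
    by (rule Suc.IH) (use Suc.prems that in auto)
  let ?G = "\<lambda>c. real (lin_count b (2 * r) c)"
  have S2: "2 * Suc r = Suc (Suc (2 * r))" by simp
  have P: "card {p \<in> carrier k \<times> carrier k. \<one>\<^bsub>k\<^esub> \<otimes>\<^bsub>k\<^esub> (fst p \<otimes>\<^bsub>k\<^esub> fst p) \<oplus>\<^bsub>k\<^esub> \<ominus>\<^bsub>k\<^esub> \<one>\<^bsub>k\<^esub> \<otimes>\<^bsub>k\<^esub> (snd p \<otimes>\<^bsub>k\<^esub> snd p) = d} =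
    k.q - 1 + (if d = \<zero>\<^bsub>k\<^esub> then k.q else 0)" if d: "d \<in> carrier k" for d
  proof -
    have "{p \<in> carrier k \<times> carrier k. \<one>\<^bsub>k\<^esub> \<otimes>\<^bsub>k\<^esub> (fst p \<otimes>\<^bsub>k\<^esub> fst p) \<oplus>\<^bsub>k\<^esub> \<ominus>\<^bsub>k\<^esub> \<one>\<^bsub>k\<^esub> \<otimes>\<^bsub>k\<^esub> (snd p \<otimes>\<^bsub>k\<^esub> snd p) = d} =
       {p \<in> carrier k \<times> carrier k. fst p \<otimes>\<^bsub>k\<^esub> fst p \<oplus>\<^bsub>k\<^esub> \<ominus>\<^bsub>k\<^esub> \<one>\<^bsub>k\<^esub> \<otimes>\<^bsub>k\<^esub> (snd p \<otimes>\<^bsub>k\<^esub> snd p) = d}"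
      by auto
    then show ?thesis using k.card_hyperbolic[OF d] by simp
  qed
  have "lin_count b (2 * Suc r) c = (\<Sum>d\<in>carrier k. card nonunits ^ 2 *
    card {p \<in> carrier k \<times> carrier k. \<one>\<^bsub>k\<^esub> \<otimes>\<^bsub>k\<^esub> (fst p \<otimes>\<^bsub>k\<^esub> fst p) \<oplus>\<^bsub>k\<^esub> \<ominus>\<^bsub>k\<^esub> \<one>\<^bsub>k\<^esub> \<otimes>\<^bsub>k\<^esub> (snd p \<otimes>\<^bsub>k\<^esub> snd p) = d} *
    lin_count b (2 * r) (c \<ominus>\<^bsub>k\<^esub> d))"
    unfolding S2 by (rule lin_count_two_more) (use Suc.prems in auto)
  also have "\<dots> = (\<Sum>d\<in>carrier k. card nonunits ^ 2 * (k.q - 1 + (if d = \<zero>\<^bsub>k\<^esub> then k.q else 0)) * lin_count b (2 * r) (c \<ominus>\<^bsub>k\<^esub> d))"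
    by (rule sum.cong) (simp_all only: P)
  finally have N: "lin_count b (2 * Suc r) c = \<dots>" .
  have "real (lin_count b (2 * Suc r) c) = (\<Sum>d\<in>carrier k. ?R ^ 2 * (?q - 1) * ?G (c \<ominus>\<^bsub>k\<^esub> d) + (if d = \<zero>\<^bsub>k\<^esub> then ?R ^ 2 * ?q * ?G c else 0))"
    unfolding N of_nat_sum
  proof (rule sum.cong[OF refl])
    fix d assume d: "d \<in> carrier k"
    have q1: "real (k.q - 1) = ?q - 1" using k.card_ge2 by simp
    show "real (card nonunits ^ 2 * (k.q - 1 + (if d = \<zero>\<^bsub>k\<^esub> then k.q else 0)) * lin_count b (2 * r) (c \<ominus>\<^bsub>k\<^esub> d)) =
      ?R ^ 2 * (?q - 1) * ?G (c \<ominus>\<^bsub>k\<^esub> d) + (if d = \<zero>\<^bsub>k\<^esub> then ?R ^ 2 * ?q * ?G c else 0)"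
    proof (cases "d = \<zero>\<^bsub>k\<^esub>")
      case True
      have c0: "c \<ominus>\<^bsub>k\<^esub> \<zero>\<^bsub>k\<^esub> = c" using Suc.prems(4) by (simp add: k.minus_eq)
      have "?R ^ 2 * ((?q - 1) + ?q) * g = ?R ^ 2 * (?q - 1) * g + ?R ^ 2 * ?q * g" for g
        by (simp add: algebra_simps)
      then show ?thesis unfolding True c0 of_nat_mult of_nat_add of_nat_power q1 if_P[OF refl] by (simp only:)
    next
      case False
      show ?thesis unfolding if_not_P[OF False] of_nat_mult of_nat_add of_nat_power q1 by (simp only: of_nat_0 add_0_right)
    qed
  qed
  then have "real (lin_count b (2 * Suc r) c) = ?R ^ 2 * (?q - 1) * (\<Sum>d\<in>carrier k. ?G (c \<ominus>\<^bsub>k\<^esub> d)) + ?R ^ 2 * ?q * ?G c"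
    unfolding sum.distrib sum_distrib_left[symmetric] sum.delta[OF k.finite_carrier] by (simp only: k.zero_closed if_True)
  also have "(\<Sum>d\<in>carrier k. ?G (c \<ominus>\<^bsub>k\<^esub> d)) = real (\<Sum>d\<in>carrier k. lin_count b (2 * r) d)"
    unfolding of_nat_sum by (rule k.sum_shift[OF Suc.prems(4), of ?G])
  also have "\<dots> = (?q * ?R) ^ (2 * r)" by (subst sum_lin_count) (use Suc.prems in auto)
  finally have fin: "real (lin_count b (2 * Suc r) c) = ?R ^ 2 * (?q - 1) * (?q * ?R) ^ (2 * r) + ?R ^ 2 * ?q * ?G c" .
  have alg: "R ^ 2 * (q - 1) * (q * R) ^ (2 * r) + R ^ 2 * q * (R ^ (2 * r) * (q ^ (2 * r) / q - q ^ r / q + e)) =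
    R ^ (2 * Suc r) * (q ^ (2 * Suc r) / q - q ^ Suc r / q + q * e)" if "q > 0" for q R e :: real
    using that by (simp add: field_simps power_mult_distrib power2_eq_square)
  have e: "?q * (if c = \<zero>\<^bsub>k\<^esub> then ?q ^ r else 0) = (if c = \<zero>\<^bsub>k\<^esub> then ?q ^ Suc r else 0)"
    by (simp only: if_distrib[of "\<lambda>x. ?q * x"] power_Suc mult_zero_right)
  show ?case unfolding fin IH[OF Suc.prems(4)] alg[OF q_pos] e ..
qed

lemma card_isotropic_kind_I:
  assumes m: "m = 2 * r" and r: "r > 0" and kind: "alternating_diagonal B M m h \<one>"
  shows "real (card {w \<in> carrier M. \<phi> (h w w) = \<zero>\<^bsub>k\<^esub>}) =
    real (card nonunits) ^ m * (real k.q ^ m / real k.q - real k.q ^ r / real k.q + real k.q ^ r)"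
proof -
  obtain b where b: "module_basis B M m b" and hb: "\<And>i j. i < m \<Longrightarrow> j < m \<Longrightarrow> h (b i) (b j) =
     (if i \<noteq> j then \<zero> else if i = m - 1 then \<ominus> \<one> else if even i then \<one> else \<ominus> \<one>)"
    using kind unfolding alternating_diagonal_def by blast
  have "odd (m - 1)" using m r by simp
  then have "real (lin_count b (2 * r) \<zero>\<^bsub>k\<^esub>) = real (card nonunits) ^ (2 * r) *
    (real k.q ^ (2 * r) / real k.q - real k.q ^ r / real k.q + (if \<zero>\<^bsub>k\<^esub> = \<zero>\<^bsub>k\<^esub> then real k.q ^ r else 0))"
    using b hb m by (intro lin_count_hyperbolic) (auto simp: module_basis_def)
  then show ?thesis using lin_count_basis[OF b] m by simp
qed

text \<open>
  All but the last plane are hyperbolic. On the last one, with diagonal \<open>1, -\<epsilon>\<close>, the value \<open>0\<close> is taken over the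
  residue field by the zero vector only. Its remaining nonzero vectors have nonzero values, and these
  are complemented to \<open>0\<close> by nonzero values of the hyperbolic part, which all occur equally often.
\<close>

lemma card_isotropic_kind_II:
  assumes m: "m = 2 * r" and r: "r > 0" and kind: "alternating_diagonal B M m h \<epsilon>"
    and \<epsilon>: "\<epsilon> \<in> carrier B" "\<not> (\<exists>x\<in>carrier k. \<phi> \<epsilon> = x \<otimes>\<^bsub>k\<^esub> x)"
  shows "real (card {w \<in> carrier M. \<phi> (h w w) = \<zero>\<^bsub>k\<^esub>}) =
    real (card nonunits) ^ m * (real k.q ^ m / real k.q - real k.q ^ r + real k.q ^ r / real k.q)"
proof -
  let ?q = "real k.q" and ?R = "real (card nonunits)"
  obtain r' where r': "r = Suc r'" using r by (cases r) auto
  obtain b where b: "module_basis B M m b" and hb: "\<And>i j. i < m \<Longrightarrow> j < m \<Longrightarrow> h (b i) (b j) =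
     (if i \<noteq> j then \<zero> else if i = m - 1 then \<ominus> \<epsilon> else if even i then \<one> else \<ominus> \<one>)"
    using kind unfolding alternating_diagonal_def by blast
  have bc: "\<And>i. i < m \<Longrightarrow> b i \<in> carrier M" using b by (auto simp: module_basis_def)
  let ?n = "2 * r'"
  have mn: "m = Suc (Suc ?n)" using m r' by simp
  let ?G = "\<lambda>c. real (lin_count b ?n c)"
  \<comment> \<open>The hyperbolic part takes a nonzero value \<open>\<alpha>\<close> times and the value \<open>0\<close> precisely \<open>\<alpha> + \<beta>\<close> times.\<close>
  define \<alpha> where "\<alpha> = ?R ^ ?n * (?q ^ ?n / ?q - ?q ^ r' / ?q)"
  define \<beta> where "\<beta> = ?R ^ ?n * ?q ^ r'"
  have G: "?G c = \<alpha> + (if c = \<zero>\<^bsub>k\<^esub> then \<beta> else 0)" if c: "c \<in> carrier k" for c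
  proof -
    have "?G c = ?R ^ ?n * (?q ^ ?n / ?q - ?q ^ r' / ?q + (if c = \<zero>\<^bsub>k\<^esub> then ?q ^ r' else 0))"
      by (rule lin_count_hyperbolic) (use mn bc hb c in auto)
    then show ?thesis by (simp add: \<alpha>_def \<beta>_def algebra_simps)
  qed
  let ?P = "\<lambda>d. {p \<in> carrier k \<times> carrier k. \<one>\<^bsub>k\<^esub> \<otimes>\<^bsub>k\<^esub> (fst p \<otimes>\<^bsub>k\<^esub> fst p) \<oplus>\<^bsub>k\<^esub> \<ominus>\<^bsub>k\<^esub> \<phi> \<epsilon> \<otimes>\<^bsub>k\<^esub> (snd p \<otimes>\<^bsub>k\<^esub> snd p) = d}"
  have "?P \<zero>\<^bsub>k\<^esub> = {p \<in> carrier k \<times> carrier k. fst p \<otimes>\<^bsub>k\<^esub> fst p \<oplus>\<^bsub>k\<^esub> \<ominus>\<^bsub>k\<^esub> \<phi> \<epsilon> \<otimes>\<^bsub>k\<^esub> (snd p \<otimes>\<^bsub>k\<^esub> snd p) = \<zero>\<^bsub>k\<^esub>}"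
    by auto
  then have P0: "card (?P \<zero>\<^bsub>k\<^esub>) = 1" using k.card_anisotropic[OF _ \<epsilon>(2)] \<epsilon>(1) by simp
  define p where "p = (\<lambda>d. real (card (?P d)))"
  have p0: "p \<zero>\<^bsub>k\<^esub> = 1" unfolding p_def P0 by simp
  have "(\<Sum>d\<in>carrier k. card (?P d)) = card (carrier k \<times> carrier k)"
    by (rule sum_card_fibres) (use k.finite_carrier \<epsilon>(1) in auto)
  then have sump: "(\<Sum>d\<in>carrier k. p d) = ?q * ?q"
    unfolding p_def by (simp add: card_cartesian_product flip: of_nat_sum)
  have "lin_count b m \<zero>\<^bsub>k\<^esub> = (\<Sum>d\<in>carrier k. card nonunits ^ 2 * card (?P d) * lin_count b ?n (\<zero>\<^bsub>k\<^esub> \<ominus>\<^bsub>k\<^esub> d))"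
    unfolding mn by (rule lin_count_two_more) (use mn bc hb \<epsilon>(1) in auto)
  then have "real (lin_count b m \<zero>\<^bsub>k\<^esub>) = (\<Sum>d\<in>carrier k. ?R ^ 2 * p d * ?G (\<zero>\<^bsub>k\<^esub> \<ominus>\<^bsub>k\<^esub> d))"
    unfolding p_def by (simp only: of_nat_sum of_nat_mult of_nat_power)
  also have "\<dots> = (\<Sum>d\<in>carrier k. ?R ^ 2 * \<alpha> * p d + (if d = \<zero>\<^bsub>k\<^esub> then ?R ^ 2 * \<beta> else 0))"
  proof (rule sum.cong[OF refl])
    fix d assume d: "d \<in> carrier k"
    have "\<zero>\<^bsub>k\<^esub> \<ominus>\<^bsub>k\<^esub> d = \<zero>\<^bsub>k\<^esub> \<longleftrightarrow> d = \<zero>\<^bsub>k\<^esub>" using k.r_right_minus_eq[of "\<zero>\<^bsub>k\<^esub>" d] d by auto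
    then have "?G (\<zero>\<^bsub>k\<^esub> \<ominus>\<^bsub>k\<^esub> d) = \<alpha> + (if d = \<zero>\<^bsub>k\<^esub> then \<beta> else 0)" using G[of "\<zero>\<^bsub>k\<^esub> \<ominus>\<^bsub>k\<^esub> d"] d by simp
    then show "?R ^ 2 * p d * ?G (\<zero>\<^bsub>k\<^esub> \<ominus>\<^bsub>k\<^esub> d) = ?R ^ 2 * \<alpha> * p d + (if d = \<zero>\<^bsub>k\<^esub> then ?R ^ 2 * \<beta> else 0)"
      using p0 by (cases "d = \<zero>\<^bsub>k\<^esub>") (simp_all add: algebra_simps)
  qed
  also have "\<dots> = ?R ^ 2 * \<alpha> * (\<Sum>d\<in>carrier k. p d) + ?R ^ 2 * \<beta>"
    by (simp add: sum.distrib sum_distrib_left k.finite_carrier)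
  also have "\<dots> = ?R ^ 2 * \<alpha> * (?q * ?q) + ?R ^ 2 * \<beta>" unfolding sump by simp
  finally have "real (lin_count b m \<zero>\<^bsub>k\<^esub>) = ?R ^ 2 * \<alpha> * (?q * ?q) + ?R ^ 2 * \<beta>" .
  moreover have "\<dots> = ?R ^ m * (?q ^ m / ?q - ?q ^ r + ?q ^ r / ?q)"
    unfolding \<alpha>_def \<beta>_def mn r' using q_pos by (simp add: field_simps power2_eq_square)
  ultimately show ?thesis unfolding lin_count_basis[OF b] by simp
qed

end

section \<open>Uniformized rings\<close>

text \<open>
  The element \<open>\<beta>\<close> generates the maximal ideal and is negated by the involution, as \<open>\<rho>\<close> is in the ring of
  integers. Both properties pass to quotients. Nilpotency of \<open>\<beta>\<close> is not built in, so that the ring of integers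
  itself is an instance.
\<close>

locale uniformized = local_involution B k \<phi> \<tau>
  for B :: "('a, 'c) ring_scheme" (structure) and k :: "('k, 'e) ring_scheme"
    and \<phi> :: "'a \<Rightarrow> 'k" and \<tau> :: "'a \<Rightarrow> 'a" +
  fixes \<beta> :: 'a
  assumes \<beta>_closed [simp, intro]: "\<beta> \<in> carrier B"
    and nonunits_eq: "nonunits = {\<beta> \<otimes> y | y. y \<in> carrier B}"
    and \<tau>_\<beta>: "\<tau> \<beta> = \<ominus> \<beta>"
begin

definition level :: "nat \<Rightarrow> 'a set" where
  "level n = {\<beta> [^] n \<otimes> y | y. y \<in> carrier B}"

lemma \<phi>_\<beta>: "\<phi> \<beta> = \<zero>\<^bsub>k\<^esub>"
proof -
  have "\<beta> \<otimes> \<one> \<in> nonunits" unfolding nonunits_eq by blast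
  then show ?thesis by (simp add: nonunits_def)
qed

lemma nonunitE:
  assumes "x \<in> carrier B" "\<phi> x = \<zero>\<^bsub>k\<^esub>" obtains y where "y \<in> carrier B" "x = \<beta> \<otimes> y"
proof -
  have "x \<in> nonunits" using assms by (simp add: nonunits_def)
  then show thesis using that unfolding nonunits_eq by blast
qed

lemma level_PIdl: "level n = PIdl (\<beta> [^] n)"
  unfolding level_def cgenideal_def
  by (rule Collect_cong) (use R.m_comm[of "\<beta> [^] n"] R.nat_pow_closed[OF \<beta>_closed] in metis)

lemma level_ideal: "ideal (level n) B"
  unfolding level_PIdl by (rule R.cgenideal_ideal) simp

lemma level_0: "level 0 = carrier B"
proof -
  have "level 0 = {y. y \<in> carrier B}" unfolding level_def
  proof (rule Collect_cong)
    fix x show "(\<exists>y. x = \<beta> [^] (0::nat) \<otimes> y \<and> y \<in> carrier B) = (x \<in> carrier B)"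
    proof
      assume "x \<in> carrier B" then show "\<exists>y. x = \<beta> [^] (0::nat) \<otimes> y \<and> y \<in> carrier B"
        by (intro exI[of _ x]) simp
    qed auto
  qed
  then show ?thesis by simp
qed

lemma level_1: "level 1 = nonunits"
  unfolding level_def nonunits_eq by simp

lemma level_Suc_subset: "level (Suc n) \<subseteq> level n"
proof
  fix x assume "x \<in> level (Suc n)"
  then obtain y where y: "y \<in> carrier B" "x = \<beta> [^] Suc n \<otimes> y" by (auto simp: level_def)
  have "x = \<beta> [^] n \<otimes> (\<beta> \<otimes> y)" using y by (simp add: R.m_assoc)
  then show "x \<in> level n" using y unfolding level_def by blast
qed

lemma level_nonunits: "n > 0 \<Longrightarrow> level n \<subseteq> nonunits"
proof (induction n)
  case (Suc n)
  then show ?case using level_Suc_subset[of n] level_1 by (cases n) auto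
qed simp

lemma level_\<tau>:
  assumes "x \<in> level n" shows "\<tau> x \<in> level n"
proof -
  obtain y where y: "y \<in> carrier B" "x = \<beta> [^] n \<otimes> y" using assms by (auto simp: level_def)
  have "\<tau> (\<beta> [^] n) \<in> level n"
  proof (induction n)
    case 0 then show ?case by (simp add: level_0)
  next
    case (Suc n)
    then obtain z where z: "z \<in> carrier B" "\<tau> (\<beta> [^] n) = \<beta> [^] n \<otimes> z" by (auto simp: level_def)
    have "\<tau> (\<beta> [^] Suc n) = \<beta> [^] n \<otimes> z \<otimes> (\<ominus> \<beta>)" using z by (simp add: \<tau>_\<beta>)
    also have "\<dots> = \<beta> [^] Suc n \<otimes> (\<ominus> z)"
      using z by (simp add: R.r_minus R.l_minus R.m_ac)
    finally show ?case using z unfolding level_def by blast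
  qed
  then have "\<tau> (\<beta> [^] n) \<otimes> \<tau> y \<in> level n" using y ideal.I_r_closed[OF level_ideal] by simp
  then show ?thesis using y by simp
qed

lemma ideal_power_nonunits: "ideal_power B nonunits n = level n"
proof (induction n)
  case 0
  show ?case by (simp add: ideal_power_def ideals_set_def level_0)
next
  case (Suc n)
  have "ideal_power B nonunits (Suc n) = ideal_prod B (level n) nonunits"
    using Suc by (simp add: ideal_power_def ideals_set_def)
  also have "\<dots> = level (Suc n)"
  proof (intro equalityI subsetI)
    fix x assume "x \<in> ideal_prod B (level n) nonunits"
    then show "x \<in> level (Suc n)"
    proof induction
      case (prod i j)
      then obtain y z where "y \<in> carrier B" "i = \<beta> [^] n \<otimes> y" "z \<in> carrier B" "j = \<beta> \<otimes> z"
        unfolding nonunits_eq level_def by blast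
      then have "i \<otimes> j = \<beta> [^] Suc n \<otimes> (y \<otimes> z) \<and> y \<otimes> z \<in> carrier B" by (simp add: R.m_ac)
      then show ?case unfolding level_def by blast
    next
      case (sum x y)
      then show ?case using additive_subgroup.a_closed[OF ideal.axioms(1)[OF level_ideal]] by blast
    qed
  next
    fix x assume "x \<in> level (Suc n)"
    then obtain y where y: "y \<in> carrier B" "x = \<beta> [^] Suc n \<otimes> y" by (auto simp: level_def)
    have "x = (\<beta> [^] n \<otimes> \<one>) \<otimes> (\<beta> \<otimes> y)" using y by (simp add: R.m_assoc)
    moreover have "\<beta> [^] n \<otimes> \<one> \<in> level n" unfolding level_def by blast
    moreover have "\<beta> \<otimes> y \<in> nonunits" unfolding nonunits_eq using y by blast
    ultimately show "x \<in> ideal_prod B (level n) nonunits" by (simp only: ideal_prod.prod)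
  qed
  finally show ?case .
qed

text \<open>
  A proper ideal contains no unit, so the nonunits, which form an ideal, contain every other.
\<close>

lemma maximalideal_eq_nonunits:
  assumes J: "maximalideal J B" shows "J = nonunits"
proof -
  interpret J: maximalideal J B by (rule J)
  have sub: "J \<subseteq> nonunits"
  proof
    fix x assume x: "x \<in> J"
    have xc: "x \<in> carrier B" using x J.Icarr by blast
    have "\<phi> x = \<zero>\<^bsub>k\<^esub>"
    proof (rule ccontr)
      assume "\<phi> x \<noteq> \<zero>\<^bsub>k\<^esub>"
      then have U: "x \<in> Units B" using xc \<phi>_unit by blast
      have "inv x \<otimes> x \<in> J" by (rule J.I_l_closed[OF x R.Units_inv_closed[OF U]])
      then have "\<one> \<in> J" by (simp only: R.Units_l_inv[OF U])
      then show False using J.one_imp_carrier J.I_notcarr by simp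
    qed
    then show "x \<in> nonunits" using xc by (simp add: nonunits_def)
  qed
  have "ideal nonunits B" using level_ideal[of 1] level_1 by simp
  moreover have "nonunits \<subseteq> carrier B" by (auto simp: nonunits_def)
  moreover have "nonunits \<noteq> carrier B"
  proof
    assume "nonunits = carrier B"
    then have "\<one> \<in> nonunits" by simp
    then show False by (simp add: nonunits_def)
  qed
  ultimately show ?thesis using J.I_maximal[OF _ sub] by blast
qed

text \<open>
  Here \<open>\<beta>\<^sup>i = \<beta>\<^sup>i c\<close> with a nonunit \<open>c\<close>, and \<open>1 - c\<close> is a unit that annihilates \<open>\<beta>\<^sup>i\<close>.
\<close>

lemma pow_eq_zero:
  assumes ij: "i < j" and y: "y \<in> carrier B" and eq: "\<beta> [^] i = \<beta> [^] j \<otimes> y"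
  shows "\<beta> [^] (i::nat) = \<zero>"
proof -
  obtain r where r: "j = i + Suc r" using ij less_iff_Suc_add[of i j] by auto
  define b where "b = \<beta> [^] i"
  define c where "c = \<beta> [^] Suc r \<otimes> y"
  have bc: "b \<in> carrier B" "c \<in> carrier B" "\<phi> c = \<zero>\<^bsub>k\<^esub>" using y by (simp_all add: b_def c_def \<phi>_\<beta>)
  have "\<beta> [^] j = b \<otimes> \<beta> [^] Suc r" unfolding r b_def by (rule R.nat_pow_mult[symmetric]) simp
  then have "b = b \<otimes> \<beta> [^] Suc r \<otimes> y" using eq unfolding b_def by (simp only:)
  also have "\<dots> = b \<otimes> c" unfolding c_def using bc y by (intro R.m_assoc) auto
  finally have bbc: "b = b \<otimes> c" .
  have "b \<otimes> (\<one> \<ominus> c) = b \<ominus> b \<otimes> c" using bc by (simp add: R.minus_eq R.r_distr R.r_minus)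
  also have "\<dots> = \<zero>" unfolding bbc[symmetric] using bc by (simp add: R.minus_eq R.r_neg)
  finally have z: "b \<otimes> (\<one> \<ominus> c) = \<zero>" .
  have U: "\<one> \<ominus> c \<in> Units B" by (rule \<phi>_unit) (use bc in \<open>simp_all add: R.minus_eq\<close>)
  have "b = b \<otimes> ((\<one> \<ominus> c) \<otimes> inv (\<one> \<ominus> c))" using bc U by simp
  also have "\<dots> = (b \<otimes> (\<one> \<ominus> c)) \<otimes> inv (\<one> \<ominus> c)"
    using bc U by (intro R.m_assoc[symmetric]) auto
  also have "\<dots> = \<zero>" unfolding z using U by simp
  finally show ?thesis by (simp only: b_def)
qed

definition fixed_lift :: "'k \<Rightarrow> 'a" where
  "fixed_lift c = (SOME x. x \<in> fixed \<and> \<phi> x = c)"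

lemma fixed_lift:
  assumes "c \<in> carrier k" shows "fixed_lift c \<in> fixed" "\<phi> (fixed_lift c) = c" "fixed_lift c \<in> carrier B"
proof -
  have "\<exists>x. x \<in> fixed \<and> \<phi> x = c" using \<phi>_fixed_surj[OF assms] by blast
  from someI_ex[OF this] show "fixed_lift c \<in> fixed" "\<phi> (fixed_lift c) = c" by (simp_all add: fixed_lift_def)
  then show "fixed_lift c \<in> carrier B" using fixed_closed(1) by blast
qed

context
  fixes l :: nat
  assumes l: "l > 0" and nil: "\<beta> [^] l = \<zero>" and not_nil: "\<beta> [^] (l - 1) \<noteq> \<zero>"
begin

lemma pow_nonzero: "j < l \<Longrightarrow> \<beta> [^] j \<noteq> \<zero>"
proof
  assume j: "j < l" and z: "\<beta> [^] j = \<zero>"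
  have "\<beta> [^] (l - 1) = \<beta> [^] j \<otimes> \<beta> [^] (l - 1 - j)"
    using j by (subst R.nat_pow_mult) auto
  then show False using z not_nil by simp
qed

lemma annihilator: "j < l \<Longrightarrow> y \<in> carrier B \<Longrightarrow> \<beta> [^] j \<otimes> y = \<zero> \<Longrightarrow> \<phi> y = \<zero>\<^bsub>k\<^esub>"
proof (rule ccontr)
  assume j: "j < l" and y: "y \<in> carrier B" and z: "\<beta> [^] j \<otimes> y = \<zero>" and n: "\<phi> y \<noteq> \<zero>\<^bsub>k\<^esub>"
  have U: "y \<in> Units B" by (rule \<phi>_unit[OF y n])
  have "\<beta> [^] j = \<beta> [^] j \<otimes> (y \<otimes> inv y)" using U by simp
  also have "\<dots> = \<beta> [^] j \<otimes> y \<otimes> inv y" using U y by (intro R.m_assoc[symmetric]) auto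
  also have "\<dots> = \<zero>" unfolding z using U by simp
  finally show False using pow_nonzero[OF j] by simp
qed

text \<open>
  An element \<open>\<beta>\<^sup>j y\<close> is determined by the residue of \<open>y\<close> and an element of the next level. Fixed
  representatives are used for the residues in order that the decomposition is compatible with the involution.
\<close>

lemma level_step:
  assumes j: "j < l"
  shows "bij_betw (\<lambda>p. \<beta> [^] j \<otimes> fixed_lift (fst p) \<oplus> snd p) (carrier k \<times> level (Suc j)) (level j)"
proof (rule bij_betwI')
  have lc: "level n \<subseteq> carrier B" for n using ideal.Icarr[OF level_ideal] by blast
  fix p assume p: "p \<in> carrier k \<times> level (Suc j)"
  then obtain y where y: "y \<in> carrier B" "snd p = \<beta> [^] Suc j \<otimes> y" by (auto simp: level_def)
  have s: "fixed_lift (fst p) \<in> carrier B" using p fixed_lift by auto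
  have sp: "\<beta> [^] j \<otimes> fixed_lift (fst p) \<oplus> snd p = \<beta> [^] j \<otimes> (fixed_lift (fst p) \<oplus> \<beta> \<otimes> y)"
    using y s by (simp add: R.r_distr R.m_assoc)
  then show "\<beta> [^] j \<otimes> fixed_lift (fst p) \<oplus> snd p \<in> level j" using y s unfolding level_def by blast
  fix p' assume p': "p' \<in> carrier k \<times> level (Suc j)"
  then obtain y' where y': "y' \<in> carrier B" "snd p' = \<beta> [^] Suc j \<otimes> y'" by (auto simp: level_def)
  have s': "fixed_lift (fst p') \<in> carrier B" using p' fixed_lift by auto
  have sp': "\<beta> [^] j \<otimes> fixed_lift (fst p') \<oplus> snd p' = \<beta> [^] j \<otimes> (fixed_lift (fst p') \<oplus> \<beta> \<otimes> y')"
    using y' s' by (simp add: R.r_distr R.m_assoc)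
  have sn': "snd p' \<in> carrier B" using p' lc[of "Suc j"] by auto
  show "\<beta> [^] j \<otimes> fixed_lift (fst p) \<oplus> snd p = \<beta> [^] j \<otimes> fixed_lift (fst p') \<oplus> snd p' \<longleftrightarrow> p = p'"
  proof
    assume eq: "\<beta> [^] j \<otimes> fixed_lift (fst p) \<oplus> snd p = \<beta> [^] j \<otimes> fixed_lift (fst p') \<oplus> snd p'"
    have "\<beta> [^] j \<otimes> ((fixed_lift (fst p) \<oplus> \<beta> \<otimes> y) \<ominus> (fixed_lift (fst p') \<oplus> \<beta> \<otimes> y')) =
      \<beta> [^] j \<otimes> (fixed_lift (fst p) \<oplus> \<beta> \<otimes> y) \<ominus> \<beta> [^] j \<otimes> (fixed_lift (fst p') \<oplus> \<beta> \<otimes> y')"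
      using s s' y y' by (simp add: R.minus_eq R.r_distr R.r_minus)
    also have "\<dots> = \<zero>" unfolding sp[symmetric] sp'[symmetric] eq
      using sn' s' by (simp add: R.r_right_minus_eq)
    finally have "\<phi> ((fixed_lift (fst p) \<oplus> \<beta> \<otimes> y) \<ominus> (fixed_lift (fst p') \<oplus> \<beta> \<otimes> y')) = \<zero>\<^bsub>k\<^esub>"
      using annihilator[OF j] s s' y y' by simp
    moreover have "\<phi> (fixed_lift (fst p)) = fst p" "\<phi> (fixed_lift (fst p')) = fst p'" using p p' fixed_lift by auto
    ultimately have "fst p \<ominus>\<^bsub>k\<^esub> fst p' = \<zero>\<^bsub>k\<^esub>"
      using p p' s s' y y' by (simp add: R.minus_eq k.minus_eq \<phi>_\<beta> mem_Times_iff)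
    then have f: "fst p = fst p'" using p p' by (simp add: k.r_right_minus_eq mem_Times_iff)
    have "snd p \<in> carrier B" "snd p' \<in> carrier B" using p p' lc[of "Suc j"] by auto
    then have "snd p = snd p'" using eq s' R.add.l_cancel[of "\<beta> [^] j \<otimes> fixed_lift (fst p')" "snd p" "snd p'"]
      unfolding f by simp
    then show "p = p'" using f by (simp add: prod_eq_iff)
  qed simp
next
  fix x assume "x \<in> level j"
  then obtain y where y: "y \<in> carrier B" "x = \<beta> [^] j \<otimes> y" by (auto simp: level_def)
  let ?c = "\<phi> y"
  have s: "fixed_lift ?c \<in> carrier B" "\<phi> (fixed_lift ?c) = ?c" using y fixed_lift by auto
  have "\<phi> (y \<ominus> fixed_lift ?c) = \<zero>\<^bsub>k\<^esub>" using y s by (simp add: R.minus_eq k.r_neg)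
  then obtain z where z: "z \<in> carrier B" "y \<ominus> fixed_lift ?c = \<beta> \<otimes> z" using nonunitE[of "y \<ominus> fixed_lift ?c"] y s by auto
  have "y = fixed_lift ?c \<oplus> (y \<ominus> fixed_lift ?c)" using y s by (simp add: R.minus_eq R.a_lcomm R.r_neg)
  then have e: "y = fixed_lift ?c \<oplus> \<beta> \<otimes> z" unfolding z(2) .
  have "x = \<beta> [^] j \<otimes> (fixed_lift ?c \<oplus> \<beta> \<otimes> z)" 
    by (rule trans[OF y(2)]) (rule arg_cong[OF e, of "\<lambda>v. \<beta> [^] j \<otimes> v"])
  also have "\<dots> = \<beta> [^] j \<otimes> fixed_lift ?c \<oplus> \<beta> [^] Suc j \<otimes> z" using z(1) s(1) by (simp add: R.r_distr R.m_assoc)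
  finally have "x = \<beta> [^] j \<otimes> fixed_lift ?c \<oplus> \<beta> [^] Suc j \<otimes> z" .
  moreover have "\<beta> [^] Suc j \<otimes> z \<in> level (Suc j)" using z unfolding level_def by blast
  ultimately show "\<exists>p\<in>carrier k \<times> level (Suc j). x = \<beta> [^] j \<otimes> fixed_lift (fst p) \<oplus> snd p"
    using y by (intro bexI[of _ "(?c, \<beta> [^] Suc j \<otimes> z)"]) simp_all
qed

lemma level_top: "level l = {\<zero>}"
  unfolding level_def nil by (auto intro!: exI[of _ \<zero>])

lemma card_level: "i \<le> l \<Longrightarrow> finite (level (l - i)) \<and> card (level (l - i)) = k.q ^ i"
proof (induction i)
  case 0 then show ?case by (simp add: level_top)
next
  case (Suc i)
  then have IH: "finite (level (l - i))" "card (level (l - i)) = k.q ^ i" by auto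
  have S: "l - i = Suc (l - Suc i)" "l - Suc i < l" using Suc.prems by auto
  have b: "bij_betw (\<lambda>p. \<beta> [^] (l - Suc i) \<otimes> fixed_lift (fst p) \<oplus> snd p) (carrier k \<times> level (l - i)) (level (l - Suc i))"
    using level_step[OF S(2)] unfolding S(1) by simp
  show ?case using bij_betw_finite[OF b] bij_betw_same_card[OF b] IH k.finite_carrier
    by (simp add: card_cartesian_product)
qed

lemma finite_carrier_B: "finite (carrier B)"
  using card_level[of l] level_0 by simp

lemma card_nonunits: "card nonunits = k.q ^ (l - 1)"
  using card_level[of "l - 1"] l level_1 by simp

lemma \<tau>_pow_even: "even j \<Longrightarrow> \<tau> (\<beta> [^] (j::nat)) = \<beta> [^] j"
proof -
  assume "even j"
  then obtain i where i: "j = 2 * i" by blast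
  have "\<tau> (\<beta> [^] (2 * i)) = \<beta> [^] (2 * i)"
  proof (induction i)
    case (Suc i)
    have S: "2 * Suc i = Suc (Suc (2 * i))" by simp
    show ?case unfolding S using Suc by (simp add: \<tau>_\<beta> R.l_minus R.r_minus)
  qed simp
  then show ?thesis using i by simp
qed

text \<open>
  As \<open>\<beta>\<^sup>j\<close> is fixed, the decomposition of \<open>level_step\<close> restricts to the fixed elements.
\<close>

lemma fixed_level_even:
  assumes j: "j < l" "even j"
  shows "card (fixed \<inter> level j) = k.q * card (fixed \<inter> level (Suc j))"
proof -
  let ?f = "\<lambda>p. \<beta> [^] j \<otimes> fixed_lift (fst p) \<oplus> snd p"
  have lc: "level n \<subseteq> carrier B" for n using ideal.Icarr[OF level_ideal] by blast
  have bj: "\<beta> [^] j \<in> fixed" using \<tau>_pow_even[OF j(2)] by (simp add: fixed_def)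
  have "bij_betw ?f {p \<in> carrier k \<times> level (Suc j). snd p \<in> fixed} {x \<in> level j. x \<in> fixed}"
  proof (rule bij_betw_Collect[OF level_step[OF j(1)]])
    fix p assume p: "p \<in> carrier k \<times> level (Suc j)"
    have s: "\<beta> [^] j \<otimes> fixed_lift (fst p) \<in> fixed" using bj fixed_lift p by (intro fixed_closed(5)) auto
    have pc: "snd p \<in> carrier B" using p lc[of "Suc j"] by auto
    show "?f p \<in> fixed \<longleftrightarrow> snd p \<in> fixed"
    proof
      assume f: "?f p \<in> fixed"
      have "snd p = ?f p \<ominus> \<beta> [^] j \<otimes> fixed_lift (fst p)"
        using pc fixed_closed(1)[OF s] by (simp add: R.minus_eq R.a_ac R.r_neg R.r_neg1 R.r_neg2)
      then show "snd p \<in> fixed" using fixed_closed(7)[OF f s] by simp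
    next
      assume "snd p \<in> fixed" then show "?f p \<in> fixed" by (rule fixed_closed(4)[OF s])
    qed
  qed
  from bij_betw_same_card[OF this]
  have "card {p \<in> carrier k \<times> level (Suc j). snd p \<in> fixed} = card {x \<in> level j. x \<in> fixed}" .
  moreover have "{p \<in> carrier k \<times> level (Suc j). snd p \<in> fixed} = carrier k \<times> (fixed \<inter> level (Suc j))" by auto
  moreover have "{x \<in> level j. x \<in> fixed} = fixed \<inter> level j" by auto
  ultimately have "card (carrier k \<times> (fixed \<inter> level (Suc j))) = card (fixed \<inter> level j)" by (simp only:)
  then show ?thesis by (simp add: card_cartesian_product)
qed

text \<open>
  Now \<open>\<beta>\<^sup>j\<close> is negated, so a fixed element \<open>\<beta>\<^sup>j y\<close> satisfies \<open>\<beta>\<^sup>j (y + \<tau> y) = 0\<close>; hence the residue of \<open>y\<close>,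
  being half that of its trace, is zero.
\<close>

lemma fixed_level_odd:
  assumes j: "j < l" "odd j"
  shows "fixed \<inter> level j = fixed \<inter> level (Suc j)"
proof (intro equalityI subsetI)
  fix x assume x: "x \<in> fixed \<inter> level j"
  then obtain y where y: "y \<in> carrier B" "x = \<beta> [^] j \<otimes> y" by (auto simp: level_def)
  obtain i where i: "j = Suc (2 * i)" using j(2) oddE by fastforce
  have "\<tau> (\<beta> [^] j) = \<ominus> (\<beta> [^] j)" unfolding i using \<tau>_pow_even[of "2 * i"] by (simp add: \<tau>_\<beta> R.r_minus)
  then have tx: "\<tau> x = \<ominus> (\<beta> [^] j \<otimes> \<tau> y)" using y by (simp add: R.l_minus)
  moreover have "\<tau> x = x" using x by (simp add: fixed_def)
  ultimately have "\<beta> [^] j \<otimes> y = \<ominus> (\<beta> [^] j \<otimes> \<tau> y)" using y(2) by simp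
  then have "\<beta> [^] j \<otimes> (y \<oplus> \<tau> y) = \<zero>" using y by (simp add: R.r_distr R.l_neg)
  then have "\<phi> (y \<oplus> \<tau> y) = \<zero>\<^bsub>k\<^esub>" using y by (intro annihilator[OF j(1)]) auto
  then have "(\<one>\<^bsub>k\<^esub> \<oplus>\<^bsub>k\<^esub> \<one>\<^bsub>k\<^esub>) \<otimes>\<^bsub>k\<^esub> \<phi> y = \<zero>\<^bsub>k\<^esub>" using y by (simp add: \<phi>_\<tau> k.l_distr)
  then have "\<phi> y = \<zero>\<^bsub>k\<^esub>" using k.two_nonzero y by (simp add: k.integral_iff)
  then obtain z where z: "z \<in> carrier B" "y = \<beta> \<otimes> z" using nonunitE[of y] y by auto
  then have "x = \<beta> [^] Suc j \<otimes> z" using y(2) by (simp add: R.m_assoc)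
  then show "x \<in> fixed \<inter> level (Suc j)" using x z unfolding level_def by blast
qed (use level_Suc_subset in auto)

text \<open>
  A factor \<open>q\<close> arises from every even \<open>j\<close> with \<open>1 \<le> j < l\<close>, and there are \<open>f - 1\<close> of these. The induction goes
  down from the top in steps of two levels.
\<close>

lemma card_fixed_nonunits:
  assumes f: "f > 0" "l = 2 * f - 1 \<or> l = 2 * f"
  shows "card fixed_nonunits = k.q ^ (f - 1)"
proof -
  have "i \<le> f - 1 \<Longrightarrow> card (fixed \<inter> level (2 * (f - 1 - i) + 1)) = k.q ^ i" for i
  proof (induction i)
    case 0
    have "fixed \<inter> level (2 * (f - 1) + 1) = {\<zero>}"
    proof (cases "l = 2 * f - 1")
      case True
      then have "2 * (f - 1) + 1 = l" using f by simp
      then show ?thesis using level_top fixed_closed(2) by auto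
    next
      case False
      then have eq: "2 * (f - 1) + 1 < l" "odd (2 * (f - 1) + 1)" "Suc (2 * (f - 1) + 1) = l" using f by auto
      show ?thesis unfolding fixed_level_odd[OF eq(1,2)] eq(3) using level_top fixed_closed(2) by auto
    qed
    then show ?case by simp
  next
    case (Suc i)
    let ?j = "2 * (f - 1 - Suc i) + 1"
    have j5: "Suc (Suc ?j) = 2 * (f - 1 - i) + 1" using Suc.prems by simp
    have "2 * f - 1 \<le> l" using f(2) by auto
    then have j: "?j < l" "odd ?j" "Suc ?j < l" "even (Suc ?j)" using Suc.prems by simp_all
    have "card (fixed \<inter> level ?j) = card (fixed \<inter> level (Suc ?j))" by (simp only: fixed_level_odd[OF j(1,2)])
    also have "\<dots> = k.q * card (fixed \<inter> level (Suc (Suc ?j)))" by (rule fixed_level_even[OF j(3,4)])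
    also have "\<dots> = k.q ^ Suc i" unfolding j5 using Suc by simp
    finally show ?case .
  qed
  from this[of "f - 1"] show ?thesis by (simp add: fixed_nonunits_def level_1[unfolded One_nat_def])
qed

end

end

section \<open>Quotients of uniformized rings\<close>

lemma (in abelian_subgroup) a_rcos_eq_iff:
  assumes x: "x \<in> carrier G" and y: "y \<in> carrier G"
  shows "H +> x = H +> y \<longleftrightarrow> x \<ominus> y \<in> H"
proof
  assume "H +> x = H +> y"
  then have "x \<in> H +> y" using a_rcos_self[OF x] by simp
  then show "x \<ominus> y \<in> H" using a_rcos_module[OF y x] by (simp add: minus_eq)
next
  assume "x \<ominus> y \<in> H"
  then have "x \<in> H +> y" using a_rcos_module[OF y x] by (simp add: minus_eq)
  then show "H +> x = H +> y" using a_repr_independence'[OF _ y] by simp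
qed

context uniformized
begin

context
  fixes n :: nat
  assumes n: "n > 0"
begin

interpretation I: ideal "level n" B by (rule level_ideal)

lemma \<phi>_coset: "x \<in> carrier B \<Longrightarrow> the_elem (\<phi> ` (level n +> x)) = \<phi> x"
proof -
  assume x: "x \<in> carrier B"
  have "\<phi> y = \<phi> x" if y: "y \<in> level n +> x" for y
  proof -
    obtain i where i: "i \<in> level n" "y = i \<oplus> x" using y unfolding a_r_coset_def' by blast
    then have "i \<in> carrier B" "\<phi> i = \<zero>\<^bsub>k\<^esub>" using level_nonunits[OF n] by (auto simp: nonunits_def)
    then show ?thesis using i x by simp
  qed
  moreover have "x \<in> level n +> x" by (rule I.a_rcos_self[OF x])
  ultimately have "\<phi> ` (level n +> x) = {\<phi> x}" by blast
  then show ?thesis by simp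
qed

lemma \<tau>_coset: "x \<in> carrier B \<Longrightarrow> \<tau> ` (level n +> x) = level n +> \<tau> x"
proof (intro equalityI subsetI)
  assume x: "x \<in> carrier B"
  fix z assume "z \<in> \<tau> ` (level n +> x)"
  then obtain i where i: "i \<in> level n" "z = \<tau> (i \<oplus> x)" unfolding a_r_coset_def' by blast
  then have "z = \<tau> i \<oplus> \<tau> x" using x I.Icarr by simp
  then show "z \<in> level n +> \<tau> x" using level_\<tau>[OF i(1)] unfolding a_r_coset_def' by blast
next
  assume x: "x \<in> carrier B"
  fix z assume "z \<in> level n +> \<tau> x"
  then obtain i where i: "i \<in> level n" "z = i \<oplus> \<tau> x" unfolding a_r_coset_def' by blast
  have "\<tau> (\<tau> i \<oplus> x) = i \<oplus> \<tau> x" using x I.Icarr[OF i(1)] by (simp add: \<tau>_invol)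
  then have "z = \<tau> (\<tau> i \<oplus> x)" by (simp only: i(2))
  moreover have "\<tau> i \<oplus> x \<in> level n +> x" by (rule R.a_rcosI[OF level_\<tau>[OF i(1)] I.a_subset x])
  ultimately show "z \<in> \<tau> ` (level n +> x)" by (rule image_eqI)
qed

lemma quot_cring: "cring (B Quot level n)"
  by (rule I.quotient_is_cring[OF R.cring_axioms])

lemma coset_mult: "x \<in> carrier B \<Longrightarrow> y \<in> carrier B \<Longrightarrow>
    (level n +> x) \<otimes>\<^bsub>B Quot level n\<^esub> (level n +> y) = level n +> (x \<otimes> y)"
  using ring_hom_mult[OF I.rcos_ring_hom] by (simp only:)

lemma coset_add: "x \<in> carrier B \<Longrightarrow> y \<in> carrier B \<Longrightarrow>
    (level n +> x) \<oplus>\<^bsub>B Quot level n\<^esub> (level n +> y) = level n +> (x \<oplus> y)"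
  using ring_hom_add[OF I.rcos_ring_hom] by (simp only:)

lemma coset_one: "\<one>\<^bsub>B Quot level n\<^esub> = level n +> \<one>"
  using ring_hom_one[OF I.rcos_ring_hom] by (simp only:)

lemma quot_rep: "C \<in> carrier (B Quot level n) \<Longrightarrow> \<exists>x\<in>carrier B. C = level n +> x"
  by (auto simp: FactRing_def A_RCOSETS_def')

lemma coset_in_quot: "x \<in> carrier B \<Longrightarrow> level n +> x \<in> carrier (B Quot level n)"
  using ring_hom_closed[OF I.rcos_ring_hom] by (simp only:)

text \<open>
  For \<open>n > 0\<close> the residue map is constant on cosets of \<open>level n\<close>, so it factors through the quotient, and the
  images of cosets under the involution are cosets.
\<close>

lemma quot_local_involution:
  "local_involution (B Quot level n) k (\<lambda>C. the_elem (\<phi> ` C)) (image \<tau>)"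
proof (intro local_involution.intro local_involution_axioms.intro)
  show "cring (B Quot level n)" by (rule quot_cring)
  show "finite_odd_field k" by (rule k.finite_odd_field_axioms)
  show "(\<lambda>C. the_elem (\<phi> ` C)) \<in> ring_hom (B Quot level n) k"
  proof (rule ring_hom_memI)
    fix C assume "C \<in> carrier (B Quot level n)"
    then obtain x where x: "x \<in> carrier B" "C = level n +> x" using quot_rep by blast
    then show "the_elem (\<phi> ` C) \<in> carrier k" by (simp add: \<phi>_coset)
    fix D assume "D \<in> carrier (B Quot level n)"
    then obtain y where y: "y \<in> carrier B" "D = level n +> y" using quot_rep by blast
    show "the_elem (\<phi> ` (C \<otimes>\<^bsub>B Quot level n\<^esub> D)) = the_elem (\<phi> ` C) \<otimes>\<^bsub>k\<^esub> the_elem (\<phi> ` D)"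
      "the_elem (\<phi> ` (C \<oplus>\<^bsub>B Quot level n\<^esub> D)) = the_elem (\<phi> ` C) \<oplus>\<^bsub>k\<^esub> the_elem (\<phi> ` D)"
      using x y by (simp_all add: \<phi>_coset coset_mult coset_add)
  next
    show "the_elem (\<phi> ` \<one>\<^bsub>B Quot level n\<^esub>) = \<one>\<^bsub>k\<^esub>" by (simp add: \<phi>_coset coset_one)
  qed
  show "(\<lambda>C. the_elem (\<phi> ` C)) ` carrier (B Quot level n) = carrier k"
  proof (intro equalityI subsetI)
    fix c assume "c \<in> (\<lambda>C. the_elem (\<phi> ` C)) ` carrier (B Quot level n)"
    then obtain C where "C \<in> carrier (B Quot level n)" "c = the_elem (\<phi> ` C)" by blast
    then show "c \<in> carrier k" using quot_rep \<phi>_coset by fastforce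
  next
    fix c assume "c \<in> carrier k"
    then obtain x where x: "x \<in> carrier B" "\<phi> x = c" using \<phi>_preimage by blast
    then have "c = the_elem (\<phi> ` (level n +> x))" by (simp add: \<phi>_coset)
    then show "c \<in> (\<lambda>C. the_elem (\<phi> ` C)) ` carrier (B Quot level n)" using coset_in_quot[OF x(1)] by blast
  qed
  show "image \<tau> \<in> ring_hom (B Quot level n) (B Quot level n)"
  proof (rule ring_hom_memI)
    fix C assume "C \<in> carrier (B Quot level n)"
    then obtain x where x: "x \<in> carrier B" "C = level n +> x" using quot_rep by blast
    then show "\<tau> ` C \<in> carrier (B Quot level n)" by (simp add: \<tau>_coset coset_in_quot)
    fix D assume "D \<in> carrier (B Quot level n)"
    then obtain y where y: "y \<in> carrier B" "D = level n +> y" using quot_rep by blast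
    show "\<tau> ` (C \<otimes>\<^bsub>B Quot level n\<^esub> D) = \<tau> ` C \<otimes>\<^bsub>B Quot level n\<^esub> \<tau> ` D"
      "\<tau> ` (C \<oplus>\<^bsub>B Quot level n\<^esub> D) = \<tau> ` C \<oplus>\<^bsub>B Quot level n\<^esub> \<tau> ` D"
      using x y by (simp_all add: \<tau>_coset coset_mult coset_add)
  next
    show "\<tau> ` \<one>\<^bsub>B Quot level n\<^esub> = \<one>\<^bsub>B Quot level n\<^esub>" by (simp add: \<tau>_coset coset_one)
  qed
  fix C assume "C \<in> carrier (B Quot level n)"
  then obtain x where x: "x \<in> carrier B" "C = level n +> x" using quot_rep by blast
  show "\<tau> ` \<tau> ` C = C" using x by (simp add: \<tau>_coset \<tau>_invol)
  show "the_elem (\<phi> ` (\<tau> ` C)) = the_elem (\<phi> ` C)" unfolding x(2) \<tau>_coset[OF x(1)]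
    using x(1) by (simp add: \<phi>_coset \<phi>_\<tau>)
  assume "the_elem (\<phi> ` C) \<noteq> \<zero>\<^bsub>k\<^esub>"
  then have U: "x \<in> Units B" using x \<phi>_unit by (simp add: \<phi>_coset)
  have "(level n +> x) \<otimes>\<^bsub>B Quot level n\<^esub> (level n +> inv x) = \<one>\<^bsub>B Quot level n\<^esub>"
    "(level n +> inv x) \<otimes>\<^bsub>B Quot level n\<^esub> (level n +> x) = \<one>\<^bsub>B Quot level n\<^esub>"
    using U x(1) by (simp_all add: coset_mult coset_one)
  then show "C \<in> Units (B Quot level n)" unfolding x(2) Units_def
    using coset_in_quot[OF x(1)] coset_in_quot[OF R.Units_inv_closed[OF U]] by blast
qed

interpretation L: local_involution "B Quot level n" k "\<lambda>C. the_elem (\<phi> ` C)" "image \<tau>"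
  by (rule quot_local_involution)

lemma quot_nonunits: "L.nonunits = (\<lambda>x. level n +> x) ` nonunits"
proof (intro equalityI subsetI)
  fix C assume "C \<in> L.nonunits"
  then have C: "C \<in> carrier (B Quot level n)" "the_elem (\<phi> ` C) = \<zero>\<^bsub>k\<^esub>" by (simp_all add: L.nonunits_def)
  obtain x where x: "x \<in> carrier B" "C = level n +> x" using quot_rep[OF C(1)] by blast
  then have "x \<in> nonunits" using C(2) by (simp add: nonunits_def \<phi>_coset)
  then show "C \<in> (\<lambda>x. level n +> x) ` nonunits" using x(2) by (rule rev_image_eqI)
next
  fix C assume "C \<in> (\<lambda>x. level n +> x) ` nonunits"
  then obtain x where x: "x \<in> nonunits" "C = level n +> x" by (rule imageE)
  have xc: "x \<in> carrier B" "\<phi> x = \<zero>\<^bsub>k\<^esub>" using x(1) by (simp_all add: nonunits_def)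
  show "C \<in> L.nonunits" unfolding L.nonunits_def x(2) using coset_in_quot[OF xc(1)] \<phi>_coset[OF xc(1)] xc(2) by simp
qed

text \<open>
  This carries the structure along the chain from the ring of integers to \<open>A\<close> and from \<open>A\<close> to \<open>B\<close>.
\<close>

lemma quot_uniformized:
  "uniformized (B Quot level n) k (\<lambda>C. the_elem (\<phi> ` C)) (image \<tau>) (level n +> \<beta>)"
proof (intro uniformized.intro uniformized_axioms.intro quot_local_involution)
  show "level n +> \<beta> \<in> carrier (B Quot level n)" by (rule coset_in_quot[OF \<beta>_closed])
  show "L.nonunits = {(level n +> \<beta>) \<otimes>\<^bsub>B Quot level n\<^esub> y | y. y \<in> carrier (B Quot level n)}"
    unfolding quot_nonunits
  proof (intro equalityI subsetI)
    fix C assume "C \<in> (\<lambda>x. level n +> x) ` nonunits"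
    then obtain x where x: "x \<in> nonunits" "C = level n +> x" by (rule imageE)
    then obtain y where y: "y \<in> carrier B" "x = \<beta> \<otimes> y" unfolding nonunits_eq by blast
    have "C = (level n +> \<beta>) \<otimes>\<^bsub>B Quot level n\<^esub> (level n +> y)" unfolding x(2) y(2) coset_mult[OF \<beta>_closed y(1)] ..
    then show "C \<in> {(level n +> \<beta>) \<otimes>\<^bsub>B Quot level n\<^esub> y | y. y \<in> carrier (B Quot level n)}"
      using coset_in_quot[OF y(1)] by blast
  next
    fix C assume "C \<in> {(level n +> \<beta>) \<otimes>\<^bsub>B Quot level n\<^esub> y | y. y \<in> carrier (B Quot level n)}"
    then obtain D where D: "D \<in> carrier (B Quot level n)" "C = (level n +> \<beta>) \<otimes>\<^bsub>B Quot level n\<^esub> D" by blast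
    obtain y where y: "y \<in> carrier B" "D = level n +> y" using quot_rep[OF D(1)] by blast
    have "C = level n +> (\<beta> \<otimes> y)" unfolding D(2) y(2) coset_mult[OF \<beta>_closed y(1)] ..
    moreover have "\<beta> \<otimes> y \<in> nonunits" unfolding nonunits_eq using y(1) by blast
    ultimately show "C \<in> (\<lambda>x. level n +> x) ` nonunits" by (rule image_eqI)
  qed
  have "(level n +> \<beta>) \<oplus>\<^bsub>B Quot level n\<^esub> (level n +> (\<ominus> \<beta>)) = \<zero>\<^bsub>B Quot level n\<^esub>"
    using I.a_rcos_const[OF additive_subgroup.zero_closed[OF I.is_additive_subgroup]]
    by (simp add: coset_add R.r_neg) (simp add: FactRing_def)
  then have "level n +> (\<ominus> \<beta>) = \<ominus>\<^bsub>B Quot level n\<^esub> (level n +> \<beta>)"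
    using coset_in_quot[OF \<beta>_closed] coset_in_quot[of "\<ominus> \<beta>"] L.R.a_comm[of "level n +> \<beta>" "level n +> (\<ominus> \<beta>)"]
    by (intro L.R.minus_equality[symmetric]) simp_all
  then show "\<tau> ` (level n +> \<beta>) = \<ominus>\<^bsub>B Quot level n\<^esub> (level n +> \<beta>)" by (simp add: \<tau>_coset \<tau>_\<beta>)
qed

lemma quot_pow: "(level n +> \<beta>) [^]\<^bsub>B Quot level n\<^esub> (j::nat) = level n +> (\<beta> [^] j)"
  by (induction j) (simp_all add: coset_mult coset_one)

lemma quot_zero_iff: "x \<in> carrier B \<Longrightarrow> level n +> x = \<zero>\<^bsub>B Quot level n\<^esub> \<longleftrightarrow> x \<in> level n"
proof -
  assume x: "x \<in> carrier B"
  have z: "\<zero>\<^bsub>B Quot level n\<^esub> = level n" by (simp add: FactRing_def)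
  show ?thesis unfolding z
    using I.a_rcos_const[of x] I.a_rcos_self[OF x] by auto
qed

lemma quot_pow_top: "(level n +> \<beta>) [^]\<^bsub>B Quot level n\<^esub> n = \<zero>\<^bsub>B Quot level n\<^esub>"
proof -
  have "\<beta> [^] n \<otimes> \<one> \<in> level n" unfolding level_def by blast
  then show ?thesis unfolding quot_pow using quot_zero_iff by simp
qed

text \<open>
  Together with \<open>quot_pow_top\<close> this says that passing to the quotient introduces no relation in degrees below
  \<open>n\<close>: otherwise \<open>\<beta>\<^sup>j\<close> would be a multiple of \<open>\<beta>\<^sup>n\<close>, and \<open>pow_eq_zero\<close> applies.
\<close>

lemma quot_pow_nonzero:
  assumes j: "j < n" and nz: "\<beta> [^] j \<noteq> \<zero>"
  shows "(level n +> \<beta>) [^]\<^bsub>B Quot level n\<^esub> j \<noteq> \<zero>\<^bsub>B Quot level n\<^esub>"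
proof
  assume "(level n +> \<beta>) [^]\<^bsub>B Quot level n\<^esub> j = \<zero>\<^bsub>B Quot level n\<^esub>"
  then have "\<beta> [^] j \<in> level n" unfolding quot_pow using quot_zero_iff[of "\<beta> [^] j"] by simp
  then obtain y where "y \<in> carrier B" "\<beta> [^] j = \<beta> [^] n \<otimes> y" unfolding level_def by blast
  then show False using pow_eq_zero[OF j] nz by blast
qed

end

end

section \<open>Reduction of a hermitian module modulo an ideal\<close>

text \<open>
  The last two assumptions provide the map that \<open>\<tau>\<close> induces on the quotient ring, in the form of images of
  cosets.
\<close>

locale hermitian_reduction = module A V + I: ideal I A
  for A :: "('a, 'c) ring_scheme" (structure) and V :: "('a, 'b, 'd) module_scheme" and I :: "'a set" +
  fixes \<tau> :: "'a \<Rightarrow> 'a" and h :: "'b \<Rightarrow> 'b \<Rightarrow> 'a" and n :: nat and b :: "nat \<Rightarrow> 'b"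
  assumes herm: "hermitian_form A \<tau> V h"
    and nondeg: "nondegenerate A V h"
    and basis: "module_basis A V n b"
    and \<tau>_I: "\<And>a. a \<in> I \<Longrightarrow> \<tau> a \<in> I"
    and \<tau>_coset: "\<And>a. a \<in> carrier A \<Longrightarrow> \<tau> ` (I +> a) = I +> \<tau> a"
begin

lemma h_closed [simp]: "x \<in> carrier V \<Longrightarrow> y \<in> carrier V \<Longrightarrow> h x y \<in> carrier A"
  and h_add_l: "x \<in> carrier V \<Longrightarrow> y \<in> carrier V \<Longrightarrow> z \<in> carrier V \<Longrightarrow> h (x \<oplus>\<^bsub>V\<^esub> y) z = h x z \<oplus> h y z"
  and h_add_r: "x \<in> carrier V \<Longrightarrow> y \<in> carrier V \<Longrightarrow> z \<in> carrier V \<Longrightarrow> h x (y \<oplus>\<^bsub>V\<^esub> z) = h x y \<oplus> h x z"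
  and h_smult_r: "a \<in> carrier A \<Longrightarrow> x \<in> carrier V \<Longrightarrow> y \<in> carrier V \<Longrightarrow> h x (a \<odot>\<^bsub>V\<^esub> y) = a \<otimes> h x y"
  and h_sym: "x \<in> carrier V \<Longrightarrow> y \<in> carrier V \<Longrightarrow> h y x = \<tau> (h x y)"
  using herm unfolding hermitian_form_def by blast+

lemma h_minus_r: "x \<in> carrier V \<Longrightarrow> y \<in> carrier V \<Longrightarrow> h x (\<ominus>\<^bsub>V\<^esub> y) = \<ominus> h x y"
  using h_smult_r[of "\<ominus> \<one>" x y] by (simp add: smult_l_minus R.l_minus)

lemma h_zero_r: "x \<in> carrier V \<Longrightarrow> h x \<zero>\<^bsub>V\<^esub> = \<zero>"
  using h_smult_r[of "\<zero>" x "\<zero>\<^bsub>V\<^esub>"] by simp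

lemma h_diff_r: "x \<in> carrier V \<Longrightarrow> y \<in> carrier V \<Longrightarrow> z \<in> carrier V \<Longrightarrow> h x (y \<ominus>\<^bsub>V\<^esub> z) = h x y \<ominus> h x z"
  by (simp add: M.minus_eq R.minus_eq h_add_r h_minus_r)

lemma b_closed: "i < n \<Longrightarrow> b i \<in> carrier V"
  using basis by (simp add: module_basis_def)

lemma basis_ex: "x \<in> carrier V \<Longrightarrow> \<exists>c. c \<in> {..<n} \<rightarrow>\<^sub>E carrier A \<and> x = (\<Oplus>\<^bsub>V\<^esub> i\<in>{..<n}. c i \<odot>\<^bsub>V\<^esub> b i)"
  using basis unfolding module_basis_def by blast

lemma basis_unique:
  assumes "c \<in> {..<n} \<rightarrow>\<^sub>E carrier A" "c' \<in> {..<n} \<rightarrow>\<^sub>E carrier A"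
    "(\<Oplus>\<^bsub>V\<^esub> i\<in>{..<n}. c i \<odot>\<^bsub>V\<^esub> b i) = (\<Oplus>\<^bsub>V\<^esub> i\<in>{..<n}. c' i \<odot>\<^bsub>V\<^esub> b i)"
  shows "c = c'"
proof -
  have "(\<Oplus>\<^bsub>V\<^esub> i\<in>{..<n}. c i \<odot>\<^bsub>V\<^esub> b i) \<in> carrier V"
    by (rule lin_comb_closed) (use b_closed assms(1) in auto)
  then have "\<exists>!x. x \<in> {..<n} \<rightarrow>\<^sub>E carrier A \<and> (\<Oplus>\<^bsub>V\<^esub> i\<in>{..<n}. c i \<odot>\<^bsub>V\<^esub> b i) = (\<Oplus>\<^bsub>V\<^esub> i\<in>{..<n}. x i \<odot>\<^bsub>V\<^esub> b i)"
    using basis unfolding module_basis_def by blast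
  then show ?thesis using assms by blast
qed

definition coords :: "'b \<Rightarrow> nat \<Rightarrow> 'a" where
  "coords x = (SOME c. c \<in> {..<n} \<rightarrow>\<^sub>E carrier A \<and> x = (\<Oplus>\<^bsub>V\<^esub> i\<in>{..<n}. c i \<odot>\<^bsub>V\<^esub> b i))"

lemma coords:
  assumes "x \<in> carrier V"
  shows "coords x \<in> {..<n} \<rightarrow>\<^sub>E carrier A" "x = (\<Oplus>\<^bsub>V\<^esub> i\<in>{..<n}. coords x i \<odot>\<^bsub>V\<^esub> b i)"
  using someI_ex[OF basis_ex[OF assms]] unfolding coords_def by blast+

lemma coords_closed: "x \<in> carrier V \<Longrightarrow> i < n \<Longrightarrow> coords x i \<in> carrier A"
  using coords(1) by blast

lemma coords_eq:
  assumes c: "\<And>i. i < n \<Longrightarrow> c i \<in> carrier A" and x: "x = (\<Oplus>\<^bsub>V\<^esub> i\<in>{..<n}. c i \<odot>\<^bsub>V\<^esub> b i)" and i: "i < n"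
  shows "coords x i = c i"
proof -
  let ?c = "restrict c {..<n}"
  have xc: "x \<in> carrier V" unfolding x by (rule lin_comb_closed) (use b_closed c in auto)
  have e: "(\<Oplus>\<^bsub>V\<^esub> i\<in>{..<n}. ?c i \<odot>\<^bsub>V\<^esub> b i) = x" unfolding x by (rule lin_comb_cong) (use b_closed c in auto)
  have "coords x = ?c"
  proof (rule basis_unique)
    show "(\<Oplus>\<^bsub>V\<^esub> i\<in>{..<n}. coords x i \<odot>\<^bsub>V\<^esub> b i) = (\<Oplus>\<^bsub>V\<^esub> i\<in>{..<n}. ?c i \<odot>\<^bsub>V\<^esub> b i)"
      unfolding e by (rule coords(2)[OF xc, symmetric])
  qed (use coords(1)[OF xc] c in auto)
  then show ?thesis using i by simp
qed

lemma coords_hom: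
  assumes i: "i < n"
  shows "restrict (\<lambda>x. coords x i) (carrier V) \<in> module_hom A V (regular_module A)"
proof -
  have 1: "coords (x \<oplus>\<^bsub>V\<^esub> y) i = coords x i \<oplus> coords y i" if x: "x \<in> carrier V" and y: "y \<in> carrier V" for x y
  proof (rule coords_eq[OF _ _ i])
    have "(\<Oplus>\<^bsub>V\<^esub> i\<in>{..<n}. (coords x i \<oplus> coords y i) \<odot>\<^bsub>V\<^esub> b i) = (\<Oplus>\<^bsub>V\<^esub> i\<in>{..<n}. coords x i \<odot>\<^bsub>V\<^esub> b i \<oplus>\<^bsub>V\<^esub> coords y i \<odot>\<^bsub>V\<^esub> b i)"
      by (rule M.finsum_cong') (use x y coords_closed b_closed smult_l_distr in auto)
    also have "\<dots> = (\<Oplus>\<^bsub>V\<^esub> i\<in>{..<n}. coords x i \<odot>\<^bsub>V\<^esub> b i) \<oplus>\<^bsub>V\<^esub> (\<Oplus>\<^bsub>V\<^esub> i\<in>{..<n}. coords y i \<odot>\<^bsub>V\<^esub> b i)"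
      by (rule M.finsum_addf) (use x y coords_closed b_closed in auto)
    also have "\<dots> = x \<oplus>\<^bsub>V\<^esub> y" by (simp only: coords(2)[OF x, symmetric] coords(2)[OF y, symmetric])
    finally show "x \<oplus>\<^bsub>V\<^esub> y = (\<Oplus>\<^bsub>V\<^esub> i\<in>{..<n}. (coords x i \<oplus> coords y i) \<odot>\<^bsub>V\<^esub> b i)" ..
  qed (use x y coords_closed in auto)
  have 2: "coords (a \<odot>\<^bsub>V\<^esub> x) i = a \<otimes> coords x i" if a: "a \<in> carrier A" and x: "x \<in> carrier V" for a x
  proof (rule coords_eq[OF _ _ i])
    have "(\<Oplus>\<^bsub>V\<^esub> i\<in>{..<n}. (a \<otimes> coords x i) \<odot>\<^bsub>V\<^esub> b i) = (\<Oplus>\<^bsub>V\<^esub> i\<in>{..<n}. a \<odot>\<^bsub>V\<^esub> (coords x i \<odot>\<^bsub>V\<^esub> b i))"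
      by (rule M.finsum_cong') (use x a coords_closed b_closed smult_assoc1 in auto)
    also have "\<dots> = a \<odot>\<^bsub>V\<^esub> (\<Oplus>\<^bsub>V\<^esub> i\<in>{..<n}. coords x i \<odot>\<^bsub>V\<^esub> b i)"
      by (rule finsum_smult_ldistr[symmetric]) (use x a coords_closed b_closed in auto)
    also have "\<dots> = a \<odot>\<^bsub>V\<^esub> x" by (simp only: coords(2)[OF x, symmetric])
    finally show "a \<odot>\<^bsub>V\<^esub> x = (\<Oplus>\<^bsub>V\<^esub> i\<in>{..<n}. (a \<otimes> coords x i) \<odot>\<^bsub>V\<^esub> b i)" ..
  qed (use x a coords_closed in auto)
  show ?thesis unfolding module_hom_def regular_module_def
    using 1 2 coords_closed i by auto
qed

lemma coords_basis: "i < n \<Longrightarrow> j < n \<Longrightarrow> coords (b j) i = (if i = j then \<one> else \<zero>)"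
proof -
  assume i: "i < n" and j: "j < n"
  have "b j = (\<Oplus>\<^bsub>V\<^esub> i\<in>{..<n}. (if i = j then \<one> else \<zero>) \<odot>\<^bsub>V\<^esub> b i)"
    using lin_comb_unit[of n b j \<one>] b_closed j by simp
  then show ?thesis by (intro coords_eq[OF _ _ i]) auto
qed

text \<open>
  By nondegeneracy every coordinate function is represented by a vector.
\<close>

lemma dual_exists:
  assumes i: "i < n"
  shows "\<exists>d\<in>carrier V. \<forall>x\<in>carrier V. h d x = coords x i"
proof -
  have "restrict (\<lambda>x. coords x i) (carrier V) \<in> (\<lambda>x. restrict (h x) (carrier V)) ` carrier V"
    using coords_hom[OF i] nondeg unfolding nondegenerate_def bij_betw_def by simp
  then obtain d where d: "d \<in> carrier V" "restrict (\<lambda>x. coords x i) (carrier V) = restrict (h d) (carrier V)"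
    by (rule imageE)
  have "h d x = coords x i" if x: "x \<in> carrier V" for x using fun_cong[OF d(2), of x] x by simp
  then show ?thesis using d(1) by blast
qed

definition N :: "'b set" where "N = ideal_smult V I"

lemma N_gen: "a \<in> I \<Longrightarrow> x \<in> carrier V \<Longrightarrow> a \<odot>\<^bsub>V\<^esub> x \<in> N"
  unfolding N_def ideal_smult_def by (rule generate.incl) blast

lemma N_subgroup: "subgroup N (add_monoid V)"
  unfolding N_def ideal_smult_def
proof (rule group.generate_is_subgroup)
  show "group (add_monoid V)" by (rule M.a_group)
  show "{a \<odot>\<^bsub>V\<^esub> x |a x. a \<in> I \<and> x \<in> carrier V} \<subseteq> carrier (add_monoid V)"
    using I.Icarr by auto
qed

lemma N_abelian_subgroup: "abelian_subgroup N V"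
  by (intro abelian_subgroupI3 additive_subgroupI N_subgroup M.abelian_group_axioms)

lemmas N_a_rcos_eq_iff = abelian_subgroup.a_rcos_eq_iff[OF N_abelian_subgroup]
  and N_a_rcos_self = abelian_subgroup.a_rcos_self[OF N_abelian_subgroup]
  and N_a_rcos_sum = abelian_subgroup.a_rcos_sum[OF N_abelian_subgroup]
  and N_a_rcos_const = abelian_subgroup.a_rcos_const[OF N_abelian_subgroup]
  and N_a_rcos_module = abelian_subgroup.a_rcos_module[OF N_abelian_subgroup]
  and N_zero_closed = additive_subgroup.zero_closed[OF additive_subgroupI[OF N_subgroup]]
  and N_a_closed = additive_subgroup.a_closed[OF additive_subgroupI[OF N_subgroup]]
  and N_a_Hcarr = additive_subgroup.a_Hcarr[OF additive_subgroupI[OF N_subgroup]]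

lemma h_N_r:
  assumes x: "x \<in> carrier V" and z: "z \<in> N" shows "h x z \<in> I"
  using z unfolding N_def ideal_smult_def
proof induction
  case one
  then show ?case using x additive_subgroup.zero_closed[OF I.is_additive_subgroup] by (simp add: h_zero_r)
next
  case (incl z)
  then show ?case using x I.I_r_closed I.Icarr by (auto simp: h_smult_r)
next
  case (inv z)
  then obtain a y where z: "a \<in> I" "y \<in> carrier V" "z = a \<odot>\<^bsub>V\<^esub> y" by blast
  have "h x (\<ominus>\<^bsub>V\<^esub> z) = \<ominus> (a \<otimes> h x y)" using z x I.Icarr by (simp add: h_minus_r h_smult_r)
  then show ?case using z x I.I_r_closed I.Icarr additive_subgroup.a_inv_closed[OF I.is_additive_subgroup]
    by (simp add: a_inv_def)
next
  case (eng z w)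
  have "z \<in> carrier V" "w \<in> carrier V"
    using eng.hyps subgroup.mem_carrier[OF N_subgroup] unfolding N_def ideal_smult_def by auto
  then show ?case using eng.IH x additive_subgroup.a_closed[OF I.is_additive_subgroup] by (simp add: h_add_r)
qed

lemma h_N_l: "x \<in> carrier V \<Longrightarrow> z \<in> N \<Longrightarrow> h z x \<in> I"
  using h_N_r[of x z] \<tau>_I h_sym[of x z] N_a_Hcarr by simp

lemma N_smult:
  assumes c: "c \<in> carrier A" and z: "z \<in> N" shows "c \<odot>\<^bsub>V\<^esub> z \<in> N"
proof -
  have "z \<in> generate (add_monoid V) {a \<odot>\<^bsub>V\<^esub> x |a x. a \<in> I \<and> x \<in> carrier V}"
    using z by (simp only: N_def ideal_smult_def)
  then show ?thesis
  proof induction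
    case one
    then show ?case using c N_zero_closed by simp
  next
    case (incl z)
    then obtain a y where z: "a \<in> I" "y \<in> carrier V" "z = a \<odot>\<^bsub>V\<^esub> y" by blast
    have "c \<odot>\<^bsub>V\<^esub> z = (c \<otimes> a) \<odot>\<^bsub>V\<^esub> y" using z c I.Icarr by (simp add: smult_assoc1)
    then show ?case using N_gen[OF I.I_l_closed[OF z(1) c] z(2)] by simp
  next
    case (inv z)
    then obtain a y where z: "a \<in> I" "y \<in> carrier V" "z = a \<odot>\<^bsub>V\<^esub> y" by blast
    have "c \<odot>\<^bsub>V\<^esub> (\<ominus>\<^bsub>V\<^esub> z) = (\<ominus> (c \<otimes> a)) \<odot>\<^bsub>V\<^esub> y" using z c I.Icarr by (simp add: smult_assoc1 smult_r_minus smult_l_minus)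
    moreover have "\<ominus> (c \<otimes> a) \<in> I"
      by (rule additive_subgroup.a_inv_closed[OF I.is_additive_subgroup I.I_l_closed[OF z(1) c]])
    ultimately have "c \<odot>\<^bsub>V\<^esub> (\<ominus>\<^bsub>V\<^esub> z) \<in> N" using N_gen z(2) by simp
    then show ?case by (simp only: a_inv_def)
  next
    case (eng z w)
    have zw: "z \<in> carrier V" "w \<in> carrier V"
      using eng.hyps subgroup.mem_carrier[OF N_subgroup] unfolding N_def ideal_smult_def by auto
    have "c \<odot>\<^bsub>V\<^esub> (z \<oplus>\<^bsub>V\<^esub> w) = c \<odot>\<^bsub>V\<^esub> z \<oplus>\<^bsub>V\<^esub> c \<odot>\<^bsub>V\<^esub> w" using c zw by (simp add: smult_r_distr)
    then show ?case using N_a_closed[OF eng.IH] by simp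
  qed
qed

abbreviation proj :: "'b \<Rightarrow> 'b set" where "proj x \<equiv> N +>\<^bsub>V\<^esub> x"

abbreviation Vbar :: "('a set, 'b set) module" where "Vbar \<equiv> quot_module V I"

lemma Vbar_carrier: "carrier Vbar = proj ` carrier V"
  by (auto simp: quot_module_def A_RCOSETS_def' N_def)

lemma proj_closed: "x \<in> carrier V \<Longrightarrow> proj x \<in> carrier Vbar" unfolding Vbar_carrier by (rule imageI)

lemma proj_add: "x \<in> carrier V \<Longrightarrow> y \<in> carrier V \<Longrightarrow> proj x \<oplus>\<^bsub>Vbar\<^esub> proj y = proj (x \<oplus>\<^bsub>V\<^esub> y)"
  using N_a_rcos_sum by (simp add: quot_module_def)

lemma Vbar_zero: "\<zero>\<^bsub>Vbar\<^esub> = proj \<zero>\<^bsub>V\<^esub>"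
  using N_a_rcos_const[OF N_zero_closed] by (simp add: quot_module_def N_def)

lemma I_coset_eq: "a \<in> carrier A \<Longrightarrow> a' \<in> carrier A \<Longrightarrow> I +> a = I +> a' \<longleftrightarrow> a \<ominus> a' \<in> I"
  by (rule I.a_rcos_eq_iff)

lemma I_cosetD:
  assumes a: "a \<in> carrier A" and a': "a' \<in> I +> a" shows "a' \<in> carrier A" "a' \<ominus> a \<in> I"
proof -
  show c: "a' \<in> carrier A" using a' I.a_subset a I.Icarr unfolding a_r_coset_def' by auto
  show "a' \<ominus> a \<in> I" using I.a_rcos_module[OF a c] a' by (simp add: R.minus_eq)
qed

lemma N_cosetD:
  assumes x: "x \<in> carrier V" and x': "x' \<in> proj x" shows "x' \<in> carrier V" "x' \<ominus>\<^bsub>V\<^esub> x \<in> N"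
proof -
  show c: "x' \<in> carrier V" using x' x N_a_Hcarr unfolding a_r_coset_def' by auto
  show "x' \<ominus>\<^bsub>V\<^esub> x \<in> N" using N_a_rcos_module[OF x c] x' by (simp add: M.minus_eq)
qed

lemma UN_const: "(\<And>a x. a \<in> C \<Longrightarrow> x \<in> D \<Longrightarrow> f a x = S) \<Longrightarrow> a0 \<in> C \<Longrightarrow> x0 \<in> D \<Longrightarrow> (\<Union>a\<in>C. \<Union>x\<in>D. f a x) = S"
  by blast

lemma proj_smult:
  assumes a: "a \<in> carrier A" and x: "x \<in> carrier V"
  shows "(I +> a) \<odot>\<^bsub>Vbar\<^esub> proj x = proj (a \<odot>\<^bsub>V\<^esub> x)"
proof -
  have "(\<Union>a'\<in>I +> a. \<Union>x'\<in>proj x. proj (a' \<odot>\<^bsub>V\<^esub> x')) = proj (a \<odot>\<^bsub>V\<^esub> x)"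
  proof (rule UN_const[OF _ I.a_rcos_self[OF a] N_a_rcos_self[OF x]])
    fix a' x' assume a': "a' \<in> I +> a" and x': "x' \<in> proj x"
    note aD = I_cosetD[OF a a'] and xD = N_cosetD[OF x x']
    have "a' \<odot>\<^bsub>V\<^esub> x' \<ominus>\<^bsub>V\<^esub> a \<odot>\<^bsub>V\<^esub> x = (a' \<ominus> a) \<odot>\<^bsub>V\<^esub> x' \<oplus>\<^bsub>V\<^esub> a \<odot>\<^bsub>V\<^esub> (x' \<ominus>\<^bsub>V\<^esub> x)"
      using a x aD(1) xD(1)
      by (simp add: M.minus_eq R.minus_eq smult_l_distr smult_r_distr smult_l_minus smult_r_minus M.a_assoc M.r_neg1)
    also have "\<dots> \<in> N" by (intro N_a_closed N_gen N_smult aD xD a)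
    finally show "proj (a' \<odot>\<^bsub>V\<^esub> x') = proj (a \<odot>\<^bsub>V\<^esub> x)" using a x aD(1) xD(1) by (subst N_a_rcos_eq_iff) auto
  qed
  then show ?thesis by (simp add: quot_module_def N_def)
qed

lemma Q_rep: "C \<in> carrier (A Quot I) \<Longrightarrow> \<exists>a\<in>carrier A. C = I +> a"
  by (auto simp: FactRing_def A_RCOSETS_def')

lemma Q_closed: "a \<in> carrier A \<Longrightarrow> I +> a \<in> carrier (A Quot I)"
  using ring_hom_closed[OF I.rcos_ring_hom] by (simp only:)

lemma Q_add: "a \<in> carrier A \<Longrightarrow> a' \<in> carrier A \<Longrightarrow> (I +> a) \<oplus>\<^bsub>A Quot I\<^esub> (I +> a') = I +> (a \<oplus> a')"
  using ring_hom_add[OF I.rcos_ring_hom] by (simp only:)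

lemma Q_mult: "a \<in> carrier A \<Longrightarrow> a' \<in> carrier A \<Longrightarrow> (I +> a) \<otimes>\<^bsub>A Quot I\<^esub> (I +> a') = I +> (a \<otimes> a')"
  using ring_hom_mult[OF I.rcos_ring_hom] by (simp only:)

lemma Q_one: "\<one>\<^bsub>A Quot I\<^esub> = I +> \<one>"
  using ring_hom_one[OF I.rcos_ring_hom] by (simp only:)

lemma Q_zero: "\<zero>\<^bsub>A Quot I\<^esub> = I +> \<zero>"
  using I.a_rcos_const[OF additive_subgroup.zero_closed[OF I.is_additive_subgroup]] by (simp add: FactRing_def)

lemma Vbar_module: "module (A Quot I) Vbar"
proof (rule moduleI)
  show "cring (A Quot I)" by (rule I.quotient_is_cring[OF R.cring_axioms])
  have V: "\<exists>x\<in>carrier V. D = proj x" if "D \<in> carrier Vbar" for D using that unfolding Vbar_carrier by blast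
  show "abelian_group Vbar"
  proof (rule abelian_groupI)
    show "\<zero>\<^bsub>Vbar\<^esub> \<in> carrier Vbar" unfolding Vbar_zero by (rule proj_closed) simp
    fix D assume "D \<in> carrier Vbar"
    then obtain x where x: "x \<in> carrier V" "D = proj x" using V by blast
    show "\<zero>\<^bsub>Vbar\<^esub> \<oplus>\<^bsub>Vbar\<^esub> D = D" using x(1) by (simp add: x(2) Vbar_zero proj_add)
    show "\<exists>E\<in>carrier Vbar. E \<oplus>\<^bsub>Vbar\<^esub> D = \<zero>\<^bsub>Vbar\<^esub>"
      by (rule bexI[OF _ proj_closed[of "\<ominus>\<^bsub>V\<^esub> x"]]) (use x(1) in \<open>simp_all add: x(2) Vbar_zero proj_add M.l_neg\<close>)
    fix E assume "E \<in> carrier Vbar"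
    then obtain y where y: "y \<in> carrier V" "E = proj y" using V by blast
    show "D \<oplus>\<^bsub>Vbar\<^esub> E \<in> carrier Vbar" unfolding x(2) y(2) proj_add[OF x(1) y(1)] using x(1) y(1) by (intro proj_closed) simp
    show "D \<oplus>\<^bsub>Vbar\<^esub> E = E \<oplus>\<^bsub>Vbar\<^esub> D" unfolding x(2) y(2) proj_add[OF x(1) y(1)] proj_add[OF y(1) x(1)]
      using x(1) y(1) by (simp only: M.a_comm)
    fix G assume "G \<in> carrier Vbar"
    then obtain z where z: "z \<in> carrier V" "G = proj z" using V by blast
    show "(D \<oplus>\<^bsub>Vbar\<^esub> E) \<oplus>\<^bsub>Vbar\<^esub> G = D \<oplus>\<^bsub>Vbar\<^esub> (E \<oplus>\<^bsub>Vbar\<^esub> G)"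
      using x(1) y(1) z(1) by (simp add: x(2) y(2) z(2) proj_add M.a_assoc)
  qed
  fix D assume "D \<in> carrier Vbar"
  then obtain x where x: "x \<in> carrier V" "D = proj x" using V by blast
  show "\<one>\<^bsub>A Quot I\<^esub> \<odot>\<^bsub>Vbar\<^esub> D = D" unfolding x(2) Q_one proj_smult[OF R.one_closed x(1)] using x(1) by simp
  fix C assume "C \<in> carrier (A Quot I)"
  then obtain a where a: "a \<in> carrier A" "C = I +> a" using Q_rep by blast
  show "C \<odot>\<^bsub>Vbar\<^esub> D \<in> carrier Vbar" unfolding x(2) a(2) proj_smult[OF a(1) x(1)] using x(1) a(1) by (intro proj_closed) simp
  { fix C' assume "C' \<in> carrier (A Quot I)"
    then obtain a' where a': "a' \<in> carrier A" "C' = I +> a'" using Q_rep by blast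
    show "(C \<oplus>\<^bsub>A Quot I\<^esub> C') \<odot>\<^bsub>Vbar\<^esub> D = C \<odot>\<^bsub>Vbar\<^esub> D \<oplus>\<^bsub>Vbar\<^esub> C' \<odot>\<^bsub>Vbar\<^esub> D"
      using a(1) a'(1) x(1) by (simp add: a(2) a'(2) x(2) Q_add proj_smult proj_add smult_l_distr)
    show "(C \<otimes>\<^bsub>A Quot I\<^esub> C') \<odot>\<^bsub>Vbar\<^esub> D = C \<odot>\<^bsub>Vbar\<^esub> (C' \<odot>\<^bsub>Vbar\<^esub> D)"
      using a(1) a'(1) x(1) by (simp add: a(2) a'(2) x(2) Q_mult proj_smult smult_assoc1) }
  fix D' assume "D' \<in> carrier Vbar"
  then obtain x' where x': "x' \<in> carrier V" "D' = proj x'" using V by blast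
  show "C \<odot>\<^bsub>Vbar\<^esub> (D \<oplus>\<^bsub>Vbar\<^esub> D') = C \<odot>\<^bsub>Vbar\<^esub> D \<oplus>\<^bsub>Vbar\<^esub> C \<odot>\<^bsub>Vbar\<^esub> D'"
    using a(1) x(1) x'(1) by (simp add: a(2) x(2) x'(2) proj_smult proj_add smult_r_distr)
qed

lemma proj_lin:
  assumes "\<And>i. i < (r::nat) \<Longrightarrow> c i \<in> carrier A" "\<And>i. i < r \<Longrightarrow> y i \<in> carrier V"
  shows "(\<Oplus>\<^bsub>Vbar\<^esub> i\<in>{..<r}. (I +> c i) \<odot>\<^bsub>Vbar\<^esub> proj (y i)) = proj (\<Oplus>\<^bsub>V\<^esub> i\<in>{..<r}. c i \<odot>\<^bsub>V\<^esub> y i)"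
  using assms
proof (induction r)
  case 0
  interpret Vbar: module "A Quot I" Vbar by (rule Vbar_module)
  show ?case by (simp add: Vbar_zero)
next
  case (Suc r)
  interpret Vbar: module "A Quot I" Vbar by (rule Vbar_module)
  have c: "\<And>i. i < Suc r \<Longrightarrow> I +> c i \<in> carrier (A Quot I)" using Suc.prems Q_closed by blast
  have y: "\<And>i. i < Suc r \<Longrightarrow> proj (y i) \<in> carrier Vbar" using Suc.prems proj_closed by blast
  have "(\<Oplus>\<^bsub>Vbar\<^esub> i\<in>{..<Suc r}. (I +> c i) \<odot>\<^bsub>Vbar\<^esub> proj (y i)) =
    (I +> c r) \<odot>\<^bsub>Vbar\<^esub> proj (y r) \<oplus>\<^bsub>Vbar\<^esub> (\<Oplus>\<^bsub>Vbar\<^esub> i\<in>{..<r}. (I +> c i) \<odot>\<^bsub>Vbar\<^esub> proj (y i))"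
    by (rule Vbar.lin_comb_Suc) (use c y in auto)
  also have "\<dots> = proj (c r \<odot>\<^bsub>V\<^esub> y r) \<oplus>\<^bsub>Vbar\<^esub> proj (\<Oplus>\<^bsub>V\<^esub> i\<in>{..<r}. c i \<odot>\<^bsub>V\<^esub> y i)"
    using Suc proj_smult[of "c r" "y r"] by simp
  also have "\<dots> = proj (c r \<odot>\<^bsub>V\<^esub> y r \<oplus>\<^bsub>V\<^esub> (\<Oplus>\<^bsub>V\<^esub> i\<in>{..<r}. c i \<odot>\<^bsub>V\<^esub> y i))"
    by (rule proj_add) (use Suc.prems lin_comb_closed in auto)
  also have "c r \<odot>\<^bsub>V\<^esub> y r \<oplus>\<^bsub>V\<^esub> (\<Oplus>\<^bsub>V\<^esub> i\<in>{..<r}. c i \<odot>\<^bsub>V\<^esub> y i) = (\<Oplus>\<^bsub>V\<^esub> i\<in>{..<Suc r}. c i \<odot>\<^bsub>V\<^esub> y i)"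
    by (rule lin_comb_Suc[symmetric]) (use Suc.prems in auto)
  finally show ?case .
qed

text \<open>
  The coordinates are values of the form against fixed vectors, and the form maps the submodule spanned by
  \<open>I\<close>-multiples into \<open>I\<close>.
\<close>

lemma proj_eq_imp_coords:
  assumes x: "x \<in> carrier V" and y: "y \<in> carrier V" and eq: "proj x = proj y" and i: "i < n"
  shows "I +> coords x i = I +> coords y i"
proof -
  obtain d where d: "d \<in> carrier V" "\<And>x. x \<in> carrier V \<Longrightarrow> h d x = coords x i" using dual_exists[OF i] by blast
  have "x \<ominus>\<^bsub>V\<^esub> y \<in> N" using N_a_rcos_eq_iff[OF x y] eq by simp
  then have "h d (x \<ominus>\<^bsub>V\<^esub> y) \<in> I" by (rule h_N_r[OF d(1)])
  then have "coords x i \<ominus> coords y i \<in> I" using h_diff_r[OF d(1) x y] d(2) x y by simp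
  then show ?thesis using I_coset_eq coords_closed x y i by simp
qed

lemma Vbar_basis: "module_basis (A Quot I) Vbar n (\<lambda>i. proj (b i))"
  unfolding module_basis_def
proof (intro conjI allI impI ballI)
  show "proj (b i) \<in> carrier Vbar" if "i < n" for i using proj_closed[OF b_closed[OF that]] .
  fix D assume "D \<in> carrier Vbar"
  then obtain x where x: "x \<in> carrier V" "D = proj x" unfolding Vbar_carrier by blast
  let ?c = "\<lambda>i\<in>{..<n}. I +> coords x i"
  interpret Vbar: module "A Quot I" Vbar by (rule Vbar_module)
  show "\<exists>!c. c \<in> {..<n} \<rightarrow>\<^sub>E carrier (A Quot I) \<and> D = (\<Oplus>\<^bsub>Vbar\<^esub> i\<in>{..<n}. c i \<odot>\<^bsub>Vbar\<^esub> proj (b i))"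
  proof (intro ex1I conjI)
    show "?c \<in> {..<n} \<rightarrow>\<^sub>E carrier (A Quot I)" using Q_closed coords_closed[OF x(1)] by auto
    have "(\<Oplus>\<^bsub>Vbar\<^esub> i\<in>{..<n}. ?c i \<odot>\<^bsub>Vbar\<^esub> proj (b i)) = (\<Oplus>\<^bsub>Vbar\<^esub> i\<in>{..<n}. (I +> coords x i) \<odot>\<^bsub>Vbar\<^esub> proj (b i))"
      by (rule Vbar.lin_comb_cong) (use Q_closed coords_closed[OF x(1)] proj_closed b_closed in auto)
    also have "\<dots> = proj (\<Oplus>\<^bsub>V\<^esub> i\<in>{..<n}. coords x i \<odot>\<^bsub>V\<^esub> b i)"
      by (rule proj_lin) (use coords_closed[OF x(1)] b_closed in auto)
    also have "\<dots> = D" unfolding x(2) by (simp only: coords(2)[OF x(1), symmetric])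
    finally show "D = (\<Oplus>\<^bsub>Vbar\<^esub> i\<in>{..<n}. ?c i \<odot>\<^bsub>Vbar\<^esub> proj (b i))" ..
    fix c assume c: "c \<in> {..<n} \<rightarrow>\<^sub>E carrier (A Quot I) \<and> D = (\<Oplus>\<^bsub>Vbar\<^esub> i\<in>{..<n}. c i \<odot>\<^bsub>Vbar\<^esub> proj (b i))"
    have "\<forall>i\<in>{..<n}. \<exists>a. a \<in> carrier A \<and> c i = I +> a" using c Q_rep by blast
    then have "\<exists>a. \<forall>i\<in>{..<n}. a i \<in> carrier A \<and> c i = I +> a i" by (rule bchoice)
    then obtain a where a': "\<forall>i\<in>{..<n}. a i \<in> carrier A \<and> c i = I +> a i" by blast
    have a: "\<And>i. i < n \<Longrightarrow> a i \<in> carrier A" "\<And>i. i < n \<Longrightarrow> c i = I +> a i" using a' by blast+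
    define y where "y = (\<Oplus>\<^bsub>V\<^esub> i\<in>{..<n}. a i \<odot>\<^bsub>V\<^esub> b i)"
    have y: "y \<in> carrier V" unfolding y_def by (rule lin_comb_closed) (use a b_closed in auto)
    have "D = (\<Oplus>\<^bsub>Vbar\<^esub> i\<in>{..<n}. c i \<odot>\<^bsub>Vbar\<^esub> proj (b i))" using c by blast
    also have "\<dots> = (\<Oplus>\<^bsub>Vbar\<^esub> i\<in>{..<n}. (I +> a i) \<odot>\<^bsub>Vbar\<^esub> proj (b i))"
      by (rule Vbar.lin_comb_cong) (use Q_closed a proj_closed b_closed in auto)
    also have "\<dots> = proj y" unfolding y_def by (rule proj_lin) (use a b_closed in auto)
    finally have xy: "proj x = proj y" unfolding x(2) .
    have "c i = ?c i" if i: "i < n" for i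
      using proj_eq_imp_coords[OF x(1) y xy i] coords_eq[OF a(1) y_def i] a(2)[OF i] i by simp
    moreover have "c \<in> extensional {..<n}" using c by (simp add: PiE_iff)
    ultimately show "c = ?c" by (intro extensionalityI[of c "{..<n}"]) auto
  qed
qed

abbreviation hbar :: "'b set \<Rightarrow> 'b set \<Rightarrow> 'a set" where "hbar \<equiv> quot_form A I h"

lemma hbar_proj:
  assumes x: "x \<in> carrier V" and y: "y \<in> carrier V"
  shows "hbar (proj x) (proj y) = I +> h x y"
  unfolding quot_form_def
proof (rule UN_const[OF _ N_a_rcos_self[OF x] N_a_rcos_self[OF y]])
  fix x' y' assume x': "x' \<in> proj x" and y': "y' \<in> proj y"
  note xD = N_cosetD[OF x x'] and yD = N_cosetD[OF y y']
  define u where "u = x' \<ominus>\<^bsub>V\<^esub> x"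
  have uc: "u \<in> carrier V" using x xD(1) by (simp add: u_def)
  have "x' = u \<oplus>\<^bsub>V\<^esub> x" using x xD(1) by (simp add: u_def M.minus_eq M.a_assoc M.l_neg)
  then have "h x' y' = h u y' \<oplus> h x y'" using uc x yD(1) by (simp add: h_add_l)
  moreover have "h x (y' \<ominus>\<^bsub>V\<^esub> y) = h x y' \<ominus> h x y" by (rule h_diff_r[OF x yD(1) y])
  ultimately have "h x' y' \<ominus> h x y = h u y' \<oplus> h x (y' \<ominus>\<^bsub>V\<^esub> y)"
    using uc x y yD(1) by (simp add: R.minus_eq R.a_assoc)
  also have "\<dots> \<in> I"
    using h_N_l[OF yD(1) xD(2)] h_N_r[OF x yD(2)] additive_subgroup.a_closed[OF I.is_additive_subgroup]
    by (simp add: u_def)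
  finally show "I +> h x' y' = I +> h x y" using I_coset_eq xD(1) yD(1) x y by simp
qed

lemma hbar_hermitian: "hermitian_form (A Quot I) (image \<tau>) Vbar hbar"
proof -
  have V: "\<exists>x\<in>carrier V. D = proj x" if "D \<in> carrier Vbar" for D using that unfolding Vbar_carrier by blast
  show ?thesis unfolding hermitian_form_def
  proof (intro conjI ballI)
    fix D E assume "D \<in> carrier Vbar" "E \<in> carrier Vbar"
    then obtain x y where x: "x \<in> carrier V" "D = proj x" and y: "y \<in> carrier V" "E = proj y" using V by meson
    show "hbar D E \<in> carrier (A Quot I)" unfolding x(2) y(2) hbar_proj[OF x(1) y(1)] using x(1) y(1) by (intro Q_closed) simp
    show "hbar E D = \<tau> ` hbar D E" unfolding x(2) y(2) hbar_proj[OF x(1) y(1)] hbar_proj[OF y(1) x(1)] \<tau>_coset[OF h_closed[OF x(1) y(1)]]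
      by (simp only: h_sym[OF x(1) y(1)])
    { fix G assume "G \<in> carrier Vbar"
      then obtain z where z: "z \<in> carrier V" "G = proj z" using V by blast
      show "hbar (D \<oplus>\<^bsub>Vbar\<^esub> E) G = hbar D G \<oplus>\<^bsub>A Quot I\<^esub> hbar E G"
        using x(1) y(1) z(1) by (simp add: x(2) y(2) z(2) proj_add hbar_proj Q_add h_add_l)
      show "hbar D (E \<oplus>\<^bsub>Vbar\<^esub> G) = hbar D E \<oplus>\<^bsub>A Quot I\<^esub> hbar D G"
        using x(1) y(1) z(1) by (simp add: x(2) y(2) z(2) proj_add hbar_proj Q_add h_add_r) }
  next
    fix C D E assume "C \<in> carrier (A Quot I)" "D \<in> carrier Vbar" "E \<in> carrier Vbar"
    then obtain a x y where a: "a \<in> carrier A" "C = I +> a" and x: "x \<in> carrier V" "D = proj x" and y: "y \<in> carrier V" "E = proj y"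
      using V Q_rep by meson
    show "hbar D (C \<odot>\<^bsub>Vbar\<^esub> E) = C \<otimes>\<^bsub>A Quot I\<^esub> hbar D E"
      using x(1) y(1) a(1) by (simp add: x(2) y(2) a(2) proj_smult hbar_proj Q_mult h_smult_r)
  qed
qed

text \<open>
  The reductions of the dual vectors form a dual basis again; this is the nondegeneracy of the reduced form.
\<close>

lemma hbar_dual:
  "\<exists>d. \<forall>i<n. d i \<in> carrier Vbar \<and> (\<forall>j<n. hbar (d i) (proj (b j)) = (if i = j then \<one>\<^bsub>A Quot I\<^esub> else \<zero>\<^bsub>A Quot I\<^esub>))"
proof -
  have "\<forall>i. \<exists>d. i < n \<longrightarrow> d \<in> carrier Vbar \<and> (\<forall>j<n. hbar d (proj (b j)) = (if i = j then \<one>\<^bsub>A Quot I\<^esub> else \<zero>\<^bsub>A Quot I\<^esub>))"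
  proof
    fix i show "\<exists>d. i < n \<longrightarrow> d \<in> carrier Vbar \<and> (\<forall>j<n. hbar d (proj (b j)) = (if i = j then \<one>\<^bsub>A Quot I\<^esub> else \<zero>\<^bsub>A Quot I\<^esub>))"
    proof (cases "i < n")
      case True
      obtain d where d: "d \<in> carrier V" "\<And>x. x \<in> carrier V \<Longrightarrow> h d x = coords x i" using dual_exists[OF True] by blast
      have "hbar (proj d) (proj (b j)) = (if i = j then \<one>\<^bsub>A Quot I\<^esub> else \<zero>\<^bsub>A Quot I\<^esub>)" if j: "j < n" for j
        unfolding hbar_proj[OF d(1) b_closed[OF j]] d(2)[OF b_closed[OF j]] coords_basis[OF True j] by (simp add: Q_one Q_zero)
      then show ?thesis using proj_closed[OF d(1)] by blast
    qed simp
  qed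
  from choice[OF this] show ?thesis by blast
qed

end

section \<open>The ring of integers of a ramified quadratic extension\<close>

context ramified_quadratic_extension
begin

abbreviation "K' \<equiv> F\<lparr>carrier := K\<rparr>"
abbreviation "Oring \<equiv> val_ring K' v"
abbreviation "k \<equiv> residue_field K' v"

definition "integers = {x \<in> K. x = \<zero> \<or> v x \<ge> 0}"
definition "prime_ideal = {x \<in> K. x = \<zero> \<or> v x > 0}"

interpretation LF: nonarch_local_field K' v by (rule local_field)

lemmas K_closed = subringE[OF subfieldE(1)[OF subfield]]

lemma K_carrier: "x \<in> K \<Longrightarrow> x \<in> carrier F" using K_closed(1) by blast

lemma K_inv: "x \<in> K \<Longrightarrow> x \<noteq> \<zero> \<Longrightarrow> inv x \<in> K \<and> inv x \<noteq> \<zero> \<and> x \<otimes> inv x = \<one>"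
  using subfield_m_inv[OF subfield, of x] by auto

lemma v_mult: "x \<in> K \<Longrightarrow> x \<noteq> \<zero> \<Longrightarrow> y \<in> K \<Longrightarrow> y \<noteq> \<zero> \<Longrightarrow> v (x \<otimes> y) = v x + v y"
  using LF.v_mult[of x y] by simp

lemma v_add: "x \<in> K \<Longrightarrow> x \<noteq> \<zero> \<Longrightarrow> y \<in> K \<Longrightarrow> y \<noteq> \<zero> \<Longrightarrow> x \<oplus> y \<noteq> \<zero> \<Longrightarrow> v (x \<oplus> y) \<ge> min (v x) (v y)"
  using LF.v_add[of x y] by simp

lemma v_one: "v \<one> = 0"
  using v_mult[of \<one> \<one>] K_closed(3) by simp

lemma v_minus: assumes x: "x \<in> K" "x \<noteq> \<zero>" shows "v (\<ominus> x) = v x"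
proof -
  have mx: "\<ominus> x \<in> K" "\<ominus> x \<noteq> \<zero>" using x K_closed(5) K_carrier[OF x(1)] add.inv_eq_1_iff[of x] by auto
  have "v (\<ominus> x \<otimes> \<ominus> x) = v (x \<otimes> x)" using K_carrier[OF x(1)] by (simp add: l_minus r_minus)
  then show ?thesis using v_mult[OF x x] v_mult[OF mx mx] by simp
qed

lemma v_inv: assumes x: "x \<in> K" "x \<noteq> \<zero>" shows "v (inv x) = - v x"
  using v_mult[OF x, of "inv x"] K_inv[OF x] v_one by simp

lemma integers_subring: "subring integers F"
proof (rule subringI)
  show "integers \<subseteq> carrier F" using K_carrier by (auto simp: integers_def)
  show "\<one> \<in> integers" using v_one K_closed(3) by (simp add: integers_def)
  show "\<ominus> x \<in> integers" if "x \<in> integers" for x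
    using that v_minus[of x] K_closed(5) by (cases "x = \<zero>") (auto simp: integers_def)
  show "x \<otimes> y \<in> integers" if "x \<in> integers" "y \<in> integers" for x y
  proof (cases "x = \<zero> \<or> y = \<zero>")
    case True then show ?thesis using that K_carrier K_closed(2) by (auto simp: integers_def)
  next
    case False then show ?thesis using that v_mult[of x y] K_closed(6) by (simp add: integers_def)
  qed
  show "x \<oplus> y \<in> integers" if xy: "x \<in> integers" "y \<in> integers" for x y
  proof (cases "x = \<zero> \<or> y = \<zero> \<or> x \<oplus> y = \<zero>")
    case True
    then consider "x \<oplus> y = \<zero>" | "x = \<zero>" | "y = \<zero>" by blast
    then show ?thesis
    proof cases
      case 1 then show ?thesis using K_closed(2) by (simp add: integers_def)
    next
      case 2 then show ?thesis using xy K_carrier[of y] by (simp add: integers_def)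
    next
      case 3 then show ?thesis using xy K_carrier[of x] by (simp add: integers_def)
    qed
  next
    case False
    then have nz: "x \<noteq> \<zero>" "y \<noteq> \<zero>" "x \<oplus> y \<noteq> \<zero>" by blast+
    have d: "x \<in> K" "y \<in> K" "v x \<ge> 0" "v y \<ge> 0" using xy nz by (simp_all add: integers_def)
    have "v (x \<oplus> y) \<ge> min (v x) (v y)" by (rule v_add[OF d(1) nz(1) d(2) nz(2,3)])
    then have "v (x \<oplus> y) \<ge> 0" using d(3,4) by linarith
    then show ?thesis using K_closed(7)[OF d(1,2)] by (simp add: integers_def)
  qed
qed

lemmas int_closed = subringE[OF integers_subring]

lemma int_carrier: "x \<in> integers \<Longrightarrow> x \<in> carrier F" using int_closed(1) by blast

lemma Oring_eq: "Oring = F\<lparr>carrier := integers\<rparr>"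
  by (simp add: val_ring_def integers_def)

lemma Oring_carrier: "carrier Oring = integers"
  unfolding Oring_eq by simp

lemma Oring_cring: "cring Oring"
  unfolding Oring_eq using subcringI'[OF integers_subring] subcring_iff[OF int_closed(1)] by simp

lemma prime_ideal_eq: "val_ideal K' v = prime_ideal"
  by (simp add: val_ideal_def prime_ideal_def)

lemma prime_sub: "x \<in> prime_ideal \<Longrightarrow> x \<in> integers"
  by (auto simp: prime_ideal_def integers_def)

lemma prime_absorb:
  assumes x: "x \<in> prime_ideal" and y: "y \<in> integers" shows "x \<otimes> y \<in> prime_ideal"
proof (cases "x = \<zero> \<or> y = \<zero>")
  case True
  then show ?thesis using x y K_carrier K_closed(2) by (auto simp: prime_ideal_def integers_def)
next
  case False
  then show ?thesis using x y v_mult[of x y] K_closed(6) by (simp add: prime_ideal_def integers_def)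
qed

lemma prime_add:
  assumes x: "x \<in> prime_ideal" and y: "y \<in> prime_ideal" shows "x \<oplus> y \<in> prime_ideal"
proof (cases "x = \<zero> \<or> y = \<zero> \<or> x \<oplus> y = \<zero>")
  case True
  then consider "x \<oplus> y = \<zero>" | "x = \<zero>" | "y = \<zero>" by blast
  then show ?thesis
  proof cases
    case 1 then show ?thesis using K_closed(2) by (simp add: prime_ideal_def)
  next
    case 2 then show ?thesis using y K_carrier[of y] by (simp add: prime_ideal_def)
  next
    case 3 then show ?thesis using x K_carrier[of x] by (simp add: prime_ideal_def)
  qed
next
  case False
  then have nz: "x \<noteq> \<zero>" "y \<noteq> \<zero>" "x \<oplus> y \<noteq> \<zero>" by blast+
  have d: "x \<in> K" "y \<in> K" "v x > 0" "v y > 0" using x y nz by (simp_all add: prime_ideal_def)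
  have "v (x \<oplus> y) \<ge> min (v x) (v y)" by (rule v_add[OF d(1) nz(1) d(2) nz(2,3)])
  then have "v (x \<oplus> y) > 0" using d(3,4) by linarith
  then show ?thesis using K_closed(7)[OF d(1,2)] by (simp add: prime_ideal_def)
qed

lemma prime_minus: "x \<in> prime_ideal \<Longrightarrow> \<ominus> x \<in> prime_ideal"
  using v_minus[of x] K_closed(5) by (cases "x = \<zero>") (auto simp: prime_ideal_def)

lemma prime_ideal_ideal: "ideal prime_ideal Oring"
proof (rule idealI)
  interpret Or: cring Oring by (rule Oring_cring)
  show "ring Oring" by (rule Or.ring_axioms)
  show "subgroup prime_ideal (add_monoid Oring)"
  proof (rule group.subgroupI[OF Or.a_group])
    show "prime_ideal \<subseteq> carrier (add_monoid Oring)" using prime_sub by (auto simp: Oring_carrier)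
    have "\<zero> \<in> prime_ideal" using K_closed(2) by (simp add: prime_ideal_def)
    then show "prime_ideal \<noteq> {}" by blast
    fix x assume x: "x \<in> prime_ideal"
    have xi: "x \<in> integers" "\<ominus> x \<in> integers" "x \<in> carrier F" using prime_sub[OF x] int_closed(5) int_carrier by auto
    have "\<ominus>\<^bsub>Oring\<^esub> x = \<ominus> x"
      by (rule Or.minus_equality) (use xi in \<open>simp_all add: Oring_eq l_neg\<close>)
    then show "inv\<^bsub>add_monoid Oring\<^esub> x \<in> prime_ideal" using prime_minus[OF x] by (simp add: a_inv_def)
    fix y assume "y \<in> prime_ideal"
    then show "x \<otimes>\<^bsub>add_monoid Oring\<^esub> y \<in> prime_ideal" using prime_add[OF x] by (simp add: Oring_eq)
  qed
  fix a x assume a: "a \<in> prime_ideal" and x: "x \<in> carrier Oring"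
  then show "a \<otimes>\<^bsub>Oring\<^esub> x \<in> prime_ideal" using prime_absorb by (simp add: Oring_eq)
  moreover have "x \<otimes>\<^bsub>Oring\<^esub> a = a \<otimes>\<^bsub>Oring\<^esub> x"
    using a x prime_sub by (intro Or.m_comm) (auto simp: Oring_carrier)
  ultimately show "x \<otimes>\<^bsub>Oring\<^esub> a \<in> prime_ideal" by simp
qed

lemma integer_unit:
  assumes "x \<in> integers" "x \<notin> prime_ideal"
  shows "x \<noteq> \<zero>" "v x = 0" "inv x \<in> integers" "x \<otimes> inv x = \<one>"
proof -
  show x: "x \<noteq> \<zero>" and vx: "v x = 0" using assms by (auto simp: integers_def prime_ideal_def)
  have "x \<in> K" using assms by (simp add: integers_def)
  then show "inv x \<in> integers" "x \<otimes> inv x = \<one>" using K_inv[of x] v_inv[of x] x vx by (auto simp: integers_def)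
qed

lemma residue_field_eq: "k = Oring Quot prime_ideal"
  by (simp add: residue_field_def prime_ideal_eq)

lemma prime_ideal_maximal: "maximalideal prime_ideal Oring"
proof (rule maximalidealI[OF prime_ideal_ideal])
  have "\<one> \<in> integers" "\<one> \<notin> prime_ideal" using int_closed(3) v_one by (auto simp: prime_ideal_def)
  then show "carrier Oring \<noteq> prime_ideal" unfolding Oring_carrier by blast
  fix J assume J: "ideal J Oring" "prime_ideal \<subseteq> J" "J \<subseteq> carrier Oring"
  show "J = prime_ideal \<or> J = carrier Oring"
  proof (rule disjCI)
    assume "J \<noteq> carrier Oring"
    have "x \<in> prime_ideal" if x: "x \<in> J" for x
    proof (rule ccontr)
      assume n: "x \<notin> prime_ideal"
      have xi: "x \<in> integers" using x J(3) by (auto simp: Oring_carrier)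
      note U = integer_unit[OF xi n]
      have "x \<otimes>\<^bsub>Oring\<^esub> inv x \<in> J" by (rule ideal.I_r_closed[OF J(1) x]) (use U in \<open>simp add: Oring_carrier\<close>)
      then have "\<one>\<^bsub>Oring\<^esub> \<in> J" using U by (simp add: Oring_eq)
      then show False using ideal.one_imp_carrier[OF J(1)] \<open>J \<noteq> carrier Oring\<close> by simp
    qed
    then show "J = prime_ideal" using J(2) by blast
  qed
qed

lemma residue_is_field: "field k"
  unfolding residue_field_eq by (rule maximalideal.quotient_is_field[OF prime_ideal_maximal Oring_cring])

lemma residue_odd_field: "finite_odd_field k"
proof -
  interpret k: field k by (rule residue_is_field)
  have odd_le_two: "\<And>n::nat. n \<le> 2 \<Longrightarrow> odd n \<Longrightarrow> n = 1" by presburger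
  have "\<one>\<^bsub>k\<^esub> \<oplus>\<^bsub>k\<^esub> \<one>\<^bsub>k\<^esub> \<noteq> \<zero>\<^bsub>k\<^esub>"
  proof
    assume z: "\<one>\<^bsub>k\<^esub> \<oplus>\<^bsub>k\<^esub> \<one>\<^bsub>k\<^esub> = \<zero>\<^bsub>k\<^esub>"
    have c: "\<one>\<^bsub>k\<^esub> \<in> carrier (add_monoid k)" by simp
    have "\<one>\<^bsub>k\<^esub> [^]\<^bsub>add_monoid k\<^esub> (2::nat) = \<one>\<^bsub>add_monoid k\<^esub>"
      using z by (simp add: numeral_2_eq_2)
    then have "group.ord (add_monoid k) \<one>\<^bsub>k\<^esub> dvd 2" using group.pow_eq_id[OF k.a_group c, of 2] by (simp only:)
    then have "group.ord (add_monoid k) \<one>\<^bsub>k\<^esub> \<le> 2" by (rule dvd_imp_le) simp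
    moreover have "odd (group.ord (add_monoid k) \<one>\<^bsub>k\<^esub>)" by (rule odd_residue_char)
    ultimately have "group.ord (add_monoid k) \<one>\<^bsub>k\<^esub> = 1"
      using odd_le_two by blast
    then have "\<one>\<^bsub>k\<^esub> = \<one>\<^bsub>add_monoid k\<^esub>" using group.ord_eq_1[OF k.a_group c] by (simp only:)
    then show False by simp
  qed
  then show ?thesis using residue_is_field LF.finite_residue_field
    by (intro finite_odd_field.intro finite_odd_field_axioms.intro)
qed

text \<open>
  Only the valuation needs an argument. Let \<open>x\<close> have valuation \<open>1\<close> and put \<open>y = \<pi> / x\<close>, an integer since \<open>\<pi>\<close> is
  not a unit. The prime \<open>\<pi>\<close> divides \<open>x y\<close>, but it cannot divide \<open>y\<close>, whose valuation is smaller; so it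
  divides \<open>x\<close>, and its valuation is at most \<open>1\<close>.
\<close>

lemma \<pi>_props: "\<pi> \<in> integers" "\<pi> \<in> K" "\<pi> \<noteq> \<zero>" "v \<pi> = 1" "\<pi> \<in> prime_ideal"
proof -
  show pi: "\<pi> \<in> integers" using \<pi>_closed by (simp add: Oring_carrier)
  then show piK: "\<pi> \<in> K" by (simp add: integers_def)
  have prm: "\<pi> \<noteq> \<zero>" "prime Oring \<pi>" using \<pi>_prime by (auto simp: ring_prime_def Oring_eq)
  then show nz: "\<pi> \<noteq> \<zero>" by simp
  have nU: "\<pi> \<notin> Units Oring" and div: "\<And>a b. a \<in> integers \<Longrightarrow> b \<in> integers \<Longrightarrow>
      \<pi> divides\<^bsub>Oring\<^esub> (a \<otimes> b) \<Longrightarrow> \<pi> divides\<^bsub>Oring\<^esub> a \<or> \<pi> divides\<^bsub>Oring\<^esub> b"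
    using prm(2) unfolding prime_def Oring_carrier by (simp_all add: Oring_eq)
  show pp: "\<pi> \<in> prime_ideal"
  proof (rule ccontr)
    assume "\<pi> \<notin> prime_ideal"
    note U = integer_unit[OF pi this]
    have "inv \<pi> \<otimes> \<pi> = \<one>" using U(3,4) m_comm int_carrier pi by simp
    then have "\<pi> \<in> Units Oring" using U pi unfolding Units_def by (auto simp: Oring_eq)
    then show False using nU by simp
  qed
  then have vp: "v \<pi> > 0" using nz by (simp add: prime_ideal_def)
  have "1 \<in> v ` (carrier K' - {\<zero>\<^bsub>K'\<^esub>})" unfolding LF.v_surj by simp
  then obtain x where x': "1 = v x" "x \<in> carrier K' - {\<zero>\<^bsub>K'\<^esub>}" by (rule imageE)
  then have x: "x \<in> K" "x \<noteq> \<zero>" "v x = 1" by simp_all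
  define y where "y = \<pi> \<otimes> inv x"
  note xi = K_inv[OF x(1,2)]
  have y: "y \<in> K" "y \<noteq> \<zero>" "v y = v \<pi> - 1"
    using piK nz xi K_closed(6) K_carrier v_mult[of \<pi> "inv x"] v_inv[OF x(1,2)] x(3)
    by (auto simp: y_def integral_iff)
  have int: "x \<in> integers" "y \<in> integers" using x y vp by (auto simp: integers_def)
  have "x \<otimes> y = \<pi> \<otimes> (x \<otimes> inv x)" using x(1) xi piK K_carrier by (simp add: y_def m_lcomm)
  then have "x \<otimes> y = \<pi> \<otimes>\<^bsub>Oring\<^esub> \<one>" using xi piK K_carrier by (simp add: Oring_eq)
  then have "\<pi> divides\<^bsub>Oring\<^esub> (x \<otimes> y)" unfolding factor_def Oring_carrier using int_closed(3) by blast
  from div[OF int this] show "v \<pi> = 1"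
  proof
    assume "\<pi> divides\<^bsub>Oring\<^esub> x"
    then obtain c where c: "c \<in> integers" "x = \<pi> \<otimes> c" by (auto simp: factor_def Oring_eq)
    then have "c \<noteq> \<zero>" using x piK K_carrier by auto
    then have "1 = v \<pi> + v c" "v c \<ge> 0" using x(3) c piK nz v_mult[of \<pi> c] by (auto simp: integers_def)
    then show ?thesis using vp by simp
  next
    assume "\<pi> divides\<^bsub>Oring\<^esub> y"
    then obtain c where c: "c \<in> integers" "y = \<pi> \<otimes> c" by (auto simp: factor_def Oring_eq)
    then have "c \<noteq> \<zero>" using y(2) piK K_carrier by auto
    then have "v \<pi> - 1 = v \<pi> + v c" "v c \<ge> 0" using y(3) c piK nz v_mult[of \<pi> c] by (auto simp: integers_def)
    then show ?thesis by simp
  qed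
qed

definition "order_set = {a \<oplus> b \<otimes> \<rho> | a b. a \<in> integers \<and> b \<in> integers}"

lemma \<rho>_sq: "\<rho> \<otimes> \<rho> = \<pi>"
  using \<rho>_square \<rho>_closed by (simp add: numeral_2_eq_2)

lemma order_mult:
  assumes "a \<in> integers" "b \<in> integers" "c \<in> integers" "d \<in> integers"
  shows "(a \<oplus> b \<otimes> \<rho>) \<otimes> (c \<oplus> d \<otimes> \<rho>) = (a \<otimes> c \<oplus> \<pi> \<otimes> (b \<otimes> d)) \<oplus> (a \<otimes> d \<oplus> b \<otimes> c) \<otimes> \<rho>"
proof -
  note c = assms[THEN int_carrier]
  have "(a \<oplus> b \<otimes> \<rho>) \<otimes> (c \<oplus> d \<otimes> \<rho>) = (a \<otimes> c \<oplus> (\<rho> \<otimes> \<rho>) \<otimes> (b \<otimes> d)) \<oplus> (a \<otimes> d \<oplus> b \<otimes> c) \<otimes> \<rho>"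
    using c \<rho>_closed by algebra
  then show ?thesis by (simp only: \<rho>_sq)
qed

lemma order_subring: "subring order_set F"
proof (rule subringI)
  show "order_set \<subseteq> carrier F" using int_carrier \<rho>_closed by (auto simp: order_set_def)
  have "\<one> = \<one> \<oplus> \<zero> \<otimes> \<rho>" using \<rho>_closed by simp
  then show "\<one> \<in> order_set" using int_closed(2,3) unfolding order_set_def by blast
  fix x assume "x \<in> order_set"
  then obtain a b where x: "a \<in> integers" "b \<in> integers" "x = a \<oplus> b \<otimes> \<rho>" unfolding order_set_def by blast
  have "\<ominus> x = \<ominus> a \<oplus> (\<ominus> b) \<otimes> \<rho>" using x int_carrier \<rho>_closed by (simp add: minus_add l_minus)
  then show "\<ominus> x \<in> order_set" using int_closed(5) x(1,2) unfolding order_set_def by blast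
  fix y assume "y \<in> order_set"
  then obtain c d where y: "c \<in> integers" "d \<in> integers" "y = c \<oplus> d \<otimes> \<rho>" unfolding order_set_def by blast
  have "x \<otimes> y = (a \<otimes> c \<oplus> \<pi> \<otimes> (b \<otimes> d)) \<oplus> (a \<otimes> d \<oplus> b \<otimes> c) \<otimes> \<rho>"
    unfolding x(3) y(3) by (rule order_mult[OF x(1,2) y(1,2)])
  moreover have "a \<otimes> c \<oplus> \<pi> \<otimes> (b \<otimes> d) \<in> integers" "a \<otimes> d \<oplus> b \<otimes> c \<in> integers"
    using x y \<pi>_props(1) int_closed(6,7) by auto
  ultimately show "x \<otimes> y \<in> order_set" unfolding order_set_def by blast
  have "x \<oplus> y = (a \<oplus> c) \<oplus> (b \<oplus> d) \<otimes> \<rho>"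
    unfolding x(3) y(3)
    using int_carrier[OF x(1)] int_carrier[OF x(2)] int_carrier[OF y(1)] int_carrier[OF y(2)] \<rho>_closed by algebra
  then show "x \<oplus> y \<in> order_set"
    using int_closed(7)[OF x(1) y(1)] int_closed(7)[OF x(2) y(2)] unfolding order_set_def by blast
qed

lemma order_eq: "ext_integers F K v \<rho> = F\<lparr>carrier := order_set\<rparr>"
proof -
  have "simple_extension integers \<rho> = order_set"
  proof
    show "simple_extension integers \<rho> \<subseteq> order_set"
    proof (rule simple_extension_subring_incl[OF order_subring])
      show "integers \<subseteq> order_set"
      proof
        fix a assume a: "a \<in> integers"
        then have "a = a \<oplus> \<zero> \<otimes> \<rho>" using int_carrier \<rho>_closed by simp
        then show "a \<in> order_set" using a int_closed(2) unfolding order_set_def by blast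
      qed
      have "\<rho> = \<zero> \<oplus> \<one> \<otimes> \<rho>" using \<rho>_closed by simp
      then show "\<rho> \<in> order_set" using int_closed(2,3) unfolding order_set_def by blast
    qed
    show "order_set \<subseteq> simple_extension integers \<rho>"
    proof
      fix x assume "x \<in> order_set"
      then obtain a b where x: "a \<in> integers" "b \<in> integers" "x = a \<oplus> b \<otimes> \<rho>" unfolding order_set_def by blast
      have "b \<in> simple_extension integers \<rho>"
        using simple_extension_incl[OF int_closed(1) \<rho>_closed] x(2) by blast
      then have "b \<otimes> \<rho> \<oplus> a \<in> simple_extension integers \<rho>" using x(1) by (rule simple_extension.lin)
      then show "x \<in> simple_extension integers \<rho>" using x int_carrier \<rho>_closed by (simp add: a_comm)
    qed
  qed
  then show ?thesis unfolding ext_integers_def Oring_carrier by simp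
qed

abbreviation "\<R> \<equiv> F\<lparr>carrier := order_set\<rparr>"

lemma \<R>_cring: "cring \<R>"
  using subcringI'[OF order_subring] subcring_iff[OF subringE(1)[OF order_subring]] by simp

text \<open>
  Otherwise \<open>a\<^sup>2 = \<pi> b\<^sup>2\<close>, where the left side has even and the right side odd valuation. This makes the first
  coordinate of an element of the order well defined.
\<close>

lemma order_zero:
  assumes a: "a \<in> integers" and b: "b \<in> integers" and z: "a \<oplus> b \<otimes> \<rho> = \<zero>"
  shows "a = \<zero>"
proof (rule ccontr)
  assume na: "a \<noteq> \<zero>"
  have c: "a \<in> carrier F" "b \<in> carrier F" using a b int_carrier by auto
  have e: "a = \<ominus> (b \<otimes> \<rho>)" 
    by (rule minus_equality[symmetric]) (use z c \<rho>_closed in auto)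
  have "a \<otimes> a = (b \<otimes> \<rho>) \<otimes> (b \<otimes> \<rho>)" unfolding e using c \<rho>_closed by (simp add: l_minus r_minus)
  also have "\<dots> = \<pi> \<otimes> (b \<otimes> b)" using c \<rho>_closed by (simp add: m_ac flip: \<rho>_sq)
  finally have eq: "a \<otimes> a = \<pi> \<otimes> (b \<otimes> b)" .
  have nb: "b \<noteq> \<zero>"
  proof
    assume "b = \<zero>" then show False using e na \<rho>_closed by simp
  qed
  have K: "a \<in> K" "b \<in> K" using a b by (auto simp: integers_def)
  have bb: "b \<otimes> b \<in> K" "b \<otimes> b \<noteq> \<zero>" using K nb K_closed(6) c by (auto simp: integral_iff)
  have "2 * v a = 1 + 2 * v b"
    using eq v_mult[OF K(1) na K(1) na] v_mult[OF K(2) nb K(2) nb] v_mult[OF \<pi>_props(2,3) bb] \<pi>_props(4) by simp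
  then show False by presburger
qed

definition rational_part :: "'a \<Rightarrow> 'a" where
  "rational_part x = (SOME a. a \<in> integers \<and> (\<exists>b\<in>integers. x = a \<oplus> b \<otimes> \<rho>))"

lemma rational_part_eq:
  assumes a: "a \<in> integers" and b: "b \<in> integers"
  shows "rational_part (a \<oplus> b \<otimes> \<rho>) = a"
proof -
  let ?P = "\<lambda>c. c \<in> integers \<and> (\<exists>e\<in>integers. a \<oplus> b \<otimes> \<rho> = c \<oplus> e \<otimes> \<rho>)"
  have "?P a" using a b by blast
  then have "?P (rational_part (a \<oplus> b \<otimes> \<rho>))" unfolding rational_part_def by (rule someI)
  then obtain c e where c: "rational_part (a \<oplus> b \<otimes> \<rho>) = c" "c \<in> integers" "e \<in> integers" "a \<oplus> b \<otimes> \<rho> = c \<oplus> e \<otimes> \<rho>" by blast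
  have cc: "a \<in> carrier F" "b \<in> carrier F" "c \<in> carrier F" "e \<in> carrier F" using a b c int_carrier by auto
  have "(a \<ominus> c) \<oplus> (b \<ominus> e) \<otimes> \<rho> = (a \<oplus> b \<otimes> \<rho>) \<ominus> (c \<oplus> e \<otimes> \<rho>)" using cc \<rho>_closed by algebra
  also have "\<dots> = \<zero>" unfolding c(4) using cc \<rho>_closed by (simp add: minus_eq r_neg)
  finally have "a \<ominus> c = \<zero>"
    using order_zero[of "a \<ominus> c" "b \<ominus> e"] a b c int_closed(5,7) by (simp add: minus_eq)
  then show ?thesis using c(1) cc by (simp add: r_right_minus_eq)
qed

text \<open>
  The residue field of the order is that of the base, because \<open>\<rho>\<close> has residue \<open>0\<close>.
\<close>

definition residue :: "'a \<Rightarrow> 'a set" where "residue x = prime_ideal +>\<^bsub>Oring\<^esub> rational_part x"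

lemma coset_eq: "a \<in> integers \<Longrightarrow> c \<in> integers \<Longrightarrow> a \<ominus> c \<in> prime_ideal \<Longrightarrow>
    prime_ideal +>\<^bsub>Oring\<^esub> a = prime_ideal +>\<^bsub>Oring\<^esub> c"
proof -
  assume a: "a \<in> integers" and c: "c \<in> integers" and d: "a \<ominus> c \<in> prime_ideal"
  interpret Or: cring Oring by (rule Oring_cring)
  have ci: "\<ominus> c \<in> integers" "c \<in> carrier F" using c int_closed(5) int_carrier by auto
  have "\<ominus>\<^bsub>Oring\<^esub> c = \<ominus> c"
    by (rule Or.minus_equality) (use c ci in \<open>simp_all add: Oring_eq l_neg\<close>)
  then have "a \<ominus>\<^bsub>Oring\<^esub> c = a \<ominus> c" by (simp add: Or.minus_eq minus_eq) (simp add: Oring_eq)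
  then show ?thesis
    using Or.quotient_eq_iff_same_a_r_cos[OF prime_ideal_ideal, of a c] a c d by (simp add: Oring_carrier)
qed

lemma residue_zero_iff:
  assumes a: "a \<in> integers"
  shows "prime_ideal +>\<^bsub>Oring\<^esub> a = \<zero>\<^bsub>k\<^esub> \<longleftrightarrow> a \<in> prime_ideal"
proof -
  interpret P: ideal prime_ideal Oring by (rule prime_ideal_ideal)
  have z: "\<zero>\<^bsub>k\<^esub> = prime_ideal" unfolding residue_field_eq by (simp add: FactRing_def)
  show ?thesis unfolding z
  proof
    assume "prime_ideal +>\<^bsub>Oring\<^esub> a = prime_ideal"
    moreover have "a \<in> prime_ideal +>\<^bsub>Oring\<^esub> a" by (rule P.a_rcos_self) (use a in \<open>simp add: Oring_carrier\<close>)
    ultimately show "a \<in> prime_ideal" by simp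
  next
    assume "a \<in> prime_ideal" then show "prime_ideal +>\<^bsub>Oring\<^esub> a = prime_ideal" by (rule P.a_rcos_const)
  qed
qed

lemma order_rep: "x \<in> order_set \<Longrightarrow> \<exists>a b. a \<in> integers \<and> b \<in> integers \<and> x = a \<oplus> b \<otimes> \<rho>"
  unfolding order_set_def by blast

lemma order_mem: "a \<in> integers \<Longrightarrow> b \<in> integers \<Longrightarrow> a \<oplus> b \<otimes> \<rho> \<in> order_set"
  unfolding order_set_def by blast

lemma residue_order_eq: "a \<in> integers \<Longrightarrow> b \<in> integers \<Longrightarrow> residue (a \<oplus> b \<otimes> \<rho>) = prime_ideal +>\<^bsub>Oring\<^esub> a"
  unfolding residue_def by (simp only: rational_part_eq)

lemma pi_mult_prime: "b \<in> integers \<Longrightarrow> \<pi> \<otimes> b \<in> prime_ideal"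
  by (rule prime_absorb[OF \<pi>_props(5)])

lemma \<pi>_div: assumes a: "a \<in> prime_ideal" shows "\<exists>b\<in>integers. a = \<pi> \<otimes> b"
proof (cases "a = \<zero>")
  case True
  have "a = \<pi> \<otimes> \<zero>" using True int_carrier[OF \<pi>_props(1)] by simp
  then show ?thesis using int_closed(2) by blast
next
  case False
  have aK: "a \<in> K" "v a > 0" using a False by (simp_all add: prime_ideal_def)
  note i = K_inv[OF \<pi>_props(2,3)]
  have "inv \<pi> \<otimes> a \<in> K" using i aK K_closed(6) by blast
  moreover have "v (inv \<pi> \<otimes> a) = - 1 + v a"
    using v_mult[of "inv \<pi>" a] i aK False v_inv[OF \<pi>_props(2,3)] \<pi>_props(4) by simp
  ultimately have "inv \<pi> \<otimes> a \<in> integers" using aK by (simp add: integers_def)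
  moreover have "a = \<pi> \<otimes> (inv \<pi> \<otimes> a)"
    using i aK K_carrier \<pi>_props(2) by (simp flip: m_assoc)
  ultimately show ?thesis by blast
qed

lemma residue_hom: "residue \<in> ring_hom \<R> k"
proof (rule ring_hom_memI)
  interpret P: ideal prime_ideal Oring by (rule prime_ideal_ideal)
  have cl: "prime_ideal +>\<^bsub>Oring\<^esub> a \<in> carrier k" if "a \<in> integers" for a
    using ring_hom_closed[OF P.rcos_ring_hom, of a] that unfolding Oring_carrier residue_field_eq .
  fix x assume "x \<in> carrier \<R>"
  then obtain a b where x: "a \<in> integers" "b \<in> integers" "x = a \<oplus> b \<otimes> \<rho>" using order_rep[of x] by auto
  show "residue x \<in> carrier k" unfolding x(3) residue_order_eq[OF x(1,2)] by (rule cl[OF x(1)])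
  fix y assume "y \<in> carrier \<R>"
  then obtain c d where y: "c \<in> integers" "d \<in> integers" "y = c \<oplus> d \<otimes> \<rho>" using order_rep[of y] by auto
  have i: "a \<otimes> c \<in> integers" "b \<otimes> d \<in> integers" "\<pi> \<otimes> (b \<otimes> d) \<in> integers" "a \<otimes> d \<oplus> b \<otimes> c \<in> integers"
    "a \<otimes> c \<oplus> \<pi> \<otimes> (b \<otimes> d) \<in> integers" "a \<oplus> c \<in> integers" "b \<oplus> d \<in> integers"
    by (intro int_closed(6,7) x(1,2) y(1,2) \<pi>_props(1))+
  have "residue (x \<otimes> y) = prime_ideal +>\<^bsub>Oring\<^esub> (a \<otimes> c \<oplus> \<pi> \<otimes> (b \<otimes> d))"
    unfolding x(3) y(3) order_mult[OF x(1,2) y(1,2)] by (rule residue_order_eq[OF i(5,4)])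
  also have "\<dots> = prime_ideal +>\<^bsub>Oring\<^esub> (a \<otimes> c)"
  proof (rule coset_eq[OF i(5,1)])
    have "(a \<otimes> c \<oplus> \<pi> \<otimes> (b \<otimes> d)) \<ominus> a \<otimes> c = \<pi> \<otimes> (b \<otimes> d)"
      using int_carrier[OF i(1)] int_carrier[OF i(3)] by (simp add: minus_eq a_ac r_neg r_neg1 r_neg2)
    then show "(a \<otimes> c \<oplus> \<pi> \<otimes> (b \<otimes> d)) \<ominus> a \<otimes> c \<in> prime_ideal" using pi_mult_prime[OF i(2)] by simp
  qed
  also have "\<dots> = (prime_ideal +>\<^bsub>Oring\<^esub> a) \<otimes>\<^bsub>k\<^esub> (prime_ideal +>\<^bsub>Oring\<^esub> c)"
    using ring_hom_mult[OF P.rcos_ring_hom, of a c] x(1) y(1) unfolding Oring_carrier residue_field_eq by (simp add: Oring_eq)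
  also have "\<dots> = residue x \<otimes>\<^bsub>k\<^esub> residue y" unfolding x(3) y(3) residue_order_eq[OF x(1,2)] residue_order_eq[OF y(1,2)] ..
  finally show "residue (x \<otimes>\<^bsub>\<R>\<^esub> y) = residue x \<otimes>\<^bsub>k\<^esub> residue y" by simp
  have "x \<oplus> y = (a \<oplus> c) \<oplus> (b \<oplus> d) \<otimes> \<rho>"
    unfolding x(3) y(3)
    using int_carrier[OF x(1)] int_carrier[OF x(2)] int_carrier[OF y(1)] int_carrier[OF y(2)] \<rho>_closed by algebra
  then have "residue (x \<oplus> y) = prime_ideal +>\<^bsub>Oring\<^esub> (a \<oplus> c)" by (simp only: residue_order_eq[OF i(6,7)])
  also have "\<dots> = (prime_ideal +>\<^bsub>Oring\<^esub> a) \<oplus>\<^bsub>k\<^esub> (prime_ideal +>\<^bsub>Oring\<^esub> c)"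
    using ring_hom_add[OF P.rcos_ring_hom, of a c] x(1) y(1) unfolding Oring_carrier residue_field_eq by (simp add: Oring_eq)
  also have "\<dots> = residue x \<oplus>\<^bsub>k\<^esub> residue y" unfolding x(3) y(3) residue_order_eq[OF x(1,2)] residue_order_eq[OF y(1,2)] ..
  finally show "residue (x \<oplus>\<^bsub>\<R>\<^esub> y) = residue x \<oplus>\<^bsub>k\<^esub> residue y" by simp
next
  interpret P: ideal prime_ideal Oring by (rule prime_ideal_ideal)
  have "residue (\<one> \<oplus> \<zero> \<otimes> \<rho>) = prime_ideal +>\<^bsub>Oring\<^esub> \<one>" by (rule residue_order_eq[OF int_closed(3,2)])
  also have "\<dots> = \<one>\<^bsub>k\<^esub>" using ring_hom_one[OF P.rcos_ring_hom] unfolding residue_field_eq by (simp add: Oring_eq)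
  finally show "residue \<one>\<^bsub>\<R>\<^esub> = \<one>\<^bsub>k\<^esub>" using \<rho>_closed by simp
qed

lemma residue_surj: "residue ` carrier \<R> = carrier k"
proof (intro equalityI subsetI)
  fix c assume "c \<in> residue ` carrier \<R>"
  then show "c \<in> carrier k" using ring_hom_closed[OF residue_hom] by blast
next
  fix c assume "c \<in> carrier k"
  then obtain a where a: "a \<in> integers" "c = prime_ideal +>\<^bsub>Oring\<^esub> a"
    unfolding residue_field_eq by (auto simp: FactRing_def A_RCOSETS_def' Oring_carrier)
  have "c = residue (a \<oplus> \<zero> \<otimes> \<rho>)" unfolding a(2) residue_order_eq[OF a(1) int_closed(2)] ..
  moreover have "a \<oplus> \<zero> \<otimes> \<rho> \<in> carrier \<R>" using order_mem[OF a(1) int_closed(2)] by simp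
  ultimately show "c \<in> residue ` carrier \<R>" by (rule image_eqI)
qed

text \<open>
  The norm \<open>n = a\<^sup>2 - \<pi> b\<^sup>2\<close> of \<open>a + b \<rho>\<close> is a unit because \<open>a\<close> is, and the conjugate divided by the norm is an
  inverse.
\<close>

lemma order_unit:
  assumes x: "x \<in> carrier \<R>" and nz: "residue x \<noteq> \<zero>\<^bsub>k\<^esub>"
  shows "x \<in> Units \<R>"
proof -
  obtain a b where ab: "a \<in> integers" "b \<in> integers" "x = a \<oplus> b \<otimes> \<rho>" using order_rep[of x] x by auto
  have c: "a \<in> carrier F" "b \<in> carrier F" "\<pi> \<in> carrier F" using ab int_carrier \<pi>_props(1) by auto
  have an: "a \<notin> prime_ideal" using nz residue_zero_iff[OF ab(1)] unfolding ab(3) residue_order_eq[OF ab(1,2)] by blast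
  define n where "n = a \<otimes> a \<ominus> \<pi> \<otimes> (b \<otimes> b)"
  have bb: "\<pi> \<otimes> (b \<otimes> b) \<in> prime_ideal" by (rule pi_mult_prime[OF int_closed(6)[OF ab(2,2)]])
  have aa: "a \<otimes> a \<in> integers" by (rule int_closed(6)[OF ab(1,1)])
  have ni: "n \<in> integers" unfolding n_def minus_eq
    by (rule int_closed(7)[OF aa int_closed(5)[OF prime_sub[OF bb]]])
  have nn: "n \<notin> prime_ideal"
  proof
    assume "n \<in> prime_ideal"
    then have "n \<oplus> \<pi> \<otimes> (b \<otimes> b) \<in> prime_ideal" using bb by (rule prime_add)
    moreover have "n \<oplus> \<pi> \<otimes> (b \<otimes> b) = a \<otimes> a" using c by (simp add: n_def minus_eq a_assoc l_neg)
    ultimately have aap: "a \<otimes> a \<in> prime_ideal" by simp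
    note U = integer_unit[OF ab(1) an]
    have "(a \<otimes> a) \<otimes> inv a \<in> prime_ideal" by (rule prime_absorb[OF aap U(3)])
    moreover have "(a \<otimes> a) \<otimes> inv a = a" using U c int_carrier by (simp add: m_assoc)
    ultimately show False using an by simp
  qed
  note U = integer_unit[OF ni nn]
  have nc: "n \<in> carrier F" "inv n \<in> carrier F" using ni U int_carrier by auto
  define y where "y = (a \<otimes> inv n) \<oplus> (\<ominus> (b \<otimes> inv n)) \<otimes> \<rho>"
  have y: "y \<in> order_set" unfolding y_def
    by (intro order_mem int_closed(5,6) ab U(3))
  have "x \<otimes> y = (a \<otimes> a \<ominus> (\<rho> \<otimes> \<rho>) \<otimes> (b \<otimes> b)) \<otimes> inv n"
    unfolding y_def ab(3) using c nc(2) \<rho>_closed by algebra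
  also have "\<dots> = n \<otimes> inv n" by (simp only: \<rho>_sq n_def)
  finally have xy: "x \<otimes> y = \<one>" using U by simp
  have xc: "x \<in> carrier F" "y \<in> carrier F" using x y subringE(1)[OF order_subring] by auto
  have yx: "y \<otimes> x = \<one>" using xy m_comm[OF xc] by simp
  show ?thesis unfolding Units_def using x y xy yx by auto
qed

lemma \<rho>_order: "\<rho> \<in> order_set"
proof -
  have "\<zero> \<oplus> \<one> \<otimes> \<rho> \<in> order_set" by (rule order_mem[OF int_closed(2,3)])
  then show ?thesis using \<rho>_closed by simp
qed

lemma integers_order: "a \<in> integers \<Longrightarrow> a \<in> order_set"
proof -
  assume a: "a \<in> integers"
  have "a \<oplus> \<zero> \<otimes> \<rho> \<in> order_set" by (rule order_mem[OF a int_closed(2)])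
  then show ?thesis using \<rho>_closed int_carrier[OF a] by simp
qed

lemma \<sigma>_eq:
  assumes a: "a \<in> integers" and b: "b \<in> integers"
  shows "\<sigma> (a \<oplus> b \<otimes> \<rho>) = a \<oplus> (\<ominus> b) \<otimes> \<rho>"
proof -
  have hom: "\<sigma> \<in> ring_hom \<R> \<R>" using \<sigma>_hom unfolding order_eq .
  have o: "a \<in> carrier \<R>" "b \<in> carrier \<R>" "\<rho> \<in> carrier \<R>" "b \<otimes> \<rho> \<in> carrier \<R>"
    using integers_order[OF a] integers_order[OF b] \<rho>_order subringE(6)[OF order_subring] by simp_all
  have fixd: "\<sigma> c = c" if "c \<in> integers" for c using \<sigma>_fix[of c] that by (simp add: Oring_carrier)
  have "\<sigma> (a \<oplus> b \<otimes> \<rho>) = \<sigma> a \<oplus> \<sigma> (b \<otimes> \<rho>)" using ring_hom_add[OF hom o(1,4)] by simp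
  also have "\<sigma> (b \<otimes> \<rho>) = \<sigma> b \<otimes> \<sigma> \<rho>" using ring_hom_mult[OF hom o(2,3)] by simp
  finally show ?thesis unfolding fixd[OF a] fixd[OF b] \<sigma>_\<rho>
    using int_carrier[OF b] \<rho>_closed by (simp add: r_minus l_minus)
qed

lemma \<R>_local_involution: "local_involution \<R> k residue \<sigma>"
proof (intro local_involution.intro local_involution_axioms.intro)
  show "cring \<R>" by (rule \<R>_cring)
  show "finite_odd_field k" by (rule residue_odd_field)
  show "residue \<in> ring_hom \<R> k" by (rule residue_hom)
  show "residue ` carrier \<R> = carrier k" by (rule residue_surj)
  show "\<sigma> \<in> ring_hom \<R> \<R>" using \<sigma>_hom unfolding order_eq .
  fix x assume x: "x \<in> carrier \<R>"
  then obtain a b where ab: "a \<in> integers" "b \<in> integers" "x = a \<oplus> b \<otimes> \<rho>" using order_rep[of x] by auto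
  have mb: "\<ominus> b \<in> integers" by (rule int_closed(5)[OF ab(2)])
  show "\<sigma> (\<sigma> x) = x" unfolding ab(3) \<sigma>_eq[OF ab(1,2)] \<sigma>_eq[OF ab(1) mb] using int_carrier[OF ab(2)] by simp
  show "residue (\<sigma> x) = residue x" unfolding ab(3) \<sigma>_eq[OF ab(1,2)] residue_order_eq[OF ab(1,2)] residue_order_eq[OF ab(1) mb] ..
  assume "residue x \<noteq> \<zero>\<^bsub>k\<^esub>" then show "x \<in> Units \<R>" by (rule order_unit[OF x])
qed

text \<open>
  If \<open>a = \<pi> c\<close>, then \<open>a + b \<rho> = \<rho> (b + c \<rho>)\<close>.
\<close>

lemma \<R>_nonunits: "local_involution.nonunits \<R> k residue = {\<rho> \<otimes> y | y. y \<in> order_set}"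
proof -
  interpret L: local_involution \<R> k residue \<sigma> by (rule \<R>_local_involution)
  show ?thesis
  proof (intro equalityI subsetI)
    fix x assume "x \<in> L.nonunits"
    then have x: "x \<in> order_set" "residue x = \<zero>\<^bsub>k\<^esub>" by (simp_all add: L.nonunits_def)
    obtain a b where ab: "a \<in> integers" "b \<in> integers" "x = a \<oplus> b \<otimes> \<rho>" using order_rep[OF x(1)] by blast
    have "a \<in> prime_ideal" using x(2) residue_zero_iff[OF ab(1)] unfolding ab(3) residue_order_eq[OF ab(1,2)] by blast
    then obtain c where c: "c \<in> integers" "a = \<pi> \<otimes> c" using \<pi>_div by blast
    have "\<rho> \<otimes> (b \<oplus> c \<otimes> \<rho>) = (\<rho> \<otimes> \<rho>) \<otimes> c \<oplus> b \<otimes> \<rho>"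
      using int_carrier[OF ab(2)] int_carrier[OF c(1)] \<rho>_closed by algebra
    then have "x = \<rho> \<otimes> (b \<oplus> c \<otimes> \<rho>)" unfolding ab(3) c(2) by (simp only: \<rho>_sq)
    then show "x \<in> {\<rho> \<otimes> y | y. y \<in> order_set}" using order_mem[OF ab(2) c(1)] by blast
  next
    fix x assume "x \<in> {\<rho> \<otimes> y | y. y \<in> order_set}"
    then obtain y where y: "y \<in> order_set" "x = \<rho> \<otimes> y" by blast
    obtain c d where cd: "c \<in> integers" "d \<in> integers" "y = c \<oplus> d \<otimes> \<rho>" using order_rep[OF y(1)] by blast
    have "x = (\<rho> \<otimes> \<rho>) \<otimes> d \<oplus> c \<otimes> \<rho>" unfolding y(2) cd(3)
      using int_carrier[OF cd(1)] int_carrier[OF cd(2)] \<rho>_closed by algebra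
    then have e: "x = \<pi> \<otimes> d \<oplus> c \<otimes> \<rho>" by (simp only: \<rho>_sq)
    have pd: "\<pi> \<otimes> d \<in> prime_ideal" by (rule pi_mult_prime[OF cd(2)])
    have "residue x = \<zero>\<^bsub>k\<^esub>" unfolding e residue_order_eq[OF prime_sub[OF pd] cd(1)] using residue_zero_iff[OF prime_sub[OF pd]] pd by blast
    moreover have "x \<in> order_set" unfolding e by (rule order_mem[OF prime_sub[OF pd] cd(1)])
    ultimately show "x \<in> L.nonunits" by (simp add: L.nonunits_def)
  qed
qed

lemma \<R>_uniformized: "uniformized \<R> k residue \<sigma> \<rho>"
proof (intro uniformized.intro uniformized_axioms.intro \<R>_local_involution)
  interpret L: local_involution \<R> k residue \<sigma> by (rule \<R>_local_involution)
  show "\<rho> \<in> carrier \<R>" using \<rho>_order by simp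
  show "L.nonunits = {\<rho> \<otimes>\<^bsub>\<R>\<^esub> y | y. y \<in> carrier \<R>}" unfolding \<R>_nonunits by simp
  have m: "\<ominus> \<rho> \<in> order_set" by (rule subringE(5)[OF order_subring \<rho>_order])
  have "\<ominus>\<^bsub>\<R>\<^esub> \<rho> = \<ominus> \<rho>"
    by (rule L.R.minus_equality) (use m \<rho>_order \<rho>_closed in \<open>simp_all add: l_neg\<close>)
  then show "\<sigma> \<rho> = \<ominus>\<^bsub>\<R>\<^esub> \<rho>" using \<sigma>_\<rho> by simp
qed

lemma \<rho>_pow_nonzero: "\<rho> [^]\<^bsub>\<R>\<^esub> (n::nat) \<noteq> \<zero>\<^bsub>\<R>\<^esub>"
proof (induction n)
  case 0 then show ?case by simp
next
  case (Suc n)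
  interpret R': cring \<R> by (rule \<R>_cring)
  have \<rho>0: "\<rho> \<noteq> \<zero>" using \<rho>_sq \<pi>_props(3) \<rho>_closed by auto
  have "\<rho> [^]\<^bsub>\<R>\<^esub> n \<in> carrier \<R>" using \<rho>_order by (intro R'.nat_pow_closed) simp
  then have "\<rho> [^]\<^bsub>\<R>\<^esub> n \<in> carrier F" using subringE(1)[OF order_subring] by auto
  then have "\<rho> [^]\<^bsub>\<R>\<^esub> n \<otimes> \<rho> \<noteq> \<zero>" using Suc \<rho>0 \<rho>_closed by (simp add: integral_iff)
  then show ?case by simp
qed

lemma \<R>_prime: "PIdl\<^bsub>\<R>\<^esub> \<rho> = local_involution.nonunits \<R> k residue"
proof -
  have "x \<otimes> \<rho> = \<rho> \<otimes> x" if "x \<in> order_set" for x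
    using that subringE(1)[OF order_subring] \<rho>_closed by (intro m_comm) auto
  then have "(\<lambda>x. x \<otimes> \<rho>) ` order_set = (\<lambda>x. \<rho> \<otimes> x) ` order_set" by (rule image_cong[OF refl])
  then show ?thesis unfolding \<R>_nonunits cgenideal_def by (simp add: Setcompr_eq_image)
qed

end

section \<open>The index of the stabilizer\<close>

context local_involution
begin

lemma unit_inverse_fixed:
  assumes x: "x \<in> fixed" and nz: "\<phi> x \<noteq> \<zero>\<^bsub>k\<^esub>"
  shows "x \<in> Units B" "inv x \<in> fixed"
proof -
  have xc: "x \<in> carrier B" "\<tau> x = x" using x by (simp_all add: fixed_def)
  show U: "x \<in> Units B" by (rule \<phi>_unit[OF xc(1) nz])
  have ic: "inv x \<in> carrier B" "\<tau> (inv x) \<in> carrier B" using U by auto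
  have "\<tau> (inv x \<otimes> x) = \<tau> (inv x) \<otimes> x" using \<tau>.hom_mult[OF ic(1) xc(1)] xc(2) by (simp only:)
  then have "\<tau> (inv x) \<otimes> x = \<one>" using U by simp
  then have "x \<otimes> \<tau> (inv x) = x \<otimes> inv x" using R.m_comm[OF xc(1) ic(2)] U by simp
  then have "\<tau> (inv x) = inv x" using R.Units_l_cancel[OF U ic(2,1)] by simp
  then show "inv x \<in> fixed" using ic(1) by (simp add: fixed_def)
qed

lemma fixed_ring_carrier: "carrier (fixed_ring B \<tau>) = fixed"
  by (simp add: fixed_ring_def fixed_def)

text \<open>
  A fixed element with nonzero residue has a fixed inverse, so no proper ideal of the fixed ring contains it.
\<close>

lemma maximal_fixed_nonunit:
  assumes J: "maximalideal J (fixed_ring B \<tau>)" and t: "t \<in> J"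
  shows "t \<in> fixed" "\<phi> t = \<zero>\<^bsub>k\<^esub>"
proof -
  interpret J: maximalideal J "fixed_ring B \<tau>" by (rule J)
  show tf: "t \<in> fixed" using J.Icarr[OF t] fixed_ring_carrier by simp
  show "\<phi> t = \<zero>\<^bsub>k\<^esub>"
  proof (rule ccontr)
    assume nz: "\<phi> t \<noteq> \<zero>\<^bsub>k\<^esub>"
    note U = unit_inverse_fixed[OF tf nz]
    have "t \<otimes>\<^bsub>fixed_ring B \<tau>\<^esub> inv t \<in> J" by (rule J.I_r_closed[OF t]) (simp add: fixed_ring_carrier U)
    then have "\<one>\<^bsub>fixed_ring B \<tau>\<^esub> \<in> J" using U(1) by (simp add: fixed_ring_def)
    then show False using J.one_imp_carrier J.I_notcarr by simp
  qed
qed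

lemma fixed_ring_UnitsD:
  assumes "\<epsilon> \<in> Units (fixed_ring B \<tau>)"
  shows "\<epsilon> \<in> fixed" "\<phi> \<epsilon> \<noteq> \<zero>\<^bsub>k\<^esub>"
proof -
  obtain y where y: "\<epsilon> \<in> fixed" "y \<in> fixed" "y \<otimes> \<epsilon> = \<one>"
    using assms unfolding Units_def fixed_ring_carrier by (auto simp: fixed_ring_def)
  show "\<epsilon> \<in> fixed" by (rule y(1))
  have c: "\<epsilon> \<in> carrier B" "y \<in> carrier B" using y fixed_closed(1) by auto
  have "\<phi> y \<otimes>\<^bsub>k\<^esub> \<phi> \<epsilon> = \<one>\<^bsub>k\<^esub>" using c y(3) by (simp flip: \<phi>.hom_mult)
  then show "\<phi> \<epsilon> \<noteq> \<zero>\<^bsub>k\<^esub>" using c by auto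
qed

end

text \<open>
  A square root of the residue would lift to a fixed square root by \<open>fixed_square_lift\<close>.
\<close>

lemma (in finite_local_involution) nonsquare_residue:
  assumes \<epsilon>: "\<epsilon> \<in> Units (fixed_ring B \<tau>)"
    and ns: "\<not> (\<exists>x\<in>Units (fixed_ring B \<tau>). \<epsilon> = x \<otimes>\<^bsub>fixed_ring B \<tau>\<^esub> x)"
  shows "\<not> (\<exists>y\<in>carrier k. \<phi> \<epsilon> = y \<otimes>\<^bsub>k\<^esub> y)"
proof
  assume "\<exists>y\<in>carrier k. \<phi> \<epsilon> = y \<otimes>\<^bsub>k\<^esub> y"
  then obtain y where y: "y \<in> carrier k" "\<phi> \<epsilon> = y \<otimes>\<^bsub>k\<^esub> y" by blast
  note e = fixed_ring_UnitsD[OF \<epsilon>]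
  have y0: "y \<noteq> \<zero>\<^bsub>k\<^esub>" using e(2) y by auto
  obtain x where x: "x \<in> fixed" "\<phi> x = y" "\<epsilon> = x \<otimes> x" using fixed_square_lift[OF e(1) y(1) y0 y(2)] by blast
  have nz: "\<phi> x \<noteq> \<zero>\<^bsub>k\<^esub>" using x(2) y0 by simp
  note U = unit_inverse_fixed[OF x(1) nz]
  have "x \<in> Units (fixed_ring B \<tau>)"
    unfolding Units_def fixed_ring_carrier using x(1) U(2) R.Units_l_inv[OF U(1)] R.Units_r_inv[OF U(1)]
    by (auto simp: fixed_ring_def)
  then show False using ns x(3) by (auto simp: fixed_ring_def)
qed

context hermitian_space
begin

text \<open>
  Otherwise all coordinates of \<open>u\<close> are nonunits, and \<open>u\<close> is annihilated by the nonzero scalar \<open>z\<close>, which is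
  impossible for a member of a basis. This covers bases of any length.
\<close>

lemma primitive_unimodular:
  assumes u: "primitive_vector B M u" and z: "z \<in> carrier B" "z \<noteq> \<zero>"
    and ann: "\<And>x. x \<in> nonunits \<Longrightarrow> z \<otimes> x = \<zero>"
  shows "u \<in> carrier M" "unimodular u"
proof -
  obtain n b j where b: "module_basis B M n b" and j: "j < n" "u = b j"
    using u unfolding primitive_vector_def by blast
  have bc: "\<And>i. i < n \<Longrightarrow> b i \<in> carrier M" using b by (simp add: module_basis_def)
  show uc: "u \<in> carrier M" using bc[OF j(1)] j(2) by simp
  show "unimodular u"
  proof (rule ccontr)
    assume nu: "\<not> unimodular u"
    have c: "h (d i) u \<in> carrier B" "h (d i) u \<in> nonunits" if "i < m" for i
      using unimodular_iff[OF uc] nu that dual_closed uc by (auto simp: nonunits_def)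
    have "z \<odot>\<^bsub>M\<^esub> u = z \<odot>\<^bsub>M\<^esub> lin e m (\<lambda>i. h (d i) u)" using eq_lin_dual[OF uc] by simp
    also have "\<dots> = (\<Oplus>\<^bsub>M\<^esub> i\<in>{..<m}. z \<odot>\<^bsub>M\<^esub> (h (d i) u \<odot>\<^bsub>M\<^esub> e i))"
      by (rule finsum_smult_ldistr) (use z c basis_closed in auto)
    also have "\<dots> = (\<Oplus>\<^bsub>M\<^esub> i\<in>{..<m}. \<zero>\<^bsub>M\<^esub>)"
    proof (rule M.finsum_cong'[OF refl])
      fix i assume "i \<in> {..<m}"
      then have i: "i < m" by simp
      have "z \<odot>\<^bsub>M\<^esub> (h (d i) u \<odot>\<^bsub>M\<^esub> e i) = (z \<otimes> h (d i) u) \<odot>\<^bsub>M\<^esub> e i"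
        by (rule smult_assoc1[symmetric]) (use z c(1)[OF i] basis_closed[OF i] in auto)
      then show "z \<odot>\<^bsub>M\<^esub> (h (d i) u \<odot>\<^bsub>M\<^esub> e i) = \<zero>\<^bsub>M\<^esub>" using ann[OF c(2)[OF i]] basis_closed[OF i] by simp
    qed simp
    also have "\<dots> = \<zero>\<^bsub>M\<^esub>" by simp
    finally have zu: "z \<odot>\<^bsub>M\<^esub> u = \<zero>\<^bsub>M\<^esub>" .
    let ?c = "\<lambda>i\<in>{..<n}. if i = j then z else \<zero>"
    let ?o = "\<lambda>i\<in>{..<n}. \<zero>"
    have "lin b n ?c = lin b n (\<lambda>i. if i = j then z else \<zero>)" by (rule lin_comb_cong) (use bc z in auto)
    also have "\<dots> = z \<odot>\<^bsub>M\<^esub> b j" by (rule lin_comb_unit) (use bc j z in auto)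
    also have "\<dots> = \<zero>\<^bsub>M\<^esub>" using zu j by simp
    finally have 1: "lin b n ?c = \<zero>\<^bsub>M\<^esub>" .
    have "lin b n ?o = (\<Oplus>\<^bsub>M\<^esub> i\<in>{..<n}. \<zero>\<^bsub>M\<^esub>)"
      by (rule M.finsum_cong'[OF refl]) (use bc in auto)
    then have 2: "lin b n ?o = \<zero>\<^bsub>M\<^esub>" by simp
    have "?c = ?o"
      by (rule inj_onD[OF bij_betw_imp_inj_on[OF bij_lin[OF b]]]) (use 1 2 z in auto)
    then have "?c j = ?o j" by (rule fun_cong)
    then show False using j z by simp
  qed
qed

text \<open>
  Among the vectors that are isotropic over the residue field, those that are not unimodular are counted by
  the nonunits; the unimodular ones are equidistributed over the possible lengths, of which \<open>h u u\<close> is one.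
\<close>

lemma index_equation:
  assumes u: "u \<in> carrier M" "unimodular u" and iso: "\<phi> (h u u) = \<zero>\<^bsub>k\<^esub>"
  shows "card (rcosets\<^bsub>U\<^esub> (stabilizer U (\<lambda>g. g) u)) * card fixed_nonunits + card nonunits ^ m =
    card {w \<in> carrier M. \<phi> (h w w) = \<zero>\<^bsub>k\<^esub>}"
proof -
  have "h u u \<in> fixed_nonunits" using h_self_fixed[OF u(1)] iso u(1) by (simp add: fixed_nonunits_def nonunits_def)
  then show ?thesis
    unfolding card_rcosets_stabilizer[OF u iso] card_isotropic_split by (simp add: card_isotropic_lift)
qed

text \<open>
  The maximal ideal and its fixed part have sizes that are powers of \<open>q\<close>. The power \<open>q ^ E\<close> which is left of
  \<open>card nonunits ^ m\<close> after division by \<open>card fixed_nonunits\<close> is the power of \<open>q\<close> in the index.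
\<close>

context
  fixes u and E s :: nat
  assumes u: "u \<in> carrier M" "unimodular u" and iso: "\<phi> (h u u) = \<zero>\<^bsub>k\<^esub>"
    and cf: "card fixed_nonunits = k.q ^ s" and cn: "card nonunits ^ m = k.q ^ E * k.q ^ s"
begin

lemma q_nat_pos: "k.q > 0" using k.card_ge2 by simp

lemma index_odd:
  assumes "odd m"
  shows "card (rcosets\<^bsub>U\<^esub> (stabilizer U (\<lambda>g. g) u)) = k.q ^ E * (k.q ^ (m - 1) - 1)"
proof -
  let ?x = "card (rcosets\<^bsub>U\<^esub> (stabilizer U (\<lambda>g. g) u))"
  have "?x * k.q ^ s + k.q ^ E * k.q ^ s = k.q ^ (m - 1) * (k.q ^ E * k.q ^ s)"
    using index_equation[OF u iso] card_isotropic_odd[OF assms] by (simp only: cf cn)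
  then have "(?x + k.q ^ E) * k.q ^ s = (k.q ^ (m - 1) * k.q ^ E) * k.q ^ s"
    by (simp only: add_mult_distrib mult.assoc)
  then have "?x + k.q ^ E = k.q ^ (m - 1) * k.q ^ E" using q_nat_pos by simp
  then have "?x = k.q ^ (m - 1) * k.q ^ E - k.q ^ E" by simp
  also have "\<dots> = k.q ^ E * (k.q ^ (m - 1) - 1)" by (simp add: diff_mult_distrib2 mult.commute)
  finally show ?thesis .
qed

lemma index_real:
  assumes "real (card {w \<in> carrier M. \<phi> (h w w) = \<zero>\<^bsub>k\<^esub>}) = real (card nonunits) ^ m * c"
  shows "real (card (rcosets\<^bsub>U\<^esub> (stabilizer U (\<lambda>g. g) u))) = real k.q ^ E * (c - 1)"
proof -
  let ?x = "card (rcosets\<^bsub>U\<^esub> (stabilizer U (\<lambda>g. g) u))" and ?Q = "real k.q ^ s" and ?P = "real k.q ^ E"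
  have "real (?x * card fixed_nonunits + card nonunits ^ m) = real (card nonunits) ^ m * c"
    by (simp only: index_equation[OF u iso] assms)
  moreover have R: "real (card nonunits) ^ m = ?P * ?Q" using cn by (simp flip: of_nat_power of_nat_mult)
  moreover have "real (?x * card fixed_nonunits + card nonunits ^ m) = real ?x * ?Q + real (card nonunits) ^ m"
    by (simp add: cf)
  ultimately have "real ?x * ?Q + ?P * ?Q = ?P * ?Q * c" by (simp only:)
  then have "(real ?x - ?P * (c - 1)) * ?Q = 0" by (simp add: algebra_simps)
  moreover have "?Q \<noteq> 0" using q_nat_pos by simp
  ultimately have "real ?x - ?P * (c - 1) = 0" by (simp only: mult_eq_0_iff simp_thms)
  then show ?thesis by (simp only: right_minus_eq)
qed

lemma index_kind_I:
  assumes m: "m = 2 * r" "r > 0" and kind: "alternating_diagonal B M m h \<one>"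
  shows "card (rcosets\<^bsub>U\<^esub> (stabilizer U (\<lambda>g. g) u)) = k.q ^ E * (k.q ^ r - 1) * (k.q ^ (r - 1) + 1)"
proof -
  have real_diff: "real (k.q ^ n - 1) = real k.q ^ n - 1" for n
    using q_nat_pos by (simp add: of_nat_diff Suc_le_eq)
  obtain r' where r': "r = Suc r'" using m(2) by (cases r) auto
  have "real (card (rcosets\<^bsub>U\<^esub> (stabilizer U (\<lambda>g. g) u))) =
    real k.q ^ E * ((real k.q ^ m / real k.q - real k.q ^ r / real k.q + real k.q ^ r) - 1)"
    by (rule index_real[OF card_isotropic_kind_I[OF m kind]])
  also have "\<dots> = real k.q ^ E * (real k.q ^ r - 1) * (real k.q ^ (r - 1) + 1)"
    unfolding m(1) r' using q_pos by (simp add: field_simps power_add mult_2 mult_2_right power2_eq_square)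
  also have "\<dots> = real (k.q ^ E * (k.q ^ r - 1) * (k.q ^ (r - 1) + 1))"
    by (simp only: of_nat_mult of_nat_add of_nat_power of_nat_1 real_diff)
  finally show ?thesis by (simp only: of_nat_eq_iff)
qed

lemma index_kind_II:
  assumes m: "m = 2 * r" "r > 0" and kind: "alternating_diagonal B M m h \<epsilon>"
    and \<epsilon>: "\<epsilon> \<in> carrier B" "\<not> (\<exists>x\<in>carrier k. \<phi> \<epsilon> = x \<otimes>\<^bsub>k\<^esub> x)"
  shows "card (rcosets\<^bsub>U\<^esub> (stabilizer U (\<lambda>g. g) u)) = k.q ^ E * (k.q ^ r + 1) * (k.q ^ (r - 1) - 1)"
proof -
  have real_diff: "real (k.q ^ n - 1) = real k.q ^ n - 1" for n
    using q_nat_pos by (simp add: of_nat_diff Suc_le_eq)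
  obtain r' where r': "r = Suc r'" using m(2) by (cases r) auto
  have "real (card (rcosets\<^bsub>U\<^esub> (stabilizer U (\<lambda>g. g) u))) =
    real k.q ^ E * ((real k.q ^ m / real k.q - real k.q ^ r + real k.q ^ r / real k.q) - 1)"
    by (rule index_real[OF card_isotropic_kind_II[OF m kind \<epsilon>]])
  also have "\<dots> = real k.q ^ E * (real k.q ^ r + 1) * (real k.q ^ (r - 1) - 1)"
    unfolding m(1) r' using q_pos by (simp add: field_simps power_add mult_2 mult_2_right power2_eq_square)
  also have "\<dots> = real (k.q ^ E * (k.q ^ r + 1) * (k.q ^ (r - 1) - 1))"
    by (simp only: of_nat_mult of_nat_add of_nat_power of_nat_1 real_diff)
  finally show ?thesis by (simp only: of_nat_eq_iff)
qed

end

end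

theorem theorem8p3:
  fixes F :: "'f ring" and K :: "'f set" and v :: "'f \<Rightarrow> int" and \<pi> \<rho> :: 'f and \<sigma> :: "'f \<Rightarrow> 'f"
    and \<R> :: "'f ring" and \<P> :: "'f set"
    and A :: "'f set ring" and \<rr> :: "'f set set"
    and B Rbar :: "'f set set ring" and mbar :: "'f set set set" and \<epsilon> t :: "'f set set"
    and V :: "('f set, 'v) module" and h :: "'v \<Rightarrow> 'v \<Rightarrow> 'f set"
    and Vbar :: "('f set set, 'v set) module" and hbar :: "'v set \<Rightarrow> 'v set \<Rightarrow> 'f set set"
    and u :: "'v set" and U :: "('v set \<Rightarrow> 'v set) monoid" and S :: "('v set \<Rightarrow> 'v set) set"
    and q l m :: nat
  assumes "l \<ge> 1" and "m \<ge> 2"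
    and "ramified_quadratic_extension F K v \<pi> \<rho> \<sigma>"
    and "q = card (carrier (residue_field (F\<lparr>carrier := K\<rparr>) v))"
    and "\<R> = ext_integers F K v \<rho>"
    and "\<P> = PIdl\<^bsub>\<R>\<^esub> \<rho>"
    and "A = \<R> Quot ideal_power \<R> \<P> (2 * l)"
    and "maximalideal \<rr> A"
    and "B = A Quot ideal_power A \<rr> l"
    and "Rbar = fixed_ring B (image (image \<sigma>))"
    and "maximalideal mbar Rbar"
    and "\<epsilon> \<in> Units Rbar" and "\<not> (\<exists>x \<in> Units Rbar. \<epsilon> = x \<otimes>\<^bsub>Rbar\<^esub> x)"
    and "free_of_rank A V m"
    and "hermitian_form A (image \<sigma>) V h" and "nondegenerate A V h"
    and "Vbar = quot_module V (ideal_power A \<rr> l)"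
    and "hbar = quot_form A (ideal_power A \<rr> l) h"
    and "U = unitary_group B Vbar hbar"
    and "primitive_vector B Vbar u"
    and "t = hbar u u"
    and "S = stabilizer U (\<lambda>g. g) u"
    and "t \<in> mbar"
  shows
    "(\<forall>f. l = 2 * f - 1 \<and> odd m \<longrightarrow>
        card (rcosets\<^bsub>U\<^esub> S) = q ^ (m * l + f - m - l) * (q ^ (m - 1) - 1)) \<and>
     (\<forall>f r. l = 2 * f - 1 \<and> m = 2 * r \<longrightarrow>
        (kind_I B Vbar m hbar \<longrightarrow>
           card (rcosets\<^bsub>U\<^esub> S) = q ^ (m * l + f - m - l) * (q ^ r - 1) * (q ^ (r - 1) + 1)) \<and>
        (kind_II B \<epsilon> Vbar m hbar \<longrightarrow>
           card (rcosets\<^bsub>U\<^esub> S) = q ^ (m * l + f - m - l) * (q ^ r + 1) * (q ^ (r - 1) - 1))) \<and>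
     (\<forall>f. l = 2 * f \<and> odd m \<longrightarrow>
        card (rcosets\<^bsub>U\<^esub> S) = q ^ (l * m + f + 1 - m - l) * (q ^ (m - 1) - 1)) \<and>
     (\<forall>f r. l = 2 * f \<and> m = 2 * r \<longrightarrow>
        (kind_I B Vbar m hbar \<longrightarrow>
           card (rcosets\<^bsub>U\<^esub> S) = q ^ (l * m + f + 1 - m - l) * (q ^ r - 1) * (q ^ (r - 1) + 1)) \<and>
        (kind_II B \<epsilon> Vbar m hbar \<longrightarrow>
           card (rcosets\<^bsub>U\<^esub> S) = q ^ (l * m + f + 1 - m - l) * (q ^ r + 1) * (q ^ (r - 1) - 1)))"
proof -
  let ?K = "F\<lparr>carrier := K\<rparr>"
  let ?k = "residue_field ?K v"
  interpret R2: ramified_quadratic_extension F K v \<pi> \<rho> \<sigma> by (rule assms(3))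
  have l: "l > 0" "2 * l > 0" using assms(1) by simp_all
  have \<R>_eq: "\<R> = F\<lparr>carrier := R2.order_set\<rparr>" using assms(5) R2.order_eq by simp
  interpret UR: uniformized \<R> ?k R2.residue \<sigma> \<rho> unfolding \<R>_eq by (rule R2.\<R>_uniformized)
  have "\<P> = UR.nonunits" unfolding assms(6) \<R>_eq R2.\<R>_prime ..
  then have A_eq: "A = \<R> Quot UR.level (2 * l)" using assms(7) UR.ideal_power_nonunits by simp
  define \<phi>A where "\<phi>A = (\<lambda>C. the_elem (R2.residue ` C))"
  define \<beta>A where "\<beta>A = UR.level (2 * l) +>\<^bsub>\<R>\<^esub> \<rho>"
  interpret UA: uniformized A ?k \<phi>A "image \<sigma>" \<beta>A
    unfolding A_eq \<phi>A_def \<beta>A_def by (rule UR.quot_uniformized[OF l(2)])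
  have "\<rho> [^]\<^bsub>\<R>\<^esub> (l - 1) \<noteq> \<zero>\<^bsub>\<R>\<^esub>" unfolding \<R>_eq by (rule R2.\<rho>_pow_nonzero)
  then have \<beta>A_nz: "\<beta>A [^]\<^bsub>A\<^esub> (l - 1) \<noteq> \<zero>\<^bsub>A\<^esub>"
    unfolding A_eq \<beta>A_def by (intro UR.quot_pow_nonzero[OF l(2)]) (use l in auto)
  define I where "I = UA.level l"
  have "\<rr> = UA.nonunits" by (rule UA.maximalideal_eq_nonunits[OF assms(8)])
  then have I_eq: "ideal_power A \<rr> l = I" using UA.ideal_power_nonunits by (simp add: I_def)
  have B_eq: "B = A Quot I" using assms(9) I_eq by simp
  define \<phi>B where "\<phi>B = (\<lambda>C. the_elem (\<phi>A ` C))"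
  define \<beta>B where "\<beta>B = I +>\<^bsub>A\<^esub> \<beta>A"
  interpret UB: uniformized B ?k \<phi>B "image (image \<sigma>)" \<beta>B
    unfolding B_eq I_def \<phi>B_def \<beta>B_def by (rule UA.quot_uniformized[OF l(1)])
  have nil: "\<beta>B [^]\<^bsub>B\<^esub> l = \<zero>\<^bsub>B\<^esub>"
    unfolding B_eq \<beta>B_def I_def by (rule UA.quot_pow_top[OF l(1)])
  have not_nil: "\<beta>B [^]\<^bsub>B\<^esub> (l - 1) \<noteq> \<zero>\<^bsub>B\<^esub>"
    unfolding B_eq \<beta>B_def I_def by (rule UA.quot_pow_nonzero[OF l(1) _ \<beta>A_nz]) (use l in simp)
  have q_eq: "q = card (carrier ?k)" by (rule assms(4))
  have fin: "finite (carrier B)" by (rule UB.finite_carrier_B[OF l(1) nil not_nil])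
  have cn: "card UB.nonunits = q ^ (l - 1)" unfolding q_eq by (rule UB.card_nonunits[OF l(1) nil not_nil])
  have cf: "card UB.fixed_nonunits = q ^ (f - 1)" if "f > 0" "l = 2 * f - 1 \<or> l = 2 * f" for f
    unfolding q_eq by (rule UB.card_fixed_nonunits[OF l(1) nil not_nil that])
  obtain e where mod: "module A V" and e: "module_basis A V m e"
    using assms(14) unfolding free_of_rank_def by blast
  interpret HR: hermitian_reduction A V I "image \<sigma>" h m e
  proof (intro hermitian_reduction.intro hermitian_reduction_axioms.intro mod e assms(15,16))
    show "ideal I A" unfolding I_def by (rule UA.level_ideal)
    show "\<sigma> ` a \<in> I" if "a \<in> I" for a using that unfolding I_def by (rule UA.level_\<tau>)
    show "image \<sigma> ` (I +>\<^bsub>A\<^esub> a) = I +>\<^bsub>A\<^esub> \<sigma> ` a" if "a \<in> carrier A" for a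
      unfolding I_def by (rule UA.\<tau>_coset[OF l(1) that])
  qed
  have Vbar_eq: "Vbar = quot_module V I" and hbar_eq: "hbar = quot_form A I h"
    using assms(17,18) I_eq by simp_all
  obtain d where d: "\<forall>i<m. d i \<in> carrier Vbar \<and>
      (\<forall>j<m. hbar (d i) (HR.N +>\<^bsub>V\<^esub> e j) = (if i = j then \<one>\<^bsub>B\<^esub> else \<zero>\<^bsub>B\<^esub>))"
    using HR.hbar_dual unfolding Vbar_eq hbar_eq B_eq by blast
  interpret H: hermitian_space B ?k \<phi>B "image (image \<sigma>)" Vbar hbar m "\<lambda>i. HR.N +>\<^bsub>V\<^esub> e i" d
  proof (intro hermitian_space.intro finite_local_involution.intro finite_local_involution_axioms.intro
      hermitian_space_axioms.intro UB.local_involution_axioms fin)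
    show "module B Vbar" unfolding B_eq Vbar_eq by (rule HR.Vbar_module)
    show "hermitian_form B (image (image \<sigma>)) Vbar hbar" unfolding B_eq Vbar_eq hbar_eq by (rule HR.hbar_hermitian)
    show "module_basis B Vbar m (\<lambda>i. HR.N +>\<^bsub>V\<^esub> e i)" unfolding B_eq Vbar_eq by (rule HR.Vbar_basis)
    show "d i \<in> carrier Vbar" if "i < m" for i using d that by blast
    show "hbar (d i) (HR.N +>\<^bsub>V\<^esub> e j) = (if i = j then \<one>\<^bsub>B\<^esub> else \<zero>\<^bsub>B\<^esub>)" if "i < m" "j < m" for i j
      using d that by blast
  qed
  \<comment> \<open>The last nonzero power of the uniformizer spans the annihilator of the maximal ideal.\<close>
  have z: "\<beta>B [^]\<^bsub>B\<^esub> (l - 1) \<in> carrier B" by simp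
  have ann: "\<beta>B [^]\<^bsub>B\<^esub> (l - 1) \<otimes>\<^bsub>B\<^esub> x = \<zero>\<^bsub>B\<^esub>" if x: "x \<in> UB.nonunits" for x
  proof -
    obtain y where y: "y \<in> carrier B" "x = \<beta>B \<otimes>\<^bsub>B\<^esub> y" using x unfolding UB.nonunits_eq by blast
    have "\<beta>B [^]\<^bsub>B\<^esub> (l - 1) \<otimes>\<^bsub>B\<^esub> x = \<beta>B [^]\<^bsub>B\<^esub> Suc (l - 1) \<otimes>\<^bsub>B\<^esub> y"
      unfolding y(2) using y(1) by (simp add: UB.R.m_assoc)
    also have "\<dots> = \<zero>\<^bsub>B\<^esub>" using nil l(1) y(1) by simp
    finally show ?thesis .
  qed
  note u = H.primitive_unimodular[OF assms(20) z not_nil ann]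
  have "maximalideal mbar (fixed_ring B (image (image \<sigma>)))" using assms(10,11) by simp
  from UB.maximal_fixed_nonunit(2)[OF this assms(23)]
  have iso: "\<phi>B (hbar u u) = \<zero>\<^bsub>?k\<^esub>" unfolding assms(21) .
  have \<epsilon>: "\<epsilon> \<in> carrier B" "\<not> (\<exists>x\<in>carrier ?k. \<phi>B \<epsilon> = x \<otimes>\<^bsub>?k\<^esub> x)"
    using UB.fixed_ring_UnitsD(1) UB.fixed_closed(1) H.nonsquare_residue assms(10,12,13) by auto
  have S_eq: "rcosets\<^bsub>U\<^esub> S = rcosets\<^bsub>H.U\<^esub> (stabilizer H.U (\<lambda>g. g) u)" unfolding assms(19,22) ..
  have cnm: "card UB.nonunits ^ m = card (carrier ?k) ^ E * card (carrier ?k) ^ s" if "E + s = (l - 1) * m" for E s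
    unfolding cn q_eq by (simp only: power_mult[symmetric] power_add[symmetric] that)
  \<comment> \<open>The truncated subtractions in the exponents are genuine since \<open>m \<ge> 2\<close>.\<close>
  have odd_exp: "(m * l + f - m - l) + (f - 1) = (l - 1) * m" "f > 0" if "l = 2 * f - 1" for f
  proof -
    show f: "f > 0" using that l by (cases f) auto
    obtain g where g: "f = Suc g" using f by (cases f) auto
    have "g \<le> g * m" using assms(2) by simp
    moreover have "l = Suc (2 * g)" using that g by simp
    ultimately show "(m * l + f - m - l) + (f - 1) = (l - 1) * m" by (simp add: g algebra_simps)
  qed
  have even_exp: "(l * m + f + 1 - m - l) + (f - 1) = (l - 1) * m" "f > 0" if "l = 2 * f" for f
  proof -
    show f: "f > 0" using that l by (cases f) auto
    obtain g where g: "f = Suc g" using f by (cases f) auto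
    have "g * 1 \<le> g * (m * 2)" using assms(2) by (intro mult_le_mono2) simp
    then have "g \<le> m + g * (m * 2)" by linarith
    moreover have "l = Suc (Suc (2 * g))" using that g by simp
    ultimately show "(l * m + f + 1 - m - l) + (f - 1) = (l - 1) * m" by (simp add: g algebra_simps)
  qed
  have cf': "card UB.fixed_nonunits = card (carrier ?k) ^ (f - 1)" if "f > 0" "l = 2 * f - 1 \<or> l = 2 * f" for f
    using cf[OF that] q_eq by simp
  have main: "(odd m \<longrightarrow> card (rcosets\<^bsub>U\<^esub> S) = q ^ E * (q ^ (m - 1) - 1)) \<and>
    (\<forall>r. m = 2 * r \<longrightarrow>
      (kind_I B Vbar m hbar \<longrightarrow> card (rcosets\<^bsub>U\<^esub> S) = q ^ E * (q ^ r - 1) * (q ^ (r - 1) + 1)) \<and>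
      (kind_II B \<epsilon> Vbar m hbar \<longrightarrow> card (rcosets\<^bsub>U\<^esub> S) = q ^ E * (q ^ r + 1) * (q ^ (r - 1) - 1)))"
    if f: "f > 0" "l = 2 * f - 1 \<or> l = 2 * f" and E: "E + (f - 1) = (l - 1) * m" for E f
  proof -
    note pre = u iso cf'[OF f] cnm[OF E]
    have r: "r > 0" if "m = 2 * r" for r using that assms(2) by simp
    show ?thesis
      using H.index_odd[OF pre] H.index_kind_I[OF pre _ r] H.index_kind_II[OF pre _ r _ \<epsilon>]
      unfolding kind_I_def kind_II_def S_eq q_eq by blast
  qed
  show ?thesis
    using main[OF odd_exp(2) _ odd_exp(1)] main[OF even_exp(2) _ even_exp(1)] by blast
qed

end
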